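(* Let $\mathbb K$ be a field of characteristic $0$, let $(\mathbf C,\otimes,I,\gamma)$ be a symmetric strict monoidal $\mathrm{Ch}^{[-1,0]}_{\mathbb K}$-category, let $t:\otimes\Rightarrow\otimes$ be a coherent totally symmetric strict infinitesimal 2-braiding on it, and let $T$ be a coboundary infinitesimal syllepsis for $t$. Then $\Sigma:=h\gamma T$, i.e. $\Sigma_{UV}=h\,\gamma_{UV}T_{UV}$, is a symmetric syllepsis on the braided pentagonal strictly-unital monoidal $\mathrm{Ch}^{[-1,0]}_{\mathbb K[h]/(h^3)}$-category $$\Big(\mathbf C_{\mathbb K[h]/(h^3)},\ \otimes,\ I,\ \alpha:=1+\tfrac{h^2}{24}[t_{12},t_{23}],\ \sigma:=\gamma e^{\frac h2t},\ \mathcal H^L:=\tfrac{h^2}{24}\gamma_{1(23)}\mathsf h^L,\ \mathcal H^R:=\tfrac{h^2}{24}\gamma_{(12)3}\mathsf h^R\Big).$$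
   Context: **Enriched setting.** Let $R$ be a commutative $\mathbb K$-algebra (used for $R=\mathbb K$ and $R=\mathbb K[h]/(h^3)$). $\mathrm{Ch}^{[-1,0]}_R$ denotes cochain complexes of $R$-modules concentrated in degrees $-1,0$, with the truncated tensor product (products of two degree $-1$ elements vanish and $(\partial\phi)\otimes\phi'=\phi\otimes\partial\phi'$ for degree $-1$ elements). Thus a $\mathrm{Ch}^{[-1,0]}_R$-category $\mathbf C$ has $R$-modules $\mathbf C[U,V]^0$ (1-cells) and $\mathbf C[U,V]^{-1}$ (2-cells, or homotopies), $R$-linear maps $\partial:\mathbf C[U,V]^{-1}\to\mathbf C[U,V]^0$, and an $R$-bilinear associative unital degree-preserving composition (juxtaposition) in which composites of two 2-cells vanish, $\partial(f\phi)=f\,\partial\phi$, $\partial(\phi f)=(\partial\phi)f$ and $(\partial\phi)\phi'=\phi\,\partial\phi'$ for 1-cells $f$ and 2-cells $\phi,\phi'$. $\mathbf C\boxtimes\mathbf D$ has pairs $UV$ as objects, truncated tensor products as hom complexes, and $(f'\boxtimes g')(f\boxtimes g)=f'f\boxtimes g'g$. For the $\mathrm{Ch}^{[-1,0]}_R$-functor $\otimes$ one thus also has $\phi\otimes\phi'=0$ and $(\partial\phi)\otimes\phi'=\phi\otimes\partial\phi'$ for 2-cells. $\mathbf C_{\mathbb K[h]/(h^3)}$ has the same objects as $\mathbf C$, with homs tensored with $\mathbb K[h]/(h^3)$ and all structure extended linearly. **Pseudonatural transformations.** For $\mathrm{Ch}^{[-1,0]}_R$-functors $F,G:\mathbf C\to\mathbf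 D$, a pseudonatural transformation $\xi:F\Rightarrow G$ consists of 1-cells $\xi_U\in\mathbf D[F(U),G(U)]^0$ and $R$-linear maps $f\mapsto\xi_f$, $\mathbf C[U,U']^0\to\mathbf D[F(U),G(U')]^{-1}$, with $G(f)\xi_U-\xi_{U'}F(f)=\partial\xi_f$ for 1-cells $f$, $G(q)\xi_U-\xi_{U'}F(q)=\xi_{\partial q}$ for 2-cells $q$, $\xi_{1_U}=0$, and $\xi_{f'f}=\xi_{f'}F(f)+G(f')\xi_f$. It is $\mathrm{Ch}^{[-1,0]}_R$-natural if all $\xi_f=0$. Vertical composition: $(\theta\xi)_U=\theta_U\xi_U$, $(\theta\xi)_f=\theta_f\xi_U+\theta_{U'}\xi_f$; the identity $1$ has $1_f=0$; sums and scalar multiples are componentwise; $[\xi,\theta]=\xi\theta-\theta\xi$. If all $\xi_U$ are invertible, $\xi$ has inverse $(\xi^{-1})_U=(\xi_U)^{-1}$, $(\xi^{-1})_f=-(\xi_{U'})^{-1}\xi_f(\xi_U)^{-1}$. A modification $\Xi:\xi\Rrightarrow\xi'$ is a family of 2-cells $\Xi_U\in\mathbf D[F(U),G(U)]^{-1}$ with $\xi_U-\xi'_U=\partial\Xi_U$ and $\Xi_{U'}F(f)+\xi_f=\xi'_f+G(f)\Xi_U$. If $\xi,\xi'$ are invertible, $\Xi^{-1}:\xi^{-1}\Rrightarrow\xi'^{-1}$ has components $(\Xi^{-1})_U=-(\xi_U)^{-1}\Xi_U(\xi'_U)^{-1}$. **Symmetric strict monoidal categories.** $(\mathbf C,\otimes,I,\gamma)$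 consists of a $\mathrm{Ch}^{[-1,0]}_R$-category, a strictly associative and strictly unital $\mathrm{Ch}^{[-1,0]}_R$-functor $\otimes:\mathbf C\boxtimes\mathbf C\to\mathbf C$ (on objects $(UV)$; brackets in subscripts only record the grouping of arguments), and a $\mathrm{Ch}^{[-1,0]}_R$-natural isomorphism $\gamma_{UV}:(UV)\to(VU)$ with $\gamma_{VU}\gamma_{UV}=1_{(UV)}$ and $\gamma_{U(VW)}=(1_V\otimes\gamma_{UW})(\gamma_{UV}\otimes1_W)$. **Infinitesimal 2-braidings.** An infinitesimal 2-braiding is a pseudonatural transformation $t:\otimes\Rightarrow\otimes$, with components $t_{UV}$ and $t_{f\boxtimes g}\in\mathbf C[(UV),(U'V')]^{-1}$ for $f:U\to U'$, $g:V\to V'$. It is strict if for all objects $U,V,W$ and 1-cells $f:U\to U'$, $g:V\to V'$, $k:W\to W'$: $t_{U(VW)}=t_{UV}\otimes1_W+(\gamma_{VU}\otimes1_W)(1_V\otimes t_{UW})(\gamma_{UV}\otimes1_W)$, $t_{f\boxtimes(g\otimes k)}=t_{f\boxtimes g}\otimes k+(\gamma_{V'U'}\otimes1_{W'})(g\otimes t_{f\boxtimes k})(\gamma_{UV}\otimes1_W)$, $t_{(UV)W}=1_U\otimes t_{VW}+(1_U\otimes\gamma_{WV})(t_{UW}\otimes1_V)(1_U\otimes\gamma_{VW})$, $t_{(f\otimes g)\boxtimes k}=f\otimes t_{g\boxtimes k}+(1_{U'}\otimes\gamma_{W'V'})(t_{f\boxtimes k}\otimes g)(1_U\otimes\gamma_{VW})$.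 It is symmetric if $\gamma_{UV}t_{UV}=t_{VU}\gamma_{UV}$ and $\gamma_{U'V'}t_{f\boxtimes g}=t_{g\boxtimes f}\gamma_{UV}$; it is totally symmetric if it is symmetric and $t_{\gamma_{UV}\boxtimes1_W}=0$ for all $U,V,W$. It is coherent if for all $U,V,W$ $-(\gamma_{VU}\otimes1_W)t_{1_V\boxtimes t_{UW}}(\gamma_{UV}\otimes1_W)=t_{t_{UV}\boxtimes1_W}+t_{1_U\boxtimes t_{VW}}=-(1_U\otimes\gamma_{WV})t_{t_{UW}\boxtimes1_V}(1_U\otimes\gamma_{VW})$. **Coboundary infinitesimal syllepsis.** A family of 2-cells $T_{UV}\in\mathbf C[(UV),(UV)]^{-1}$ such that for all objects $U,V,W$ and 1-cells $f:U\to U'$, $g:V\to V'$: (1) $\partial T_{UV}=t_{UV}$; (2) $(f\otimes g)T_{UV}-T_{U'V'}(f\otimes g)=t_{f\boxtimes g}$; (3) $T_{U(VW)}=T_{UV}\otimes1_W+(\gamma_{VU}\otimes1_W)(1_V\otimes T_{UW})(\gamma_{UV}\otimes1_W)$; (4) $T_{(UV)W}=1_U\otimes T_{VW}+(1_U\otimes\gamma_{WV})(T_{UW}\otimes1_V)(1_U\otimes\gamma_{VW})$; (5) $T_{UV}=\gamma_{VU}T_{VU}\gamma_{UV}$. **The data.** $t_{12},t_{23}$ are the pseudonatural endomorphisms of $\otimes^2:\mathbf C^{\boxtimes3}\to\mathbf C$ with components $(t_{12})_{UVW}=t_{UV}\otimes1_W$, $(t_{12})_{f\boxtimes g\boxtimes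 k}=t_{f\boxtimes g}\otimes k$, $(t_{23})_{UVW}=1_U\otimes t_{VW}$, $(t_{23})_{f\boxtimes g\boxtimes k}=f\otimes t_{g\boxtimes k}$. $\gamma e^{\frac h2t}=\gamma(1+\frac h2t+\frac{h^2}8t^2)$ modulo $h^3$. With $\mathcal L_{UVW}=t_{t_{UV}\boxtimes1_W}$, $\mathcal R_{UVW}=t_{1_U\boxtimes t_{VW}}$, $\mathsf h^L=2\mathcal L+\mathcal R$, $\mathsf h^R=\mathcal L+2\mathcal R$, one has $\mathcal H^L_{UVW}=\frac{h^2}{24}\gamma_{U(VW)}\mathsf h^L_{UVW}$, $\mathcal H^R_{UVW}=\frac{h^2}{24}\gamma_{(UV)W}\mathsf h^R_{UVW}$. These are modifications with components $\mathcal H^L_{UVW}:\alpha_{VWU}\sigma_{U(VW)}\alpha_{UVW}\Rrightarrow(1_V\otimes\sigma_{UW})\alpha_{VUW}(\sigma_{UV}\otimes1_W)$ and $\mathcal H^R_{UVW}:\alpha^{-1}_{WUV}\sigma_{(UV)W}\alpha^{-1}_{UVW}\Rrightarrow(\sigma_{UW}\otimes1_V)\alpha^{-1}_{UWV}(1_U\otimes\sigma_{VW})$, and the pentagonator is trivial; in the paper this structure is a braided pentagonal strictly-unital monoidal category under the stated hypotheses on $t$. **Symmetric syllepsis** on such data: a family of 2-cells $\Sigma_{UV}\in\mathbf C_{\mathbb K[h]/(h^3)}[(UV),(VU)]^{-1}$ such that for all objects and 1-cells: (i) $\partial\Sigma_{UV}=\sigma_{UV}-\sigma^{-1}_{VU}$;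 (ii) $\Sigma_{U'V'}(f\otimes g)+\sigma_{f\boxtimes g}=\sigma^{-1}_{g\boxtimes f}+(g\otimes f)\Sigma_{UV}$ (with $\sigma^{-1}_{g\boxtimes f}$ the homotopy component of the inverse $\sigma^{-1}$); (iii) $\mathcal H^L_{UVW}=\alpha_{VWU}\Sigma_{U(VW)}\alpha_{UVW}+(\mathcal H^R)^{-1}_{VWU}-(1_V\otimes\sigma^{-1}_{WU})\alpha_{VUW}(\Sigma_{UV}\otimes1_W)-(1_V\otimes\Sigma_{UW})\alpha_{VUW}(\sigma_{UV}\otimes1_W)$; (iv) $\mathcal H^R_{UVW}=\alpha^{-1}_{WUV}\Sigma_{(UV)W}\alpha^{-1}_{UVW}+(\mathcal H^L)^{-1}_{WUV}-(\sigma^{-1}_{WU}\otimes1_V)\alpha^{-1}_{UWV}(1_U\otimes\Sigma_{VW})-(\Sigma_{UW}\otimes1_V)\alpha^{-1}_{UWV}(1_U\otimes\sigma_{VW})$; (v) (symmetry) $\Sigma_{UV}=\sigma^{-1}_{VU}\Sigma_{VU}\sigma_{UV}$. *)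

theory Defs
  imports "HOL-Algebra.Module"
begin

section \<open>Linear and bilinear maps between modules\<close>

definition linear_map ::
    "('r, 'q) ring_scheme \<Rightarrow> ('r, 'm) module \<Rightarrow> ('r, 'n) module \<Rightarrow> ('m \<Rightarrow> 'n) \<Rightarrow> bool" where
  "linear_map R M N f \<longleftrightarrow>
     (\<forall>x \<in> carrier M. f x \<in> carrier N) \<and>
     (\<forall>x \<in> carrier M. \<forall>y \<in> carrier M. f (x \<oplus>\<^bsub>M\<^esub> y) = f x \<oplus>\<^bsub>N\<^esub> f y) \<and>
     (\<forall>r \<in> carrier R. \<forall>x \<in> carrier M. f (r \<odot>\<^bsub>M\<^esub> x) = r \<odot>\<^bsub>N\<^esub> f x)"

definition bilinear_map ::
    "('r, 'q) ring_scheme \<Rightarrow> ('r, 'm) module \<Rightarrow> ('r, 'n) module \<Rightarrow> ('r, 'p) module \<Rightarrow>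
     ('m \<Rightarrow> 'n \<Rightarrow> 'p) \<Rightarrow> bool" where
  "bilinear_map R M N P b \<longleftrightarrow>
     (\<forall>x \<in> carrier M. linear_map R N P (b x)) \<and>
     (\<forall>y \<in> carrier N. linear_map R M P (\<lambda>x. b x y))"


section \<open>Categories enriched in two-term complexes\<close>

text \<open>
  The objects are all elements of the type \<open>'o\<close>; \<open>'a\<close> and \<open>'b\<close> are the types of 1-cells
  (degree 0) and of 2-cells (degree -1). As usual, cells determine their source and target
  (\<open>dom\<close>, \<open>cod\<close>), so that compositions need no object arguments. The subscripts of an operation
  are the dimensions of its arguments: \<open>f \<cdot>\<^sub>1\<^sub>2 \<phi>\<close> is the composite of the 1-cell \<open>f\<close> after the 2-cell
  \<open>\<phi>\<close>. Composites of two 2-cells vanish and are therefore not recorded.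
\<close>

record ('o, 'r, 'a, 'b) ch_cat =
  Cell1 :: "'o \<Rightarrow> 'o \<Rightarrow> ('r, 'a) module"
  Cell2 :: "'o \<Rightarrow> 'o \<Rightarrow> ('r, 'b) module"
  dom1 :: "'a \<Rightarrow> 'o"
  cod1 :: "'a \<Rightarrow> 'o"
  dom2 :: "'b \<Rightarrow> 'o"
  cod2 :: "'b \<Rightarrow> 'o"
  bdry :: "'b \<Rightarrow> 'a" (\<open>\<partial>\<index> _\<close> [81] 80)
  ident :: "'o \<Rightarrow> 'a" (\<open>\<one>\<^sub>1\<index> _\<close> [81] 80)
  comp11 :: "'a \<Rightarrow> 'a \<Rightarrow> 'a" (infixl \<open>\<cdot>\<^sub>1\<^sub>1\<index>\<close> 70)
  comp12 :: "'a \<Rightarrow> 'b \<Rightarrow> 'b" (infixl \<open>\<cdot>\<^sub>1\<^sub>2\<index>\<close> 70)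
  comp21 :: "'b \<Rightarrow> 'a \<Rightarrow> 'b" (infixl \<open>\<cdot>\<^sub>2\<^sub>1\<index>\<close> 70)

locale ch_category = cring R
  for R :: "('r, 'q) ring_scheme" +
  fixes C :: "('o, 'r, 'a, 'b, 'z) ch_cat_scheme" (structure)
  assumes module_Cell1: "module R (Cell1 C U V)"
    and module_Cell2: "module R (Cell2 C U V)"
    and dom_cod1: "f \<in> carrier (Cell1 C U V) \<Longrightarrow> dom1 C f = U \<and> cod1 C f = V"
    and dom_cod2: "\<phi> \<in> carrier (Cell2 C U V) \<Longrightarrow> dom2 C \<phi> = U \<and> cod2 C \<phi> = V"
    and bdry_linear: "linear_map R (Cell2 C U V) (Cell1 C U V) (bdry C)"
    and comp11_bilinear:
      "bilinear_map R (Cell1 C V W) (Cell1 C U V) (Cell1 C U W) (comp11 C)"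
    and comp12_bilinear:
      "bilinear_map R (Cell1 C V W) (Cell2 C U V) (Cell2 C U W) (comp12 C)"
    and comp21_bilinear:
      "bilinear_map R (Cell2 C V W) (Cell1 C U V) (Cell2 C U W) (comp21 C)"
    and ident_closed: "\<one>\<^sub>1 U \<in> carrier (Cell1 C U U)"
    and ident11: "f \<in> carrier (Cell1 C U V) \<Longrightarrow> \<one>\<^sub>1 V \<cdot>\<^sub>1\<^sub>1 f = f \<and> f \<cdot>\<^sub>1\<^sub>1 \<one>\<^sub>1 U = f"
    and ident2: "\<phi> \<in> carrier (Cell2 C U V) \<Longrightarrow> \<one>\<^sub>1 V \<cdot>\<^sub>1\<^sub>2 \<phi> = \<phi> \<and> \<phi> \<cdot>\<^sub>2\<^sub>1 \<one>\<^sub>1 U = \<phi>"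
    and assoc111:
      "\<lbrakk>f \<in> carrier (Cell1 C U V); g \<in> carrier (Cell1 C V W); k \<in> carrier (Cell1 C W X)\<rbrakk>
        \<Longrightarrow> (k \<cdot>\<^sub>1\<^sub>1 g) \<cdot>\<^sub>1\<^sub>1 f = k \<cdot>\<^sub>1\<^sub>1 (g \<cdot>\<^sub>1\<^sub>1 f)"
    and assoc112:
      "\<lbrakk>\<phi> \<in> carrier (Cell2 C U V); g \<in> carrier (Cell1 C V W); k \<in> carrier (Cell1 C W X)\<rbrakk>
        \<Longrightarrow> (k \<cdot>\<^sub>1\<^sub>1 g) \<cdot>\<^sub>1\<^sub>2 \<phi> = k \<cdot>\<^sub>1\<^sub>2 (g \<cdot>\<^sub>1\<^sub>2 \<phi>)"
    and assoc121:
      "\<lbrakk>f \<in> carrier (Cell1 C U V); \<phi> \<in> carrier (Cell2 C V W); k \<in> carrier (Cell1 C W X)\<rbrakk>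
        \<Longrightarrow> (k \<cdot>\<^sub>1\<^sub>2 \<phi>) \<cdot>\<^sub>2\<^sub>1 f = k \<cdot>\<^sub>1\<^sub>2 (\<phi> \<cdot>\<^sub>2\<^sub>1 f)"
    and assoc211:
      "\<lbrakk>f \<in> carrier (Cell1 C U V); g \<in> carrier (Cell1 C V W); \<phi> \<in> carrier (Cell2 C W X)\<rbrakk>
        \<Longrightarrow> (\<phi> \<cdot>\<^sub>2\<^sub>1 g) \<cdot>\<^sub>2\<^sub>1 f = \<phi> \<cdot>\<^sub>2\<^sub>1 (g \<cdot>\<^sub>1\<^sub>1 f)"
    and bdry_comp12:
      "\<lbrakk>\<phi> \<in> carrier (Cell2 C U V); f \<in> carrier (Cell1 C V W)\<rbrakk>
        \<Longrightarrow> \<partial> (f \<cdot>\<^sub>1\<^sub>2 \<phi>) = f \<cdot>\<^sub>1\<^sub>1 \<partial> \<phi>"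
    and bdry_comp21:
      "\<lbrakk>f \<in> carrier (Cell1 C U V); \<phi> \<in> carrier (Cell2 C V W)\<rbrakk>
        \<Longrightarrow> \<partial> (\<phi> \<cdot>\<^sub>2\<^sub>1 f) = \<partial> \<phi> \<cdot>\<^sub>1\<^sub>1 f"
    and bdry_truncated:
      "\<lbrakk>\<phi>' \<in> carrier (Cell2 C U V); \<phi> \<in> carrier (Cell2 C V W)\<rbrakk>
        \<Longrightarrow> \<partial> \<phi> \<cdot>\<^sub>1\<^sub>2 \<phi>' = \<phi> \<cdot>\<^sub>2\<^sub>1 \<partial> \<phi>'"

definition inverse1 :: "('o, 'r, 'a, 'b, 'z) ch_cat_scheme \<Rightarrow> 'a \<Rightarrow> 'a \<Rightarrow> bool" where
  "inverse1 C f g \<longleftrightarrow>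
     g \<in> carrier (Cell1 C (cod1 C f) (dom1 C f)) \<and>
     g \<cdot>\<^sub>1\<^sub>1\<^bsub>C\<^esub> f = \<one>\<^sub>1\<^bsub>C\<^esub> (dom1 C f) \<and> f \<cdot>\<^sub>1\<^sub>1\<^bsub>C\<^esub> g = \<one>\<^sub>1\<^bsub>C\<^esub> (cod1 C f)"

definition invertible1 ::
    "('o, 'r, 'a, 'b, 'z) ch_cat_scheme \<Rightarrow> 'o \<Rightarrow> 'o \<Rightarrow> 'a \<Rightarrow> bool" where
  "invertible1 C U V f \<longleftrightarrow> f \<in> carrier (Cell1 C U V) \<and> (\<exists>g. inverse1 C f g)"

definition inv1 :: "('o, 'r, 'a, 'b, 'z) ch_cat_scheme \<Rightarrow> 'a \<Rightarrow> 'a" where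
  "inv1 C f = (THE g. inverse1 C f g)"


section \<open>Functors on the truncated tensor square\<close>

text \<open>
  The hom complexes of \<open>C \<boxtimes> C\<close> are truncated tensor products. A linear map on their degree 0 part
  is the same thing as a bilinear map \<open>(f, g) \<mapsto> _(f \<boxtimes> g)\<close>, and a linear map on their degree -1
  part is a pair of bilinear maps \<open>(\<phi>, g) \<mapsto> _(\<phi> \<boxtimes> g)\<close> and \<open>(f, \<psi>) \<mapsto> _(f \<boxtimes> \<psi>)\<close> that agree on
  \<open>\<partial>\<phi> \<boxtimes> \<psi>\<close> and \<open>\<phi> \<boxtimes> \<partial>\<psi>\<close>. Functors out of \<open>C \<boxtimes> C\<close> and pseudonatural transformations between
  them are given in this form, the axioms being stated on the generators.
\<close>

record ('o, 'a, 'b) bifun =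
  fob :: "'o \<Rightarrow> 'o \<Rightarrow> 'o"
  f11 :: "'a \<Rightarrow> 'a \<Rightarrow> 'a"
  f12 :: "'a \<Rightarrow> 'b \<Rightarrow> 'b"
  f21 :: "'b \<Rightarrow> 'a \<Rightarrow> 'b"

definition op_bifun :: "('o, 'a, 'b) bifun \<Rightarrow> ('o, 'a, 'b) bifun" where
  "op_bifun F = \<lparr> fob = (\<lambda>U V. fob F V U), f11 = (\<lambda>f g. f11 F g f),
     f12 = (\<lambda>f \<psi>. f21 F \<psi> f), f21 = (\<lambda>\<phi> g. f12 F g \<phi>) \<rparr>"

locale ch_bifunctor =
  fixes R :: "('r, 'q) ring_scheme"
    and C :: "('o, 'r, 'a, 'b, 'z) ch_cat_scheme" (structure)
    and F :: "('o, 'a, 'b) bifun"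
  assumes f11_bilinear: "bilinear_map R (Cell1 C U U') (Cell1 C V V')
      (Cell1 C (fob F U V) (fob F U' V')) (f11 F)"
    and f12_bilinear: "bilinear_map R (Cell1 C U U') (Cell2 C V V')
      (Cell2 C (fob F U V) (fob F U' V')) (f12 F)"
    and f21_bilinear: "bilinear_map R (Cell2 C U U') (Cell1 C V V')
      (Cell2 C (fob F U V) (fob F U' V')) (f21 F)"
    and f_truncated:
      "\<lbrakk>\<phi> \<in> carrier (Cell2 C U U'); \<psi> \<in> carrier (Cell2 C V V')\<rbrakk>
        \<Longrightarrow> f12 F (\<partial> \<phi>) \<psi> = f21 F \<phi> (\<partial> \<psi>)"
    and bdry_f12:
      "\<lbrakk>f \<in> carrier (Cell1 C U U'); \<psi> \<in> carrier (Cell2 C V V')\<rbrakk>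
        \<Longrightarrow> \<partial> (f12 F f \<psi>) = f11 F f (\<partial> \<psi>)"
    and bdry_f21:
      "\<lbrakk>\<phi> \<in> carrier (Cell2 C U U'); g \<in> carrier (Cell1 C V V')\<rbrakk>
        \<Longrightarrow> \<partial> (f21 F \<phi> g) = f11 F (\<partial> \<phi>) g"
    and f11_ident: "f11 F (\<one>\<^sub>1 U) (\<one>\<^sub>1 V) = \<one>\<^sub>1 (fob F U V)"
    and f11_comp11:
      "\<lbrakk>f \<in> carrier (Cell1 C U U'); f' \<in> carrier (Cell1 C U' U'');
        g \<in> carrier (Cell1 C V V'); g' \<in> carrier (Cell1 C V' V'')\<rbrakk>
        \<Longrightarrow> f11 F (f' \<cdot>\<^sub>1\<^sub>1 f) (g' \<cdot>\<^sub>1\<^sub>1 g) = f11 F f' g' \<cdot>\<^sub>1\<^sub>1 f11 F f g"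
    and f12_comp12:
      "\<lbrakk>f \<in> carrier (Cell1 C U U'); f' \<in> carrier (Cell1 C U' U'');
        \<psi> \<in> carrier (Cell2 C V V'); g' \<in> carrier (Cell1 C V' V'')\<rbrakk>
        \<Longrightarrow> f12 F (f' \<cdot>\<^sub>1\<^sub>1 f) (g' \<cdot>\<^sub>1\<^sub>2 \<psi>) = f11 F f' g' \<cdot>\<^sub>1\<^sub>2 f12 F f \<psi>"
    and f12_comp21:
      "\<lbrakk>f \<in> carrier (Cell1 C U U'); f' \<in> carrier (Cell1 C U' U'');
        g \<in> carrier (Cell1 C V V'); \<psi>' \<in> carrier (Cell2 C V' V'')\<rbrakk>
        \<Longrightarrow> f12 F (f' \<cdot>\<^sub>1\<^sub>1 f) (\<psi>' \<cdot>\<^sub>2\<^sub>1 g) = f12 F f' \<psi>' \<cdot>\<^sub>2\<^sub>1 f11 F f g"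
    and f21_comp12:
      "\<lbrakk>\<phi> \<in> carrier (Cell2 C U U'); f' \<in> carrier (Cell1 C U' U'');
        g \<in> carrier (Cell1 C V V'); g' \<in> carrier (Cell1 C V' V'')\<rbrakk>
        \<Longrightarrow> f21 F (f' \<cdot>\<^sub>1\<^sub>2 \<phi>) (g' \<cdot>\<^sub>1\<^sub>1 g) = f11 F f' g' \<cdot>\<^sub>1\<^sub>2 f21 F \<phi> g"
    and f21_comp21:
      "\<lbrakk>f \<in> carrier (Cell1 C U U'); \<phi>' \<in> carrier (Cell2 C U' U'');
        g \<in> carrier (Cell1 C V V'); g' \<in> carrier (Cell1 C V' V'')\<rbrakk>
        \<Longrightarrow> f21 F (\<phi>' \<cdot>\<^sub>2\<^sub>1 f) (g' \<cdot>\<^sub>1\<^sub>1 g) = f21 F \<phi>' g' \<cdot>\<^sub>2\<^sub>1 f11 F f g"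


section \<open>Pseudonatural transformations\<close>

record ('o, 'a, 'b) ptrans =
  pt_cell :: "'o \<Rightarrow> 'o \<Rightarrow> 'a" (\<open>_\<langle>_, _\<rangle>\<close> [100, 0, 0] 100)
  pt_htpy :: "'a \<Rightarrow> 'a \<Rightarrow> 'b" (\<open>_\<langle>_ \<boxtimes> _\<rangle>\<close> [100, 0, 0] 100)

locale pseudonatural =
  fixes R :: "('r, 'q) ring_scheme"
    and C :: "('o, 'r, 'a, 'b, 'z) ch_cat_scheme" (structure)
    and F G :: "('o, 'a, 'b) bifun"
    and \<xi> :: "('o, 'a, 'b) ptrans"
  assumes pt_cell_closed: "\<xi>\<langle>U, V\<rangle> \<in> carrier (Cell1 C (fob F U V) (fob G U V))"
    and pt_htpy_bilinear: "bilinear_map R (Cell1 C U U') (Cell1 C V V')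
      (Cell2 C (fob F U V) (fob G U' V')) (\<lambda>f g. \<xi>\<langle>f \<boxtimes> g\<rangle>)"
    and bdry_pt_htpy:
      "\<lbrakk>f \<in> carrier (Cell1 C U U'); g \<in> carrier (Cell1 C V V')\<rbrakk>
        \<Longrightarrow> f11 G f g \<cdot>\<^sub>1\<^sub>1 \<xi>\<langle>U, V\<rangle> \<ominus>\<^bsub>Cell1 C (fob F U V) (fob G U' V')\<^esub> \<xi>\<langle>U', V'\<rangle> \<cdot>\<^sub>1\<^sub>1 f11 F f g
            = \<partial> \<xi>\<langle>f \<boxtimes> g\<rangle>"
    and pt_htpy_bdry_left:
      "\<lbrakk>\<phi> \<in> carrier (Cell2 C U U'); g \<in> carrier (Cell1 C V V')\<rbrakk>
        \<Longrightarrow> f21 G \<phi> g \<cdot>\<^sub>2\<^sub>1 \<xi>\<langle>U, V\<rangle> \<ominus>\<^bsub>Cell2 C (fob F U V) (fob G U' V')\<^esub> \<xi>\<langle>U', V'\<rangle> \<cdot>\<^sub>1\<^sub>2 f21 F \<phi> g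
            = \<xi>\<langle>\<partial> \<phi> \<boxtimes> g\<rangle>"
    and pt_htpy_bdry_right:
      "\<lbrakk>f \<in> carrier (Cell1 C U U'); \<psi> \<in> carrier (Cell2 C V V')\<rbrakk>
        \<Longrightarrow> f12 G f \<psi> \<cdot>\<^sub>2\<^sub>1 \<xi>\<langle>U, V\<rangle> \<ominus>\<^bsub>Cell2 C (fob F U V) (fob G U' V')\<^esub> \<xi>\<langle>U', V'\<rangle> \<cdot>\<^sub>1\<^sub>2 f12 F f \<psi>
            = \<xi>\<langle>f \<boxtimes> \<partial> \<psi>\<rangle>"
    and pt_htpy_ident: "\<xi>\<langle>\<one>\<^sub>1 U \<boxtimes> \<one>\<^sub>1 V\<rangle> = \<zero>\<^bsub>Cell2 C (fob F U V) (fob G U V)\<^esub>"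
    and pt_htpy_comp:
      "\<lbrakk>f \<in> carrier (Cell1 C U U'); f' \<in> carrier (Cell1 C U' U'');
        g \<in> carrier (Cell1 C V V'); g' \<in> carrier (Cell1 C V' V'')\<rbrakk>
        \<Longrightarrow> \<xi>\<langle>f' \<cdot>\<^sub>1\<^sub>1 f \<boxtimes> g' \<cdot>\<^sub>1\<^sub>1 g\<rangle>
            = \<xi>\<langle>f' \<boxtimes> g'\<rangle> \<cdot>\<^sub>2\<^sub>1 f11 F f g \<oplus>\<^bsub>Cell2 C (fob F U V) (fob G U'' V'')\<^esub> f11 G f' g' \<cdot>\<^sub>1\<^sub>2 \<xi>\<langle>f \<boxtimes> g\<rangle>"

locale ch_natural = pseudonatural R C F G \<xi>
  for R :: "('r, 'q) ring_scheme"
    and C :: "('o, 'r, 'a, 'b, 'z) ch_cat_scheme" (structure)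
    and F G :: "('o, 'a, 'b) bifun"
    and \<xi> :: "('o, 'a, 'b) ptrans" +
  assumes htpy_zero:
    "\<lbrakk>f \<in> carrier (Cell1 C U U'); g \<in> carrier (Cell1 C V V')\<rbrakk>
      \<Longrightarrow> \<xi>\<langle>f \<boxtimes> g\<rangle> = \<zero>\<^bsub>Cell2 C (fob F U V) (fob G U' V')\<^esub>"

text \<open>
  Identity, sums, multiples, vertical composition and inverses. The functors are passed along
  because they determine the hom module in which an operation takes place.
\<close>

definition pt_id ::
    "('o, 'r, 'a, 'b, 'z) ch_cat_scheme \<Rightarrow> ('o, 'a, 'b) bifun \<Rightarrow> ('o, 'a, 'b) ptrans" where
  "pt_id C F = \<lparr> pt_cell = (\<lambda>U V. \<one>\<^sub>1\<^bsub>C\<^esub> (fob F U V)),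
     pt_htpy = (\<lambda>f g. \<zero>\<^bsub>Cell2 C (fob F (dom1 C f) (dom1 C g)) (fob F (cod1 C f) (cod1 C g))\<^esub>) \<rparr>"

definition pt_add ::
    "('o, 'r, 'a, 'b, 'z) ch_cat_scheme \<Rightarrow> ('o, 'a, 'b) bifun \<Rightarrow> ('o, 'a, 'b) bifun \<Rightarrow>
     ('o, 'a, 'b) ptrans \<Rightarrow> ('o, 'a, 'b) ptrans \<Rightarrow> ('o, 'a, 'b) ptrans" where
  "pt_add C F G \<xi> \<theta> = \<lparr>
     pt_cell = (\<lambda>U V. \<xi>\<langle>U, V\<rangle> \<oplus>\<^bsub>Cell1 C (fob F U V) (fob G U V)\<^esub> \<theta>\<langle>U, V\<rangle>),
     pt_htpy = (\<lambda>f g. \<xi>\<langle>f \<boxtimes> g\<rangle>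
       \<oplus>\<^bsub>Cell2 C (fob F (dom1 C f) (dom1 C g)) (fob G (cod1 C f) (cod1 C g))\<^esub> \<theta>\<langle>f \<boxtimes> g\<rangle>) \<rparr>"

definition pt_smult ::
    "('o, 'r, 'a, 'b, 'z) ch_cat_scheme \<Rightarrow> ('o, 'a, 'b) bifun \<Rightarrow> ('o, 'a, 'b) bifun \<Rightarrow>
     'r \<Rightarrow> ('o, 'a, 'b) ptrans \<Rightarrow> ('o, 'a, 'b) ptrans" where
  "pt_smult C F G r \<xi> = \<lparr>
     pt_cell = (\<lambda>U V. r \<odot>\<^bsub>Cell1 C (fob F U V) (fob G U V)\<^esub> \<xi>\<langle>U, V\<rangle>),
     pt_htpy = (\<lambda>f g.
       r \<odot>\<^bsub>Cell2 C (fob F (dom1 C f) (dom1 C g)) (fob G (cod1 C f) (cod1 C g))\<^esub> \<xi>\<langle>f \<boxtimes> g\<rangle>) \<rparr>"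

text \<open>\<open>pt_comp C F H \<theta> \<xi>\<close> is \<open>\<theta>\<xi>\<close> for \<open>\<xi> : F \<Rightarrow> G\<close> and \<open>\<theta> : G \<Rightarrow> H\<close>.\<close>

definition pt_comp ::
    "('o, 'r, 'a, 'b, 'z) ch_cat_scheme \<Rightarrow> ('o, 'a, 'b) bifun \<Rightarrow> ('o, 'a, 'b) bifun \<Rightarrow>
     ('o, 'a, 'b) ptrans \<Rightarrow> ('o, 'a, 'b) ptrans \<Rightarrow> ('o, 'a, 'b) ptrans" where
  "pt_comp C F H \<theta> \<xi> = \<lparr>
     pt_cell = (\<lambda>U V. \<theta>\<langle>U, V\<rangle> \<cdot>\<^sub>1\<^sub>1\<^bsub>C\<^esub> \<xi>\<langle>U, V\<rangle>),
     pt_htpy = (\<lambda>f g. \<theta>\<langle>f \<boxtimes> g\<rangle> \<cdot>\<^sub>2\<^sub>1\<^bsub>C\<^esub> \<xi>\<langle>dom1 C f, dom1 C g\<rangle>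
       \<oplus>\<^bsub>Cell2 C (fob F (dom1 C f) (dom1 C g)) (fob H (cod1 C f) (cod1 C g))\<^esub>
       \<theta>\<langle>cod1 C f, cod1 C g\<rangle> \<cdot>\<^sub>1\<^sub>2\<^bsub>C\<^esub> \<xi>\<langle>f \<boxtimes> g\<rangle>) \<rparr>"

text \<open>\<open>pt_inv C F G \<xi>\<close> is the inverse \<open>G \<Rightarrow> F\<close> of \<open>\<xi> : F \<Rightarrow> G\<close>.\<close>

definition pt_inv ::
    "('o, 'r, 'a, 'b, 'z) ch_cat_scheme \<Rightarrow> ('o, 'a, 'b) bifun \<Rightarrow> ('o, 'a, 'b) bifun \<Rightarrow>
     ('o, 'a, 'b) ptrans \<Rightarrow> ('o, 'a, 'b) ptrans" where
  "pt_inv C F G \<xi> = \<lparr>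
     pt_cell = (\<lambda>U V. inv1 C (\<xi>\<langle>U, V\<rangle>)),
     pt_htpy = (\<lambda>f g.
       \<ominus>\<^bsub>Cell2 C (fob G (dom1 C f) (dom1 C g)) (fob F (cod1 C f) (cod1 C g))\<^esub>
         (inv1 C (\<xi>\<langle>cod1 C f, cod1 C g\<rangle>) \<cdot>\<^sub>1\<^sub>2\<^bsub>C\<^esub> \<xi>\<langle>f \<boxtimes> g\<rangle>
           \<cdot>\<^sub>2\<^sub>1\<^bsub>C\<^esub> inv1 C (\<xi>\<langle>dom1 C f, dom1 C g\<rangle>))) \<rparr>"

text \<open>
  Components of the inverse \<open>\<xi>\<inverse> \<Rrightarrow> \<xi>'\<inverse>\<close> of a modification with component \<open>\<Xi>\<close> between the
  invertible 1-cells \<open>x, x' : X \<rightarrow> Y\<close>.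
\<close>

definition mod_inv ::
    "('o, 'r, 'a, 'b, 'z) ch_cat_scheme \<Rightarrow> 'o \<Rightarrow> 'o \<Rightarrow> 'a \<Rightarrow> 'a \<Rightarrow> 'b \<Rightarrow> 'b" where
  "mod_inv C X Y x x' \<Xi> = \<ominus>\<^bsub>Cell2 C Y X\<^esub> (inv1 C x \<cdot>\<^sub>1\<^sub>2\<^bsub>C\<^esub> \<Xi> \<cdot>\<^sub>2\<^sub>1\<^bsub>C\<^esub> inv1 C x')"


section \<open>Symmetric strict monoidal categories\<close>

record ('o, 'r, 'a, 'b) ch_mon_cat = "('o, 'r, 'a, 'b) ch_cat" +
  tensor :: "('o, 'a, 'b) bifun"
  unit_ob :: 'o

abbreviation tens_ob (infixl \<open>\<otimes>\<^sub>0\<index>\<close> 75) where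
  "U \<otimes>\<^sub>0\<^bsub>C\<^esub> V \<equiv> fob (tensor C) U V"

abbreviation tens11 (infixl \<open>\<otimes>\<^sub>1\<^sub>1\<index>\<close> 75) where
  "f \<otimes>\<^sub>1\<^sub>1\<^bsub>C\<^esub> g \<equiv> f11 (tensor C) f g"

abbreviation tens12 (infixl \<open>\<otimes>\<^sub>1\<^sub>2\<index>\<close> 75) where
  "f \<otimes>\<^sub>1\<^sub>2\<^bsub>C\<^esub> \<psi> \<equiv> f12 (tensor C) f \<psi>"

abbreviation tens21 (infixl \<open>\<otimes>\<^sub>2\<^sub>1\<index>\<close> 75) where
  "\<phi> \<otimes>\<^sub>2\<^sub>1\<^bsub>C\<^esub> g \<equiv> f21 (tensor C) \<phi> g"

locale sym_strict_monoidal =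
  ch_category R C +
  ch_bifunctor R C "tensor C" +
  \<gamma>: ch_natural R C "tensor C" "op_bifun (tensor C)" \<gamma>
  for R :: "('r, 'q) ring_scheme"
    and C :: "('o, 'r, 'a, 'b, 'z) ch_mon_cat_scheme" (structure)
    and \<gamma> :: "('o, 'a, 'b) ptrans" +
  assumes tens_assoc0: "(U \<otimes>\<^sub>0 V) \<otimes>\<^sub>0 W = U \<otimes>\<^sub>0 (V \<otimes>\<^sub>0 W)"
    and tens_assoc111:
      "\<lbrakk>f \<in> carrier (Cell1 C U U'); g \<in> carrier (Cell1 C V V'); k \<in> carrier (Cell1 C W W')\<rbrakk>
        \<Longrightarrow> (f \<otimes>\<^sub>1\<^sub>1 g) \<otimes>\<^sub>1\<^sub>1 k = f \<otimes>\<^sub>1\<^sub>1 (g \<otimes>\<^sub>1\<^sub>1 k)"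
    and tens_assoc211:
      "\<lbrakk>\<phi> \<in> carrier (Cell2 C U U'); g \<in> carrier (Cell1 C V V'); k \<in> carrier (Cell1 C W W')\<rbrakk>
        \<Longrightarrow> (\<phi> \<otimes>\<^sub>2\<^sub>1 g) \<otimes>\<^sub>2\<^sub>1 k = \<phi> \<otimes>\<^sub>2\<^sub>1 (g \<otimes>\<^sub>1\<^sub>1 k)"
    and tens_assoc121:
      "\<lbrakk>f \<in> carrier (Cell1 C U U'); \<phi> \<in> carrier (Cell2 C V V'); k \<in> carrier (Cell1 C W W')\<rbrakk>
        \<Longrightarrow> (f \<otimes>\<^sub>1\<^sub>2 \<phi>) \<otimes>\<^sub>2\<^sub>1 k = f \<otimes>\<^sub>1\<^sub>2 (\<phi> \<otimes>\<^sub>2\<^sub>1 k)"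
    and tens_assoc112:
      "\<lbrakk>f \<in> carrier (Cell1 C U U'); g \<in> carrier (Cell1 C V V'); \<phi> \<in> carrier (Cell2 C W W')\<rbrakk>
        \<Longrightarrow> (f \<otimes>\<^sub>1\<^sub>1 g) \<otimes>\<^sub>1\<^sub>2 \<phi> = f \<otimes>\<^sub>1\<^sub>2 (g \<otimes>\<^sub>1\<^sub>2 \<phi>)"
    and tens_unit0: "unit_ob C \<otimes>\<^sub>0 U = U" "U \<otimes>\<^sub>0 unit_ob C = U"
    and tens_unit1: "f \<in> carrier (Cell1 C U V) \<Longrightarrow>
      \<one>\<^sub>1 (unit_ob C) \<otimes>\<^sub>1\<^sub>1 f = f \<and> f \<otimes>\<^sub>1\<^sub>1 \<one>\<^sub>1 (unit_ob C) = f"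
    and tens_unit2: "\<phi> \<in> carrier (Cell2 C U V) \<Longrightarrow>
      \<one>\<^sub>1 (unit_ob C) \<otimes>\<^sub>1\<^sub>2 \<phi> = \<phi> \<and> \<phi> \<otimes>\<^sub>2\<^sub>1 \<one>\<^sub>1 (unit_ob C) = \<phi>"
    and braid_involutive: "\<gamma>\<langle>V, U\<rangle> \<cdot>\<^sub>1\<^sub>1 \<gamma>\<langle>U, V\<rangle> = \<one>\<^sub>1 (U \<otimes>\<^sub>0 V)"
    and braid_hexagon:
      "\<gamma>\<langle>U, V \<otimes>\<^sub>0 W\<rangle> = (\<one>\<^sub>1 V \<otimes>\<^sub>1\<^sub>1 \<gamma>\<langle>U, W\<rangle>) \<cdot>\<^sub>1\<^sub>1 (\<gamma>\<langle>U, V\<rangle> \<otimes>\<^sub>1\<^sub>1 \<one>\<^sub>1 W)"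


section \<open>Infinitesimal 2-braidings and coboundary syllepses\<close>

locale infinitesimal_2_braiding =
  sym_strict_monoidal R C \<gamma> + t: pseudonatural R C "tensor C" "tensor C" t
  for R :: "('r, 'q) ring_scheme"
    and C :: "('o, 'r, 'a, 'b, 'z) ch_mon_cat_scheme" (structure)
    and \<gamma> :: "('o, 'a, 'b) ptrans"
    and t :: "('o, 'a, 'b) ptrans"

locale strict_i2b = infinitesimal_2_braiding R C \<gamma> t
  for R :: "('r, 'q) ring_scheme"
    and C :: "('o, 'r, 'a, 'b, 'z) ch_mon_cat_scheme" (structure)
    and \<gamma> t :: "('o, 'a, 'b) ptrans" +
  assumes strict_right:
    "t\<langle>U, V \<otimes>\<^sub>0 W\<rangle> = t\<langle>U, V\<rangle> \<otimes>\<^sub>1\<^sub>1 \<one>\<^sub>1 W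
       \<oplus>\<^bsub>Cell1 C (U \<otimes>\<^sub>0 V \<otimes>\<^sub>0 W) (U \<otimes>\<^sub>0 V \<otimes>\<^sub>0 W)\<^esub>
       (\<gamma>\<langle>V, U\<rangle> \<otimes>\<^sub>1\<^sub>1 \<one>\<^sub>1 W) \<cdot>\<^sub>1\<^sub>1 (\<one>\<^sub>1 V \<otimes>\<^sub>1\<^sub>1 t\<langle>U, W\<rangle>) \<cdot>\<^sub>1\<^sub>1 (\<gamma>\<langle>U, V\<rangle> \<otimes>\<^sub>1\<^sub>1 \<one>\<^sub>1 W)"
    and strict_right_htpy:
    "\<lbrakk>f \<in> carrier (Cell1 C U U'); g \<in> carrier (Cell1 C V V'); k \<in> carrier (Cell1 C W W')\<rbrakk>
      \<Longrightarrow> t\<langle>f \<boxtimes> g \<otimes>\<^sub>1\<^sub>1 k\<rangle> = t\<langle>f \<boxtimes> g\<rangle> \<otimes>\<^sub>2\<^sub>1 k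
       \<oplus>\<^bsub>Cell2 C (U \<otimes>\<^sub>0 V \<otimes>\<^sub>0 W) (U' \<otimes>\<^sub>0 V' \<otimes>\<^sub>0 W')\<^esub>
       (\<gamma>\<langle>V', U'\<rangle> \<otimes>\<^sub>1\<^sub>1 \<one>\<^sub>1 W') \<cdot>\<^sub>1\<^sub>2 (g \<otimes>\<^sub>1\<^sub>2 t\<langle>f \<boxtimes> k\<rangle>) \<cdot>\<^sub>2\<^sub>1 (\<gamma>\<langle>U, V\<rangle> \<otimes>\<^sub>1\<^sub>1 \<one>\<^sub>1 W)"
    and strict_left:
    "t\<langle>U \<otimes>\<^sub>0 V, W\<rangle> = \<one>\<^sub>1 U \<otimes>\<^sub>1\<^sub>1 t\<langle>V, W\<rangle>
       \<oplus>\<^bsub>Cell1 C (U \<otimes>\<^sub>0 V \<otimes>\<^sub>0 W) (U \<otimes>\<^sub>0 V \<otimes>\<^sub>0 W)\<^esub>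
       (\<one>\<^sub>1 U \<otimes>\<^sub>1\<^sub>1 \<gamma>\<langle>W, V\<rangle>) \<cdot>\<^sub>1\<^sub>1 (t\<langle>U, W\<rangle> \<otimes>\<^sub>1\<^sub>1 \<one>\<^sub>1 V) \<cdot>\<^sub>1\<^sub>1 (\<one>\<^sub>1 U \<otimes>\<^sub>1\<^sub>1 \<gamma>\<langle>V, W\<rangle>)"
    and strict_left_htpy:
    "\<lbrakk>f \<in> carrier (Cell1 C U U'); g \<in> carrier (Cell1 C V V'); k \<in> carrier (Cell1 C W W')\<rbrakk>
      \<Longrightarrow> t\<langle>f \<otimes>\<^sub>1\<^sub>1 g \<boxtimes> k\<rangle> = f \<otimes>\<^sub>1\<^sub>2 t\<langle>g \<boxtimes> k\<rangle>
       \<oplus>\<^bsub>Cell2 C (U \<otimes>\<^sub>0 V \<otimes>\<^sub>0 W) (U' \<otimes>\<^sub>0 V' \<otimes>\<^sub>0 W')\<^esub>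
       (\<one>\<^sub>1 U' \<otimes>\<^sub>1\<^sub>1 \<gamma>\<langle>W', V'\<rangle>) \<cdot>\<^sub>1\<^sub>2 (t\<langle>f \<boxtimes> k\<rangle> \<otimes>\<^sub>2\<^sub>1 g) \<cdot>\<^sub>2\<^sub>1 (\<one>\<^sub>1 U \<otimes>\<^sub>1\<^sub>1 \<gamma>\<langle>V, W\<rangle>)"

locale symmetric_i2b = infinitesimal_2_braiding R C \<gamma> t
  for R :: "('r, 'q) ring_scheme"
    and C :: "('o, 'r, 'a, 'b, 'z) ch_mon_cat_scheme" (structure)
    and \<gamma> t :: "('o, 'a, 'b) ptrans" +
  assumes symmetric: "\<gamma>\<langle>U, V\<rangle> \<cdot>\<^sub>1\<^sub>1 t\<langle>U, V\<rangle> = t\<langle>V, U\<rangle> \<cdot>\<^sub>1\<^sub>1 \<gamma>\<langle>U, V\<rangle>"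
    and symmetric_htpy:
      "\<lbrakk>f \<in> carrier (Cell1 C U U'); g \<in> carrier (Cell1 C V V')\<rbrakk>
        \<Longrightarrow> \<gamma>\<langle>U', V'\<rangle> \<cdot>\<^sub>1\<^sub>2 t\<langle>f \<boxtimes> g\<rangle> = t\<langle>g \<boxtimes> f\<rangle> \<cdot>\<^sub>2\<^sub>1 \<gamma>\<langle>U, V\<rangle>"

locale totally_symmetric_i2b = symmetric_i2b R C \<gamma> t
  for R :: "('r, 'q) ring_scheme"
    and C :: "('o, 'r, 'a, 'b, 'z) ch_mon_cat_scheme" (structure)
    and \<gamma> t :: "('o, 'a, 'b) ptrans" +
  assumes totally_symmetric:
    "t\<langle>\<gamma>\<langle>U, V\<rangle> \<boxtimes> \<one>\<^sub>1 W\<rangle> = \<zero>\<^bsub>Cell2 C (U \<otimes>\<^sub>0 V \<otimes>\<^sub>0 W) (V \<otimes>\<^sub>0 U \<otimes>\<^sub>0 W)\<^esub>"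

locale coherent_i2b = infinitesimal_2_braiding R C \<gamma> t
  for R :: "('r, 'q) ring_scheme"
    and C :: "('o, 'r, 'a, 'b, 'z) ch_mon_cat_scheme" (structure)
    and \<gamma> t :: "('o, 'a, 'b) ptrans" +
  assumes coherent_left:
    "\<ominus>\<^bsub>Cell2 C (U \<otimes>\<^sub>0 V \<otimes>\<^sub>0 W) (U \<otimes>\<^sub>0 V \<otimes>\<^sub>0 W)\<^esub>
       ((\<gamma>\<langle>V, U\<rangle> \<otimes>\<^sub>1\<^sub>1 \<one>\<^sub>1 W) \<cdot>\<^sub>1\<^sub>2 t\<langle>\<one>\<^sub>1 V \<boxtimes> t\<langle>U, W\<rangle>\<rangle> \<cdot>\<^sub>2\<^sub>1 (\<gamma>\<langle>U, V\<rangle> \<otimes>\<^sub>1\<^sub>1 \<one>\<^sub>1 W))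
     = t\<langle>t\<langle>U, V\<rangle> \<boxtimes> \<one>\<^sub>1 W\<rangle>
       \<oplus>\<^bsub>Cell2 C (U \<otimes>\<^sub>0 V \<otimes>\<^sub>0 W) (U \<otimes>\<^sub>0 V \<otimes>\<^sub>0 W)\<^esub> t\<langle>\<one>\<^sub>1 U \<boxtimes> t\<langle>V, W\<rangle>\<rangle>"
    and coherent_right:
    "t\<langle>t\<langle>U, V\<rangle> \<boxtimes> \<one>\<^sub>1 W\<rangle>
       \<oplus>\<^bsub>Cell2 C (U \<otimes>\<^sub>0 V \<otimes>\<^sub>0 W) (U \<otimes>\<^sub>0 V \<otimes>\<^sub>0 W)\<^esub> t\<langle>\<one>\<^sub>1 U \<boxtimes> t\<langle>V, W\<rangle>\<rangle>
     = \<ominus>\<^bsub>Cell2 C (U \<otimes>\<^sub>0 V \<otimes>\<^sub>0 W) (U \<otimes>\<^sub>0 V \<otimes>\<^sub>0 W)\<^esub>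
       ((\<one>\<^sub>1 U \<otimes>\<^sub>1\<^sub>1 \<gamma>\<langle>W, V\<rangle>) \<cdot>\<^sub>1\<^sub>2 t\<langle>t\<langle>U, W\<rangle> \<boxtimes> \<one>\<^sub>1 V\<rangle> \<cdot>\<^sub>2\<^sub>1 (\<one>\<^sub>1 U \<otimes>\<^sub>1\<^sub>1 \<gamma>\<langle>V, W\<rangle>))"

locale coboundary_syllepsis = infinitesimal_2_braiding R C \<gamma> t
  for R :: "('r, 'q) ring_scheme"
    and C :: "('o, 'r, 'a, 'b, 'z) ch_mon_cat_scheme" (structure)
    and \<gamma> t :: "('o, 'a, 'b) ptrans" +
  fixes T :: "'o \<Rightarrow> 'o \<Rightarrow> 'b"
  assumes T_closed: "T U V \<in> carrier (Cell2 C (U \<otimes>\<^sub>0 V) (U \<otimes>\<^sub>0 V))"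
    and bdry_T: "\<partial> (T U V) = t\<langle>U, V\<rangle>"
    and T_htpy:
      "\<lbrakk>f \<in> carrier (Cell1 C U U'); g \<in> carrier (Cell1 C V V')\<rbrakk>
        \<Longrightarrow> (f \<otimes>\<^sub>1\<^sub>1 g) \<cdot>\<^sub>1\<^sub>2 T U V \<ominus>\<^bsub>Cell2 C (U \<otimes>\<^sub>0 V) (U' \<otimes>\<^sub>0 V')\<^esub> T U' V' \<cdot>\<^sub>2\<^sub>1 (f \<otimes>\<^sub>1\<^sub>1 g)
            = t\<langle>f \<boxtimes> g\<rangle>"
    and T_right:
      "T U (V \<otimes>\<^sub>0 W) = T U V \<otimes>\<^sub>2\<^sub>1 \<one>\<^sub>1 W
         \<oplus>\<^bsub>Cell2 C (U \<otimes>\<^sub>0 V \<otimes>\<^sub>0 W) (U \<otimes>\<^sub>0 V \<otimes>\<^sub>0 W)\<^esub>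
         (\<gamma>\<langle>V, U\<rangle> \<otimes>\<^sub>1\<^sub>1 \<one>\<^sub>1 W) \<cdot>\<^sub>1\<^sub>2 (\<one>\<^sub>1 V \<otimes>\<^sub>1\<^sub>2 T U W) \<cdot>\<^sub>2\<^sub>1 (\<gamma>\<langle>U, V\<rangle> \<otimes>\<^sub>1\<^sub>1 \<one>\<^sub>1 W)"
    and T_left:
      "T (U \<otimes>\<^sub>0 V) W = \<one>\<^sub>1 U \<otimes>\<^sub>1\<^sub>2 T V W
         \<oplus>\<^bsub>Cell2 C (U \<otimes>\<^sub>0 V \<otimes>\<^sub>0 W) (U \<otimes>\<^sub>0 V \<otimes>\<^sub>0 W)\<^esub>
         (\<one>\<^sub>1 U \<otimes>\<^sub>1\<^sub>1 \<gamma>\<langle>W, V\<rangle>) \<cdot>\<^sub>1\<^sub>2 (T U W \<otimes>\<^sub>2\<^sub>1 \<one>\<^sub>1 V) \<cdot>\<^sub>2\<^sub>1 (\<one>\<^sub>1 U \<otimes>\<^sub>1\<^sub>1 \<gamma>\<langle>V, W\<rangle>)"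
    and T_symmetric: "T U V = \<gamma>\<langle>V, U\<rangle> \<cdot>\<^sub>1\<^sub>2 T V U \<cdot>\<^sub>2\<^sub>1 \<gamma>\<langle>U, V\<rangle>"


section \<open>Extension of scalars to truncated polynomials\<close>

text \<open>
  Elements of \<open>K[h]/(h\<^sup>3)\<close> and of \<open>M \<otimes> K[h]/(h\<^sup>3)\<close> are written in the basis \<open>1, h, h\<^sup>2\<close>: the triple
  \<open>(x0, x1, x2)\<close> stands for \<open>x0 + x1 h + x2 h\<^sup>2\<close>. \<open>hext P b\<close> is the \<open>K[h]/(h\<^sup>3)\<close>-bilinear extension
  of a bilinear map \<open>b\<close> with values in \<open>P\<close>.
\<close>

definition hext :: "('p, 'z) ring_scheme \<Rightarrow> ('m \<Rightarrow> 'n \<Rightarrow> 'p) \<Rightarrow>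
    'm \<times> 'm \<times> 'm \<Rightarrow> 'n \<times> 'n \<times> 'n \<Rightarrow> 'p \<times> 'p \<times> 'p" where
  "hext P b = (\<lambda>(x0, x1, x2) (y0, y1, y2).
     (b x0 y0,
      b x0 y1 \<oplus>\<^bsub>P\<^esub> b x1 y0,
      b x0 y2 \<oplus>\<^bsub>P\<^esub> b x1 y1 \<oplus>\<^bsub>P\<^esub> b x2 y0))"

definition trunc_ring :: "('k, 'z) ring_scheme \<Rightarrow> ('k \<times> 'k \<times> 'k) ring" where
  "trunc_ring K = \<lparr> carrier = carrier K \<times> carrier K \<times> carrier K,
     monoid.mult = hext K (monoid.mult K),
     one = (\<one>\<^bsub>K\<^esub>, \<zero>\<^bsub>K\<^esub>, \<zero>\<^bsub>K\<^esub>),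
     zero = (\<zero>\<^bsub>K\<^esub>, \<zero>\<^bsub>K\<^esub>, \<zero>\<^bsub>K\<^esub>),
     add = (\<lambda>(x0, x1, x2) (y0, y1, y2). (x0 \<oplus>\<^bsub>K\<^esub> y0, x1 \<oplus>\<^bsub>K\<^esub> y1, x2 \<oplus>\<^bsub>K\<^esub> y2)) \<rparr>"

text \<open>The fields \<open>mult\<close> and \<open>one\<close> play no role for modules.\<close>

definition hmodule :: "('k, 'm) module \<Rightarrow> ('k \<times> 'k \<times> 'k, 'm \<times> 'm \<times> 'm) module" where
  "hmodule M = \<lparr> carrier = carrier M \<times> carrier M \<times> carrier M,
     monoid.mult = undefined,
     one = undefined,
     zero = (\<zero>\<^bsub>M\<^esub>, \<zero>\<^bsub>M\<^esub>, \<zero>\<^bsub>M\<^esub>),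
     add = (\<lambda>(x0, x1, x2) (y0, y1, y2). (x0 \<oplus>\<^bsub>M\<^esub> y0, x1 \<oplus>\<^bsub>M\<^esub> y1, x2 \<oplus>\<^bsub>M\<^esub> y2)),
     smult = hext M (module.smult M) \<rparr>"

definition hmap :: "('m \<Rightarrow> 'n) \<Rightarrow> 'm \<times> 'm \<times> 'm \<Rightarrow> 'n \<times> 'n \<times> 'n" where
  "hmap f = (\<lambda>(x0, x1, x2). (f x0, f x1, f x2))"

lemma (in cring) cring_trunc_ring: "cring (trunc_ring R)"
proof (rule cringI)
  show "abelian_group (trunc_ring R)"
  proof (rule abelian_groupI)
    fix x assume "x \<in> carrier (trunc_ring R)"
    then show "\<exists>y\<in>carrier (trunc_ring R). y \<oplus>\<^bsub>trunc_ring R\<^esub> x = \<zero>\<^bsub>trunc_ring R\<^esub>"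
      by (intro bexI[of _ "hmap (a_inv R) x"]) (auto simp: trunc_ring_def hmap_def l_neg)
  qed (auto simp: trunc_ring_def a_ac)
  show "comm_monoid (trunc_ring R)"
    by (rule comm_monoidI)
      (auto simp: trunc_ring_def hext_def l_distr r_distr m_assoc m_comm a_ac m_lcomm)
qed (auto simp: trunc_ring_def hext_def l_distr r_distr a_ac)

lemma abelian_group_hmodule:
  assumes "abelian_group M"
  shows "abelian_group (hmodule M)"
proof -
  interpret M: abelian_group M by fact
  show ?thesis
  proof (rule abelian_groupI)
    fix x assume "x \<in> carrier (hmodule M)"
    then show "\<exists>y\<in>carrier (hmodule M). y \<oplus>\<^bsub>hmodule M\<^esub> x = \<zero>\<^bsub>hmodule M\<^esub>"
      by (intro bexI[of _ "hmap (a_inv M) x"]) (auto simp: hmodule_def hmap_def M.l_neg)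
  qed (auto simp: hmodule_def M.a_ac)
qed

lemma module_hmodule:
  assumes "module R M"
  shows "module (trunc_ring R) (hmodule M)"
proof -
  interpret module R M by fact
  show ?thesis
  by (rule moduleI[OF R.cring_trunc_ring abelian_group_hmodule[OF M.abelian_group_axioms]])
   (auto simp: trunc_ring_def hmodule_def hext_def smult_l_distr smult_r_distr smult_assoc1 M.a_ac)
qed

lemma linear_hmap:
  assumes "linear_map R M N f" "module R M" "module R N"
  shows "linear_map (trunc_ring R) (hmodule M) (hmodule N) (hmap f)"
proof -
  interpret M: module R M by fact
  interpret N: module R N by fact
  show ?thesis using assms(1)
    by (auto simp: linear_map_def hmodule_def hmap_def trunc_ring_def hext_def)
qed

lemma bilinear_hext:
  assumes b: "bilinear_map R M N P b" and "module R M" "module R N" "module R P"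
  shows "bilinear_map (trunc_ring R) (hmodule M) (hmodule N) (hmodule P) (hext P b)"
proof -
  interpret M: module R M by fact
  interpret N: module R N by fact
  interpret P: module R P by fact
  show ?thesis using b
    by (auto simp: bilinear_map_def linear_map_def hmodule_def trunc_ring_def hext_def P.smult_r_distr
       P.a_ac P.smult_assoc1)
qed

text \<open>The inclusions \<open>x \<mapsto> x \<otimes> 1\<close> of cells of \<open>C\<close>.\<close>

definition hconst1 :: "('o, 'k, 'a, 'b, 'z) ch_cat_scheme \<Rightarrow> 'a \<Rightarrow> 'a \<times> 'a \<times> 'a" where
  "hconst1 C f =
     (f, \<zero>\<^bsub>Cell1 C (dom1 C f) (cod1 C f)\<^esub>, \<zero>\<^bsub>Cell1 C (dom1 C f) (cod1 C f)\<^esub>)"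

definition hconst2 :: "('o, 'k, 'a, 'b, 'z) ch_cat_scheme \<Rightarrow> 'b \<Rightarrow> 'b \<times> 'b \<times> 'b" where
  "hconst2 C \<phi> =
     (\<phi>, \<zero>\<^bsub>Cell2 C (dom2 C \<phi>) (cod2 C \<phi>)\<^esub>, \<zero>\<^bsub>Cell2 C (dom2 C \<phi>) (cod2 C \<phi>)\<^esub>)"

text \<open>
  All coefficients of a cell of the extended category have the same source and target, which are
  read off from the constant coefficient.
\<close>

definition hbifun ::
    "('o, 'k, 'a, 'b, 'z) ch_cat_scheme \<Rightarrow> ('o, 'a, 'b) bifun \<Rightarrow>
     ('o, 'a \<times> 'a \<times> 'a, 'b \<times> 'b \<times> 'b) bifun" where
  "hbifun C F = \<lparr> fob = fob F,
     f11 = (\<lambda>f g. hext (Cell1 C (fob F (dom1 C (fst f)) (dom1 C (fst g)))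
                                (fob F (cod1 C (fst f)) (cod1 C (fst g)))) (f11 F) f g),
     f12 = (\<lambda>f \<psi>. hext (Cell2 C (fob F (dom1 C (fst f)) (dom2 C (fst \<psi>)))
                                (fob F (cod1 C (fst f)) (cod2 C (fst \<psi>)))) (f12 F) f \<psi>),
     f21 = (\<lambda>\<phi> g. hext (Cell2 C (fob F (dom2 C (fst \<phi>)) (dom1 C (fst g)))
                                (fob F (cod2 C (fst \<phi>)) (cod1 C (fst g)))) (f21 F) \<phi> g) \<rparr>"

definition hcat ::
    "('o, 'k, 'a, 'b) ch_mon_cat \<Rightarrow>
     ('o, 'k \<times> 'k \<times> 'k, 'a \<times> 'a \<times> 'a, 'b \<times> 'b \<times> 'b) ch_mon_cat" where
  "hcat C = \<lparr>
     Cell1 = (\<lambda>U V. hmodule (Cell1 C U V)),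
     Cell2 = (\<lambda>U V. hmodule (Cell2 C U V)),
     dom1 = (\<lambda>f. dom1 C (fst f)),
     cod1 = (\<lambda>f. cod1 C (fst f)),
     dom2 = (\<lambda>\<phi>. dom2 C (fst \<phi>)),
     cod2 = (\<lambda>\<phi>. cod2 C (fst \<phi>)),
     bdry = hmap (bdry C),
     ident = (\<lambda>U. hconst1 C (\<one>\<^sub>1\<^bsub>C\<^esub> U)),
     comp11 = (\<lambda>g f. hext (Cell1 C (dom1 C (fst f)) (cod1 C (fst g))) (comp11 C) g f),
     comp12 = (\<lambda>g \<phi>. hext (Cell2 C (dom2 C (fst \<phi>)) (cod1 C (fst g))) (comp12 C) g \<phi>),
     comp21 = (\<lambda>\<phi> f. hext (Cell2 C (dom1 C (fst f)) (cod2 C (fst \<phi>))) (comp21 C) \<phi> f),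
     tensor = hbifun C (tensor C),
     unit_ob = unit_ob C \<rparr>"

definition hptrans ::
    "('o, 'k, 'a, 'b, 'z) ch_cat_scheme \<Rightarrow> ('o, 'a, 'b) bifun \<Rightarrow> ('o, 'a, 'b) bifun \<Rightarrow>
     ('o, 'a, 'b) ptrans \<Rightarrow> ('o, 'a \<times> 'a \<times> 'a, 'b \<times> 'b \<times> 'b) ptrans" where
  "hptrans C F G \<xi> = \<lparr>
     pt_cell = (\<lambda>U V. hconst1 C (\<xi>\<langle>U, V\<rangle>)),
     pt_htpy = (\<lambda>f g. hext (Cell2 C (fob F (dom1 C (fst f)) (dom1 C (fst g)))
                                    (fob G (cod1 C (fst f)) (cod1 C (fst g))))
                           (\<lambda>f g. \<xi>\<langle>f \<boxtimes> g\<rangle>) f g) \<rparr>"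

text \<open>The scalars \<open>h/n\<close> and \<open>h\<^sup>2/n\<close>.\<close>

definition h_over :: "('k, 'z) ring_scheme \<Rightarrow> nat \<Rightarrow> 'k \<times> 'k \<times> 'k" where
  "h_over K n = (\<zero>\<^bsub>K\<^esub>, inv\<^bsub>K\<^esub> ([n] \<cdot>\<^bsub>K\<^esub> \<one>\<^bsub>K\<^esub>), \<zero>\<^bsub>K\<^esub>)"

definition h2_over :: "('k, 'z) ring_scheme \<Rightarrow> nat \<Rightarrow> 'k \<times> 'k \<times> 'k" where
  "h2_over K n = (\<zero>\<^bsub>K\<^esub>, \<zero>\<^bsub>K\<^esub>, inv\<^bsub>K\<^esub> ([n] \<cdot>\<^bsub>K\<^esub> \<one>\<^bsub>K\<^esub>))"


section \<open>The deformed structure\<close>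

definition t_h ::
    "('o, 'k, 'a, 'b) ch_mon_cat \<Rightarrow> ('o, 'a, 'b) ptrans \<Rightarrow>
     ('o, 'a \<times> 'a \<times> 'a, 'b \<times> 'b \<times> 'b) ptrans" where
  "t_h C t = hptrans C (tensor C) (tensor C) t"

definition gamma_h ::
    "('o, 'k, 'a, 'b) ch_mon_cat \<Rightarrow> ('o, 'a, 'b) ptrans \<Rightarrow>
     ('o, 'a \<times> 'a \<times> 'a, 'b \<times> 'b \<times> 'b) ptrans" where
  "gamma_h C \<gamma> = hptrans C (tensor C) (op_bifun (tensor C)) \<gamma>"

text \<open>
  \<open>\<sigma> = \<gamma> (1 + (h/2) t + (h\<^sup>2/8) t\<^sup>2)\<close> as a pseudonatural transformation from \<open>\<otimes>\<close> to the opposite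
  tensor product.
\<close>

definition exp_t ::
    "('k, 'y) ring_scheme \<Rightarrow> ('o, 'k, 'a, 'b) ch_mon_cat \<Rightarrow> ('o, 'a, 'b) ptrans \<Rightarrow>
     ('o, 'a \<times> 'a \<times> 'a, 'b \<times> 'b \<times> 'b) ptrans" where
  "exp_t K C t =
     (let D = hcat C; F = tensor D; t' = t_h C t in
      pt_add D F F
        (pt_add D F F (pt_id D F) (pt_smult D F F (h_over K 2) t'))
        (pt_smult D F F (h2_over K 8) (pt_comp D F F t' t')))"

definition sigma ::
    "('k, 'y) ring_scheme \<Rightarrow> ('o, 'k, 'a, 'b) ch_mon_cat \<Rightarrow> ('o, 'a, 'b) ptrans \<Rightarrow>
     ('o, 'a, 'b) ptrans \<Rightarrow> ('o, 'a \<times> 'a \<times> 'a, 'b \<times> 'b \<times> 'b) ptrans" where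
  "sigma K C \<gamma> t =
     (let D = hcat C; F = tensor D in
      pt_comp D F (op_bifun F) (gamma_h C \<gamma>) (exp_t K C t))"

text \<open>
  Of the associator only the 1-cell components are needed: its homotopy components do not occur in
  the axioms of a syllepsis.
\<close>

definition t12 ::
    "('o, 'k, 'a, 'b) ch_mon_cat \<Rightarrow> ('o, 'a, 'b) ptrans \<Rightarrow> 'o \<Rightarrow> 'o \<Rightarrow> 'o \<Rightarrow> 'a \<times> 'a \<times> 'a" where
  "t12 C t U V W = (t_h C t)\<langle>U, V\<rangle> \<otimes>\<^sub>1\<^sub>1\<^bsub>hcat C\<^esub> \<one>\<^sub>1\<^bsub>hcat C\<^esub> W"

definition t23 ::
    "('o, 'k, 'a, 'b) ch_mon_cat \<Rightarrow> ('o, 'a, 'b) ptrans \<Rightarrow> 'o \<Rightarrow> 'o \<Rightarrow> 'o \<Rightarrow> 'a \<times> 'a \<times> 'a" where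
  "t23 C t U V W = \<one>\<^sub>1\<^bsub>hcat C\<^esub> U \<otimes>\<^sub>1\<^sub>1\<^bsub>hcat C\<^esub> (t_h C t)\<langle>V, W\<rangle>"

definition alpha ::
    "('k, 'y) ring_scheme \<Rightarrow> ('o, 'k, 'a, 'b) ch_mon_cat \<Rightarrow> ('o, 'a, 'b) ptrans \<Rightarrow>
     'o \<Rightarrow> 'o \<Rightarrow> 'o \<Rightarrow> 'a \<times> 'a \<times> 'a" where
  "alpha K C t U V W =
     (let D = hcat C; X = U \<otimes>\<^sub>0\<^bsub>C\<^esub> V \<otimes>\<^sub>0\<^bsub>C\<^esub> W; M = Cell1 D X X in
      \<one>\<^sub>1\<^bsub>D\<^esub> X \<oplus>\<^bsub>M\<^esub> h2_over K 24 \<odot>\<^bsub>M\<^esub>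
        (t12 C t U V W \<cdot>\<^sub>1\<^sub>1\<^bsub>D\<^esub> t23 C t U V W \<ominus>\<^bsub>M\<^esub> t23 C t U V W \<cdot>\<^sub>1\<^sub>1\<^bsub>D\<^esub> t12 C t U V W))"

text \<open>\<open>\<L> = t\<langle>t\<langle>U, V\<rangle> \<boxtimes> 1\<rangle>\<close> and \<open>\<R> = t\<langle>1 \<boxtimes> t\<langle>V, W\<rangle>\<rangle>\<close>.\<close>

definition left_t ::
    "('o, 'k, 'a, 'b) ch_mon_cat \<Rightarrow> ('o, 'a, 'b) ptrans \<Rightarrow> 'o \<Rightarrow> 'o \<Rightarrow> 'o \<Rightarrow> 'b \<times> 'b \<times> 'b" where
  "left_t C t U V W = (t_h C t)\<langle>(t_h C t)\<langle>U, V\<rangle> \<boxtimes> \<one>\<^sub>1\<^bsub>hcat C\<^esub> W\<rangle>"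

definition right_t ::
    "('o, 'k, 'a, 'b) ch_mon_cat \<Rightarrow> ('o, 'a, 'b) ptrans \<Rightarrow> 'o \<Rightarrow> 'o \<Rightarrow> 'o \<Rightarrow> 'b \<times> 'b \<times> 'b" where
  "right_t C t U V W = (t_h C t)\<langle>\<one>\<^sub>1\<^bsub>hcat C\<^esub> U \<boxtimes> (t_h C t)\<langle>V, W\<rangle>\<rangle>"

definition hexL ::
    "('k, 'y) ring_scheme \<Rightarrow> ('o, 'k, 'a, 'b) ch_mon_cat \<Rightarrow> ('o, 'a, 'b) ptrans \<Rightarrow>
     ('o, 'a, 'b) ptrans \<Rightarrow> 'o \<Rightarrow> 'o \<Rightarrow> 'o \<Rightarrow> 'b \<times> 'b \<times> 'b" where
  "hexL K C \<gamma> t U V W =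
     (let D = hcat C; X = U \<otimes>\<^sub>0\<^bsub>C\<^esub> V \<otimes>\<^sub>0\<^bsub>C\<^esub> W; Y = V \<otimes>\<^sub>0\<^bsub>C\<^esub> W \<otimes>\<^sub>0\<^bsub>C\<^esub> U; M = Cell2 D X X;
          \<L> = left_t C t U V W; \<R> = right_t C t U V W in
      h2_over K 24 \<odot>\<^bsub>Cell2 D X Y\<^esub>
        ((gamma_h C \<gamma>)\<langle>U, V \<otimes>\<^sub>0\<^bsub>C\<^esub> W\<rangle> \<cdot>\<^sub>1\<^sub>2\<^bsub>D\<^esub> (\<L> \<oplus>\<^bsub>M\<^esub> \<L> \<oplus>\<^bsub>M\<^esub> \<R>)))"

definition hexR ::
    "('k, 'y) ring_scheme \<Rightarrow> ('o, 'k, 'a, 'b) ch_mon_cat \<Rightarrow> ('o, 'a, 'b) ptrans \<Rightarrow>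
     ('o, 'a, 'b) ptrans \<Rightarrow> 'o \<Rightarrow> 'o \<Rightarrow> 'o \<Rightarrow> 'b \<times> 'b \<times> 'b" where
  "hexR K C \<gamma> t U V W =
     (let D = hcat C; X = U \<otimes>\<^sub>0\<^bsub>C\<^esub> V \<otimes>\<^sub>0\<^bsub>C\<^esub> W; Y = W \<otimes>\<^sub>0\<^bsub>C\<^esub> U \<otimes>\<^sub>0\<^bsub>C\<^esub> V; M = Cell2 D X X;
          \<L> = left_t C t U V W; \<R> = right_t C t U V W in
      h2_over K 24 \<odot>\<^bsub>Cell2 D X Y\<^esub>
        ((gamma_h C \<gamma>)\<langle>U \<otimes>\<^sub>0\<^bsub>C\<^esub> V, W\<rangle> \<cdot>\<^sub>1\<^sub>2\<^bsub>D\<^esub> (\<L> \<oplus>\<^bsub>M\<^esub> \<R> \<oplus>\<^bsub>M\<^esub> \<R>)))"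


section \<open>Symmetric syllepses\<close>

text \<open>
  The inverse cells occurring in the axioms presuppose that \<open>\<alpha>\<close> and \<open>\<sigma>\<close> are invertible; this is
  the content of \<open>alpha_invertible\<close> and \<open>sigma_invertible\<close>. \<open>HLi\<close> and \<open>HRi\<close> are the components of
  the inverses of the modifications \<open>HL\<close> and \<open>HR\<close>, and \<open>\<sigma>i\<close> is the inverse of \<open>\<sigma>\<close>.
\<close>

locale symmetric_syllepsis =
  fixes C :: "('o, 'r, 'a, 'b, 'z) ch_mon_cat_scheme" (structure)
    and \<alpha> :: "'o \<Rightarrow> 'o \<Rightarrow> 'o \<Rightarrow> 'a"
    and \<sigma> :: "('o, 'a, 'b) ptrans"
    and HL HR :: "'o \<Rightarrow> 'o \<Rightarrow> 'o \<Rightarrow> 'b"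
    and \<Sigma> :: "'o \<Rightarrow> 'o \<Rightarrow> 'b"
    and \<alpha>i :: "'o \<Rightarrow> 'o \<Rightarrow> 'o \<Rightarrow> 'a"
    and \<sigma>i :: "('o, 'a, 'b) ptrans"
    and HLi HRi :: "'o \<Rightarrow> 'o \<Rightarrow> 'o \<Rightarrow> 'b"
  defines "\<alpha>i \<equiv> \<lambda>U V W. inv1 C (\<alpha> U V W)"
    and "\<sigma>i \<equiv> pt_inv C (tensor C) (op_bifun (tensor C)) \<sigma>"
    and "HLi \<equiv> \<lambda>U V W. mod_inv C (U \<otimes>\<^sub>0 V \<otimes>\<^sub>0 W) (V \<otimes>\<^sub>0 W \<otimes>\<^sub>0 U)
      (\<alpha> V W U \<cdot>\<^sub>1\<^sub>1 \<sigma>\<langle>U, V \<otimes>\<^sub>0 W\<rangle> \<cdot>\<^sub>1\<^sub>1 \<alpha> U V W)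
      ((\<one>\<^sub>1 V \<otimes>\<^sub>1\<^sub>1 \<sigma>\<langle>U, W\<rangle>) \<cdot>\<^sub>1\<^sub>1 \<alpha> V U W \<cdot>\<^sub>1\<^sub>1 (\<sigma>\<langle>U, V\<rangle> \<otimes>\<^sub>1\<^sub>1 \<one>\<^sub>1 W))
      (HL U V W)"
    and "HRi \<equiv> \<lambda>U V W. mod_inv C (U \<otimes>\<^sub>0 V \<otimes>\<^sub>0 W) (W \<otimes>\<^sub>0 U \<otimes>\<^sub>0 V)
      (\<alpha>i W U V \<cdot>\<^sub>1\<^sub>1 \<sigma>\<langle>U \<otimes>\<^sub>0 V, W\<rangle> \<cdot>\<^sub>1\<^sub>1 \<alpha>i U V W)
      ((\<sigma>\<langle>U, W\<rangle> \<otimes>\<^sub>1\<^sub>1 \<one>\<^sub>1 V) \<cdot>\<^sub>1\<^sub>1 \<alpha>i U W V \<cdot>\<^sub>1\<^sub>1 (\<one>\<^sub>1 U \<otimes>\<^sub>1\<^sub>1 \<sigma>\<langle>V, W\<rangle>))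
      (HR U V W)"
  assumes alpha_invertible:
      "invertible1 C (U \<otimes>\<^sub>0 V \<otimes>\<^sub>0 W) (U \<otimes>\<^sub>0 V \<otimes>\<^sub>0 W) (\<alpha> U V W)"
    and sigma_invertible: "invertible1 C (U \<otimes>\<^sub>0 V) (V \<otimes>\<^sub>0 U) (\<sigma>\<langle>U, V\<rangle>)"
    and Sigma_closed: "\<Sigma> U V \<in> carrier (Cell2 C (U \<otimes>\<^sub>0 V) (V \<otimes>\<^sub>0 U))"
    and bdry_Sigma: "\<partial> (\<Sigma> U V) = \<sigma>\<langle>U, V\<rangle> \<ominus>\<^bsub>Cell1 C (U \<otimes>\<^sub>0 V) (V \<otimes>\<^sub>0 U)\<^esub> \<sigma>i\<langle>V, U\<rangle>"
    and Sigma_htpy: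
      "\<lbrakk>f \<in> carrier (Cell1 C U U'); g \<in> carrier (Cell1 C V V')\<rbrakk>
        \<Longrightarrow> \<Sigma> U' V' \<cdot>\<^sub>2\<^sub>1 (f \<otimes>\<^sub>1\<^sub>1 g) \<oplus>\<^bsub>Cell2 C (U \<otimes>\<^sub>0 V) (V' \<otimes>\<^sub>0 U')\<^esub> \<sigma>\<langle>f \<boxtimes> g\<rangle>
            = \<sigma>i\<langle>g \<boxtimes> f\<rangle> \<oplus>\<^bsub>Cell2 C (U \<otimes>\<^sub>0 V) (V' \<otimes>\<^sub>0 U')\<^esub> (g \<otimes>\<^sub>1\<^sub>1 f) \<cdot>\<^sub>1\<^sub>2 \<Sigma> U V"
    and Sigma_HL:
      "HL U V W =
         \<alpha> V W U \<cdot>\<^sub>1\<^sub>2 \<Sigma> U (V \<otimes>\<^sub>0 W) \<cdot>\<^sub>2\<^sub>1 \<alpha> U V W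
         \<oplus>\<^bsub>Cell2 C (U \<otimes>\<^sub>0 V \<otimes>\<^sub>0 W) (V \<otimes>\<^sub>0 W \<otimes>\<^sub>0 U)\<^esub> HRi V W U
         \<ominus>\<^bsub>Cell2 C (U \<otimes>\<^sub>0 V \<otimes>\<^sub>0 W) (V \<otimes>\<^sub>0 W \<otimes>\<^sub>0 U)\<^esub>
           (\<one>\<^sub>1 V \<otimes>\<^sub>1\<^sub>1 \<sigma>i\<langle>W, U\<rangle>) \<cdot>\<^sub>1\<^sub>1 \<alpha> V U W \<cdot>\<^sub>1\<^sub>2 (\<Sigma> U V \<otimes>\<^sub>2\<^sub>1 \<one>\<^sub>1 W)
         \<ominus>\<^bsub>Cell2 C (U \<otimes>\<^sub>0 V \<otimes>\<^sub>0 W) (V \<otimes>\<^sub>0 W \<otimes>\<^sub>0 U)\<^esub>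
           (\<one>\<^sub>1 V \<otimes>\<^sub>1\<^sub>2 \<Sigma> U W) \<cdot>\<^sub>2\<^sub>1 \<alpha> V U W \<cdot>\<^sub>2\<^sub>1 (\<sigma>\<langle>U, V\<rangle> \<otimes>\<^sub>1\<^sub>1 \<one>\<^sub>1 W)"
    and Sigma_HR:
      "HR U V W =
         \<alpha>i W U V \<cdot>\<^sub>1\<^sub>2 \<Sigma> (U \<otimes>\<^sub>0 V) W \<cdot>\<^sub>2\<^sub>1 \<alpha>i U V W
         \<oplus>\<^bsub>Cell2 C (U \<otimes>\<^sub>0 V \<otimes>\<^sub>0 W) (W \<otimes>\<^sub>0 U \<otimes>\<^sub>0 V)\<^esub> HLi W U V
         \<ominus>\<^bsub>Cell2 C (U \<otimes>\<^sub>0 V \<otimes>\<^sub>0 W) (W \<otimes>\<^sub>0 U \<otimes>\<^sub>0 V)\<^esub>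
           (\<sigma>i\<langle>W, U\<rangle> \<otimes>\<^sub>1\<^sub>1 \<one>\<^sub>1 V) \<cdot>\<^sub>1\<^sub>1 \<alpha>i U W V \<cdot>\<^sub>1\<^sub>2 (\<one>\<^sub>1 U \<otimes>\<^sub>1\<^sub>2 \<Sigma> V W)
         \<ominus>\<^bsub>Cell2 C (U \<otimes>\<^sub>0 V \<otimes>\<^sub>0 W) (W \<otimes>\<^sub>0 U \<otimes>\<^sub>0 V)\<^esub>
           (\<Sigma> U W \<otimes>\<^sub>2\<^sub>1 \<one>\<^sub>1 V) \<cdot>\<^sub>2\<^sub>1 \<alpha>i U W V \<cdot>\<^sub>2\<^sub>1 (\<one>\<^sub>1 U \<otimes>\<^sub>1\<^sub>1 \<sigma>\<langle>V, W\<rangle>)"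
    and Sigma_symmetric: "\<Sigma> U V = \<sigma>i\<langle>V, U\<rangle> \<cdot>\<^sub>1\<^sub>2 \<Sigma> V U \<cdot>\<^sub>2\<^sub>1 \<sigma>\<langle>U, V\<rangle>"

end

theory Submission
  imports Defs
begin

text \<open>
  Cells over \<open>K[h]/(h\<^sup>3)\<close> are triples of coefficients, so every axiom splits into identities between
  cells of \<open>C\<close> in the degrees \<open>1\<close>, \<open>h\<close> and \<open>h\<^sup>2\<close>. Symmetry of \<open>t\<close> gives \<open>\<sigma> = \<gamma> e\<close> and
  \<open>\<sigma>\<inverse>\<^sub>V\<^sub>U = \<gamma>\<^sub>U\<^sub>V e\<inverse>\<close>, where \<open>e = 1 + (h/2) t + (h\<^sup>2/8) t\<^sup>2\<close> has inverse \<open>1 - (h/2) t + (h\<^sup>2/8) t\<^sup>2\<close>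
  (\<open>sigma_inv_cell\<close>). Hence \<open>\<sigma> - \<sigma>\<inverse> = h \<gamma> t\<close>, which is the boundary of \<open>\<Sigma> = h \<gamma> T\<close>.

  On the homotopy components, \<open>e\<close> and \<open>e\<inverse>\<close> again differ only by their odd part \<open>h t\<langle>f \<boxtimes> g\<rangle>\<close>
  (\<open>htpy_double\<close>), and this is exactly the failure of \<open>T\<close> to be natural; so \<open>\<Sigma>\<close> is a modification
  \<open>\<sigma> \<Rrightarrow> \<sigma>\<inverse>\<close>. For the symmetry of \<open>\<Sigma>\<close> note \<open>t T = (\<partial>T) T = T (\<partial>T) = T t\<close>: conjugation by \<open>e\<close> does not
  move \<open>T\<close>.

  In the two hexagon axioms the associator is \<open>1\<close> up to \<open>h\<^sup>2\<close>, and \<open>\<Sigma>\<close> is divisible by \<open>h\<close>, so it can be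
  ignored. Degree \<open>h\<close> is the additivity of \<open>T\<close> in its two arguments (\<open>gamma_T_split\<close>). In degree
  \<open>h\<^sup>2\<close> the two terms that involve \<open>T\<close> are, up to a common factor, \<open>(\<partial>A) B\<close> and \<open>-A (\<partial>B)\<close> for whiskered copies \<open>A\<close>,
  \<open>B\<close> of \<open>\<gamma> T\<close>, and they cancel (\<open>hexagon_expansion\<close>). There remains the claim that \<open>HR\<inverse>\<close> at
  \<open>V, W, U\<close> equals \<open>HL\<close> at \<open>U, V, W\<close>, and its mirror image (\<open>hexR_inverse\<close>, \<open>hexL_inverse\<close>).
  Conjugation by \<open>\<gamma>\<close> sends \<open>\<L>\<close> at \<open>V, W, U\<close> to \<open>\<R>\<close> at \<open>U, V, W\<close> by symmetry of \<open>t\<close>, and sends \<open>\<R>\<close> to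
  \<open>-(\<L> + \<R>)\<close> by total symmetry and coherence. So it sends \<open>\<L> + 2\<R>\<close> to \<open>-(2\<L> + \<R>)\<close>, and the sign is
  absorbed by the one in the inverse of a modification.
\<close>



section \<open>Bilinear maps and triples\<close>

lemma bilinear_rules:
  assumes b: "bilinear_map R M N P b" and "module R M" "module R N" "module R P"
  shows bilinear_closed: "\<And>x y. \<lbrakk>x \<in> carrier M; y \<in> carrier N\<rbrakk> \<Longrightarrow> b x y \<in> carrier P"
    and bilinear_add_left: "\<And>x x' y. \<lbrakk>x \<in> carrier M; x' \<in> carrier M; y \<in> carrier N\<rbrakk>
      \<Longrightarrow> b (x \<oplus>\<^bsub>M\<^esub> x') y = b x y \<oplus>\<^bsub>P\<^esub> b x' y"
    and bilinear_add_right: "\<And>x y y'. \<lbrakk>x \<in> carrier M; y \<in> carrier N; y' \<in> carrier N\<rbrakk>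
      \<Longrightarrow> b x (y \<oplus>\<^bsub>N\<^esub> y') = b x y \<oplus>\<^bsub>P\<^esub> b x y'"
    and bilinear_smult_left: "\<And>r x y. \<lbrakk>r \<in> carrier R; x \<in> carrier M; y \<in> carrier N\<rbrakk>
      \<Longrightarrow> b (r \<odot>\<^bsub>M\<^esub> x) y = r \<odot>\<^bsub>P\<^esub> b x y"
    and bilinear_smult_right: "\<And>r x y. \<lbrakk>r \<in> carrier R; x \<in> carrier M; y \<in> carrier N\<rbrakk>
      \<Longrightarrow> b x (r \<odot>\<^bsub>N\<^esub> y) = r \<odot>\<^bsub>P\<^esub> b x y"
    and bilinear_zero_left: "\<And>y. y \<in> carrier N \<Longrightarrow> b \<zero>\<^bsub>M\<^esub> y = \<zero>\<^bsub>P\<^esub>"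
    and bilinear_zero_right: "\<And>x. x \<in> carrier M \<Longrightarrow> b x \<zero>\<^bsub>N\<^esub> = \<zero>\<^bsub>P\<^esub>"
    and bilinear_neg_left: "\<And>x y. \<lbrakk>x \<in> carrier M; y \<in> carrier N\<rbrakk>
      \<Longrightarrow> b (\<ominus>\<^bsub>M\<^esub> x) y = \<ominus>\<^bsub>P\<^esub> b x y"
    and bilinear_neg_right: "\<And>x y. \<lbrakk>x \<in> carrier M; y \<in> carrier N\<rbrakk>
      \<Longrightarrow> b x (\<ominus>\<^bsub>N\<^esub> y) = \<ominus>\<^bsub>P\<^esub> b x y"
proof -
  interpret M: module R M by fact
  interpret N: module R N by fact
  interpret P: module R P by fact
  show closed: "b x y \<in> carrier P" if "x \<in> carrier M" "y \<in> carrier N" for x y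
    using b that by (auto simp: bilinear_map_def linear_map_def)
  show al: "b (x \<oplus>\<^bsub>M\<^esub> x') y = b x y \<oplus>\<^bsub>P\<^esub> b x' y"
    if "x \<in> carrier M" "x' \<in> carrier M" "y \<in> carrier N" for x x' y
    using b that by (auto simp: bilinear_map_def linear_map_def)
  show ar: "b x (y \<oplus>\<^bsub>N\<^esub> y') = b x y \<oplus>\<^bsub>P\<^esub> b x y'"
    if "x \<in> carrier M" "y \<in> carrier N" "y' \<in> carrier N" for x y y'
    using b that by (auto simp: bilinear_map_def linear_map_def)
  show sl: "b (r \<odot>\<^bsub>M\<^esub> x) y = r \<odot>\<^bsub>P\<^esub> b x y"
    if "r \<in> carrier R" "x \<in> carrier M" "y \<in> carrier N" for r x y
    using b that by (auto simp: bilinear_map_def linear_map_def)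
  show sr: "b x (r \<odot>\<^bsub>N\<^esub> y) = r \<odot>\<^bsub>P\<^esub> b x y"
    if "r \<in> carrier R" "x \<in> carrier M" "y \<in> carrier N" for r x y
    using b that by (auto simp: bilinear_map_def linear_map_def)
  show zl: "b \<zero>\<^bsub>M\<^esub> y = \<zero>\<^bsub>P\<^esub>" if "y \<in> carrier N" for y
    using sl[of "\<zero>\<^bsub>R\<^esub>" "\<zero>\<^bsub>M\<^esub>" y] closed that by simp
  show zr: "b x \<zero>\<^bsub>N\<^esub> = \<zero>\<^bsub>P\<^esub>" if "x \<in> carrier M" for x
    using sr[of "\<zero>\<^bsub>R\<^esub>" x "\<zero>\<^bsub>N\<^esub>"] closed that by simp
  show "b (\<ominus>\<^bsub>M\<^esub> x) y = \<ominus>\<^bsub>P\<^esub> b x y" if "x \<in> carrier M" "y \<in> carrier N" for x y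
    using al[of "\<ominus>\<^bsub>M\<^esub> x" x y] that closed zl by (simp add: M.M.l_neg P.M.minus_equality)
  show "b x (\<ominus>\<^bsub>N\<^esub> y) = \<ominus>\<^bsub>P\<^esub> b x y" if "x \<in> carrier M" "y \<in> carrier N" for x y
    using ar[of x "\<ominus>\<^bsub>N\<^esub> y" y] that closed zr by (simp add: N.M.l_neg P.M.minus_equality)
qed

lemma hext_triple:
  "hext P b (x0, x1, x2) (y0, y1, y2) =
     (b x0 y0, b x0 y1 \<oplus>\<^bsub>P\<^esub> b x1 y0, b x0 y2 \<oplus>\<^bsub>P\<^esub> b x1 y1 \<oplus>\<^bsub>P\<^esub> b x2 y0)"
  by (simp add: hext_def)

lemma fst_hext [simp]: "fst (hext P b x y) = b (fst x) (fst y)"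
  by (simp add: hext_def split: prod.split)

lemma hmodule_simps [simp]:
  "(x0, x1, x2) \<in> carrier (hmodule M) \<longleftrightarrow>
     x0 \<in> carrier M \<and> x1 \<in> carrier M \<and> x2 \<in> carrier M"
  "(x0, x1, x2) \<oplus>\<^bsub>hmodule M\<^esub> (y0, y1, y2) = (x0 \<oplus>\<^bsub>M\<^esub> y0, x1 \<oplus>\<^bsub>M\<^esub> y1, x2 \<oplus>\<^bsub>M\<^esub> y2)"
  "\<zero>\<^bsub>hmodule M\<^esub> = (\<zero>\<^bsub>M\<^esub>, \<zero>\<^bsub>M\<^esub>, \<zero>\<^bsub>M\<^esub>)"
  by (simp_all add: hmodule_def)

lemma hmodule_carrierE:
  assumes "x \<in> carrier (hmodule M)"
  obtains x0 x1 x2 where "x = (x0, x1, x2)"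
    "x0 \<in> carrier M" "x1 \<in> carrier M" "x2 \<in> carrier M"
  using assms by (cases x) auto

lemma fst_closed: "x \<in> carrier (hmodule M) \<Longrightarrow> fst x \<in> carrier M"
  by (cases x) simp

lemma hmodule_neg:
  assumes "abelian_group M" "x0 \<in> carrier M" "x1 \<in> carrier M" "x2 \<in> carrier M"
  shows "\<ominus>\<^bsub>hmodule M\<^esub> (x0, x1, x2) = (\<ominus>\<^bsub>M\<^esub> x0, \<ominus>\<^bsub>M\<^esub> x1, \<ominus>\<^bsub>M\<^esub> x2)"
proof -
  interpret abelian_group M by fact
  interpret H: abelian_group "hmodule M" by (rule abelian_group_hmodule) fact
  show ?thesis
    by (rule H.minus_equality) (use assms in \<open>simp_all add: l_neg\<close>)
qed

lemma hmodule_minus: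
  assumes "abelian_group M" "x0 \<in> carrier M" "x1 \<in> carrier M" "x2 \<in> carrier M"
    "y0 \<in> carrier M" "y1 \<in> carrier M" "y2 \<in> carrier M"
  shows "(x0, x1, x2) \<ominus>\<^bsub>hmodule M\<^esub> (y0, y1, y2)
    = (x0 \<ominus>\<^bsub>M\<^esub> y0, x1 \<ominus>\<^bsub>M\<^esub> y1, x2 \<ominus>\<^bsub>M\<^esub> y2)"
  using assms by (simp add: a_minus_def hmodule_neg)

lemma hmodule_smult_h:
  assumes "module R M" "inv\<^bsub>R\<^esub> ([n] \<cdot>\<^bsub>R\<^esub> \<one>\<^bsub>R\<^esub>) \<in> carrier R"
    "x0 \<in> carrier M" "x1 \<in> carrier M" "x2 \<in> carrier M"
  shows "h_over R n \<odot>\<^bsub>hmodule M\<^esub> (x0, x1, x2)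
      = (\<zero>\<^bsub>M\<^esub>, inv\<^bsub>R\<^esub> ([n] \<cdot>\<^bsub>R\<^esub> \<one>\<^bsub>R\<^esub>) \<odot>\<^bsub>M\<^esub> x0, inv\<^bsub>R\<^esub> ([n] \<cdot>\<^bsub>R\<^esub> \<one>\<^bsub>R\<^esub>) \<odot>\<^bsub>M\<^esub> x1)"
    and "h2_over R n \<odot>\<^bsub>hmodule M\<^esub> (x0, x1, x2)
      = (\<zero>\<^bsub>M\<^esub>, \<zero>\<^bsub>M\<^esub>, inv\<^bsub>R\<^esub> ([n] \<cdot>\<^bsub>R\<^esub> \<one>\<^bsub>R\<^esub>) \<odot>\<^bsub>M\<^esub> x0)"
proof -
  interpret module R M by fact
  show "h_over R n \<odot>\<^bsub>hmodule M\<^esub> (x0, x1, x2)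
      = (\<zero>\<^bsub>M\<^esub>, inv\<^bsub>R\<^esub> ([n] \<cdot>\<^bsub>R\<^esub> \<one>\<^bsub>R\<^esub>) \<odot>\<^bsub>M\<^esub> x0, inv\<^bsub>R\<^esub> ([n] \<cdot>\<^bsub>R\<^esub> \<one>\<^bsub>R\<^esub>) \<odot>\<^bsub>M\<^esub> x1)"
    and "h2_over R n \<odot>\<^bsub>hmodule M\<^esub> (x0, x1, x2)
      = (\<zero>\<^bsub>M\<^esub>, \<zero>\<^bsub>M\<^esub>, inv\<^bsub>R\<^esub> ([n] \<cdot>\<^bsub>R\<^esub> \<one>\<^bsub>R\<^esub>) \<odot>\<^bsub>M\<^esub> x0)"
    using assms by (simp_all add: hmodule_def h_over_def h2_over_def hext_triple)
qed


section \<open>The extended category\<close>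

locale extended_category = field K + sym_strict_monoidal K C \<gamma>
  for K :: "('k, 'y) ring_scheme"
    and C :: "('o, 'k, 'a, 'b) ch_mon_cat" (structure)
    and \<gamma> :: "('o, 'a, 'b) ptrans"
begin

abbreviation D :: "('o, 'k \<times> 'k \<times> 'k, 'a \<times> 'a \<times> 'a, 'b \<times> 'b \<times> 'b) ch_mon_cat"
  where "D \<equiv> hcat C"

text \<open>
  Additions and zeros carry their hom module as a subscript, so rules for general objects would
  have to guess the objects. The following families are therefore instantiated with the objects at hand
  before they are used for rewriting.
\<close>

lemmas comp11_rules = bilinear_rules[OF comp11_bilinear[of V W U] module_Cell1 module_Cell1 module_Cell1]
  for U V W
lemmas comp12_rules = bilinear_rules[OF comp12_bilinear[of V W U] module_Cell1 module_Cell2 module_Cell2]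
  for U V W
lemmas comp21_rules = bilinear_rules[OF comp21_bilinear[of V W U] module_Cell2 module_Cell1 module_Cell2]
  for U V W
lemmas tens11_rules = bilinear_rules[OF f11_bilinear[of U U' V V'] module_Cell1 module_Cell1 module_Cell1]
  for U U' V V'
lemmas tens12_rules = bilinear_rules[OF f12_bilinear[of U U' V V'] module_Cell1 module_Cell2 module_Cell2]
  for U U' V V'
lemmas tens21_rules = bilinear_rules[OF f21_bilinear[of U U' V V'] module_Cell2 module_Cell1 module_Cell2]
  for U U' V V'

lemmas comp11_closed = bilinear_closed[OF comp11_bilinear module_Cell1 module_Cell1 module_Cell1]
lemmas comp12_closed = bilinear_closed[OF comp12_bilinear module_Cell1 module_Cell2 module_Cell2]
lemmas comp21_closed = bilinear_closed[OF comp21_bilinear module_Cell2 module_Cell1 module_Cell2]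
lemmas tens11_closed = bilinear_closed[OF f11_bilinear module_Cell1 module_Cell1 module_Cell1]
lemmas tens12_closed = bilinear_closed[OF f12_bilinear module_Cell1 module_Cell2 module_Cell2]
lemmas tens21_closed = bilinear_closed[OF f21_bilinear module_Cell2 module_Cell1 module_Cell2]

lemmas group_Cell1 = module.axioms(2)[OF module_Cell1]
lemmas group_Cell2 = module.axioms(2)[OF module_Cell2]

lemma zero_Cell1 [simp]: "\<zero>\<^bsub>Cell1 C U V\<^esub> \<in> carrier (Cell1 C U V)"
  and zero_Cell2 [simp]: "\<zero>\<^bsub>Cell2 C U V\<^esub> \<in> carrier (Cell2 C U V)"
  using abelian_group.axioms(1)[OF group_Cell1] abelian_group.axioms(1)[OF group_Cell2]
  by (simp_all add: abelian_monoid.zero_closed)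

lemma bdry_closed: "\<phi> \<in> carrier (Cell2 C U V) \<Longrightarrow> \<partial> \<phi> \<in> carrier (Cell1 C U V)"
  using bdry_linear[of U V] by (simp add: linear_map_def)

lemma bdry_zero: "\<partial> \<zero>\<^bsub>Cell2 C U V\<^esub> = \<zero>\<^bsub>Cell1 C U V\<^esub>"
proof -
  interpret M: module K "Cell1 C U V" by (rule module_Cell1)
  interpret N: module K "Cell2 C U V" by (rule module_Cell2)
  have "\<partial> (\<zero>\<^bsub>K\<^esub> \<odot>\<^bsub>Cell2 C U V\<^esub> \<zero>\<^bsub>Cell2 C U V\<^esub>)
      = \<zero>\<^bsub>K\<^esub> \<odot>\<^bsub>Cell1 C U V\<^esub> (\<partial> \<zero>\<^bsub>Cell2 C U V\<^esub>)"
    using bdry_linear[of U V] unfolding linear_map_def by blast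
  then show ?thesis
    by (simp add: bdry_closed)
qed

lemma neg_zero_Cell2 [simp]: "\<ominus>\<^bsub>Cell2 C U V\<^esub> \<zero>\<^bsub>Cell2 C U V\<^esub> = \<zero>\<^bsub>Cell2 C U V\<^esub>"
  by (rule abelian_group.minus_equality[OF group_Cell2])
    (simp_all add: abelian_monoid.l_zero[OF abelian_group.axioms(1)[OF group_Cell2]])

lemma hcat_simps [simp]:
  "Cell1 D U V = hmodule (Cell1 C U V)"
  "Cell2 D U V = hmodule (Cell2 C U V)"
  "dom1 D f = dom1 C (fst f)" "cod1 D f = cod1 C (fst f)"
  "dom2 D \<phi> = dom2 C (fst \<phi>)" "cod2 D \<phi> = cod2 C (fst \<phi>)"
  "bdry D \<phi> = hmap (bdry C) \<phi>"
  "fob (tensor D) = fob (tensor C)"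
  by (simp_all add: hcat_def hbifun_def)

lemma hident: "\<one>\<^sub>1\<^bsub>D\<^esub> U = (\<one>\<^sub>1 U, \<zero>\<^bsub>Cell1 C U U\<^esub>, \<zero>\<^bsub>Cell1 C U U\<^esub>)"
  using dom_cod1[OF ident_closed[of U]] by (simp add: hcat_def hconst1_def)

lemma hcomp11:
  "\<lbrakk>fst f \<in> carrier (Cell1 C U V); fst g \<in> carrier (Cell1 C V W)\<rbrakk>
    \<Longrightarrow> g \<cdot>\<^sub>1\<^sub>1\<^bsub>D\<^esub> f = hext (Cell1 C U W) (comp11 C) g f"
  by (auto simp: hcat_def dest!: dom_cod1)

lemma hcomp12:
  "\<lbrakk>fst \<phi> \<in> carrier (Cell2 C U V); fst g \<in> carrier (Cell1 C V W)\<rbrakk>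
    \<Longrightarrow> g \<cdot>\<^sub>1\<^sub>2\<^bsub>D\<^esub> \<phi> = hext (Cell2 C U W) (comp12 C) g \<phi>"
  by (auto simp: hcat_def dest!: dom_cod1 dom_cod2)

lemma hcomp21:
  "\<lbrakk>fst f \<in> carrier (Cell1 C U V); fst \<phi> \<in> carrier (Cell2 C V W)\<rbrakk>
    \<Longrightarrow> \<phi> \<cdot>\<^sub>2\<^sub>1\<^bsub>D\<^esub> f = hext (Cell2 C U W) (comp21 C) \<phi> f"
  by (auto simp: hcat_def dest!: dom_cod1 dom_cod2)

lemma htens11:
  "\<lbrakk>fst f \<in> carrier (Cell1 C U U'); fst g \<in> carrier (Cell1 C V V')\<rbrakk>
    \<Longrightarrow> f \<otimes>\<^sub>1\<^sub>1\<^bsub>D\<^esub> g = hext (Cell1 C (U \<otimes>\<^sub>0 V) (U' \<otimes>\<^sub>0 V')) (f11 (tensor C)) f g"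
  by (auto simp: hcat_def hbifun_def dest!: dom_cod1)

lemma htens12:
  "\<lbrakk>fst f \<in> carrier (Cell1 C U U'); fst \<psi> \<in> carrier (Cell2 C V V')\<rbrakk>
    \<Longrightarrow> f \<otimes>\<^sub>1\<^sub>2\<^bsub>D\<^esub> \<psi> = hext (Cell2 C (U \<otimes>\<^sub>0 V) (U' \<otimes>\<^sub>0 V')) (f12 (tensor C)) f \<psi>"
  by (auto simp: hcat_def hbifun_def dest!: dom_cod1 dom_cod2)

lemma htens21:
  "\<lbrakk>fst \<phi> \<in> carrier (Cell2 C U U'); fst g \<in> carrier (Cell1 C V V')\<rbrakk>
    \<Longrightarrow> \<phi> \<otimes>\<^sub>2\<^sub>1\<^bsub>D\<^esub> g = hext (Cell2 C (U \<otimes>\<^sub>0 V) (U' \<otimes>\<^sub>0 V')) (f21 (tensor C)) \<phi> g"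
  by (auto simp: hcat_def hbifun_def dest!: dom_cod1 dom_cod2)

lemma fst_hcomp11: "fst (g \<cdot>\<^sub>1\<^sub>1\<^bsub>D\<^esub> f) = fst g \<cdot>\<^sub>1\<^sub>1 fst f"
  and fst_htens11: "fst (f \<otimes>\<^sub>1\<^sub>1\<^bsub>D\<^esub> g) = fst f \<otimes>\<^sub>1\<^sub>1 fst g"
  by (simp_all add: hcat_def hbifun_def)

lemma hext_closed:
  assumes "bilinear_map K M N P b" "module K M" "module K N" "module K P"
    "x \<in> carrier (hmodule M)" "y \<in> carrier (hmodule N)"
  shows "hext P b x y \<in> carrier (hmodule P)"
proof -
  interpret P: module K P by fact
  note b = bilinear_closed[OF assms(1-4)]
  show ?thesis using assms(5,6) by (elim hmodule_carrierE) (simp add: hext_triple b)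
qed

lemma hcomp11_closed:
  "\<lbrakk>f \<in> carrier (Cell1 D U V); g \<in> carrier (Cell1 D V W)\<rbrakk>
    \<Longrightarrow> g \<cdot>\<^sub>1\<^sub>1\<^bsub>D\<^esub> f \<in> carrier (Cell1 D U W)"
  using hext_closed[OF comp11_bilinear module_Cell1 module_Cell1 module_Cell1]
  by (simp add: hcomp11[OF fst_closed fst_closed])

lemma htens11_closed:
  "\<lbrakk>f \<in> carrier (Cell1 D U U'); g \<in> carrier (Cell1 D V V')\<rbrakk>
    \<Longrightarrow> f \<otimes>\<^sub>1\<^sub>1\<^bsub>D\<^esub> g \<in> carrier (Cell1 D (U \<otimes>\<^sub>0 V) (U' \<otimes>\<^sub>0 V'))"
  using hext_closed[OF f11_bilinear module_Cell1 module_Cell1 module_Cell1]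
  by (simp add: htens11[OF fst_closed fst_closed])

lemma hident_closed: "\<one>\<^sub>1\<^bsub>D\<^esub> U \<in> carrier (Cell1 D U U)"
  by (simp add: hident ident_closed)

lemma hident11:
  assumes "f \<in> carrier (Cell1 D U V)"
  shows "\<one>\<^sub>1\<^bsub>D\<^esub> V \<cdot>\<^sub>1\<^sub>1\<^bsub>D\<^esub> f = f \<and> f \<cdot>\<^sub>1\<^sub>1\<^bsub>D\<^esub> \<one>\<^sub>1\<^bsub>D\<^esub> U = f"
proof -
  interpret M: module K "Cell1 C U V" by (rule module_Cell1)
  from assms obtain f0 f1 f2 where f: "f = (f0, f1, f2)"
    and ty: "f0 \<in> carrier (Cell1 C U V)" "f1 \<in> carrier (Cell1 C U V)" "f2 \<in> carrier (Cell1 C U V)"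
    by (auto elim!: hmodule_carrierE)
  show ?thesis unfolding f
    using ty ident_closed ident11
    by (simp add: hident hcomp11[of _ U U _ V] hcomp11[of _ U V _ V] hext_triple
        comp11_rules[where U=U and V=U and W=V] comp11_rules[where U=U and V=V and W=V])
qed

lemma hassoc111:
  assumes "f \<in> carrier (Cell1 D U V)" "g \<in> carrier (Cell1 D V W)" "k \<in> carrier (Cell1 D W X)"
  shows "(k \<cdot>\<^sub>1\<^sub>1\<^bsub>D\<^esub> g) \<cdot>\<^sub>1\<^sub>1\<^bsub>D\<^esub> f = k \<cdot>\<^sub>1\<^sub>1\<^bsub>D\<^esub> (g \<cdot>\<^sub>1\<^sub>1\<^bsub>D\<^esub> f)"
proof -
  interpret M: module K "Cell1 C U X" by (rule module_Cell1)
  interpret M1: module K "Cell1 C U W" by (rule module_Cell1)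
  interpret M2: module K "Cell1 C V X" by (rule module_Cell1)
  from assms obtain f0 f1 f2 g0 g1 g2 k0 k1 k2 where e: "f = (f0, f1, f2)" "g = (g0, g1, g2)" "k = (k0, k1, k2)"
    and ty: "f0 \<in> carrier (Cell1 C U V)" "f1 \<in> carrier (Cell1 C U V)" "f2 \<in> carrier (Cell1 C U V)"
    "g0 \<in> carrier (Cell1 C V W)" "g1 \<in> carrier (Cell1 C V W)" "g2 \<in> carrier (Cell1 C V W)"
    "k0 \<in> carrier (Cell1 C W X)" "k1 \<in> carrier (Cell1 C W X)" "k2 \<in> carrier (Cell1 C W X)"
    by (auto elim!: hmodule_carrierE)
  show ?thesis unfolding e using ty
    by (simp add: hcomp11[of _ U V _ W] hcomp11[of _ U V _ X] hcomp11[of _ V W _ X]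
        hcomp11[of _ U W _ X] hext_triple comp11_rules[where U=U and V=V and W=W] comp11_rules[where U=V and V=W and W=X] comp11_rules[where U=U and V=V and W=X] comp11_rules[where U=U and V=W and W=X]
        assoc111[of _ U V _ W _ X] M.M.a_ac)
qed

end


section \<open>Inverses\<close>

context extended_category
begin

text \<open>
  As for power series with invertible constant term, the coefficients of the inverse can be solved
  for one degree after the other.
\<close>

lemma hright_inverse:
  assumes x: "x \<in> carrier (Cell1 D X Y)"
    and y0: "y0 \<in> carrier (Cell1 C Y X)" "fst x \<cdot>\<^sub>1\<^sub>1 y0 = \<one>\<^sub>1 Y"
  obtains y where "y \<in> carrier (Cell1 D Y X)" "fst y = y0" "x \<cdot>\<^sub>1\<^sub>1\<^bsub>D\<^esub> y = \<one>\<^sub>1\<^bsub>D\<^esub> Y"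
proof -
  interpret YX: module K "Cell1 C Y X" by (rule module_Cell1)
  interpret YY: module K "Cell1 C Y Y" by (rule module_Cell1)
  note rules = comp11_rules[where U=Y and V=X and W=Y] comp11_rules[where U=Y and V=Y and W=X]
  from x obtain x0 x1 x2 where e: "x = (x0, x1, x2)" and ty: "x0 \<in> carrier (Cell1 C X Y)"
    "x1 \<in> carrier (Cell1 C X Y)" "x2 \<in> carrier (Cell1 C X Y)"
    by (auto elim!: hmodule_carrierE)
  define y1 where "y1 = \<ominus>\<^bsub>Cell1 C Y X\<^esub> (y0 \<cdot>\<^sub>1\<^sub>1 (x1 \<cdot>\<^sub>1\<^sub>1 y0))"
  define y2 where "y2 = \<ominus>\<^bsub>Cell1 C Y X\<^esub> (y0 \<cdot>\<^sub>1\<^sub>1 (x1 \<cdot>\<^sub>1\<^sub>1 y1 \<oplus>\<^bsub>Cell1 C Y Y\<^esub> x2 \<cdot>\<^sub>1\<^sub>1 y0))"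
  have ty': "y1 \<in> carrier (Cell1 C Y X)" "y2 \<in> carrier (Cell1 C Y X)"
    unfolding y1_def y2_def using ty y0 by (simp_all add: rules)
  have cancel: "x0 \<cdot>\<^sub>1\<^sub>1 (y0 \<cdot>\<^sub>1\<^sub>1 z) = z" if "z \<in> carrier (Cell1 C Y Y)" for z
    using that ty y0 ident11[of z Y Y] by (simp add: e flip: assoc111[of z Y Y y0 X x0 Y])
  have c1: "x0 \<cdot>\<^sub>1\<^sub>1 y1 = \<ominus>\<^bsub>Cell1 C Y Y\<^esub> (x1 \<cdot>\<^sub>1\<^sub>1 y0)"
    unfolding y1_def using ty y0 cancel by (simp add: rules)
  have c2: "x0 \<cdot>\<^sub>1\<^sub>1 y2 = \<ominus>\<^bsub>Cell1 C Y Y\<^esub> (x1 \<cdot>\<^sub>1\<^sub>1 y1 \<oplus>\<^bsub>Cell1 C Y Y\<^esub> x2 \<cdot>\<^sub>1\<^sub>1 y0)"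
    unfolding y2_def using ty ty' y0 cancel by (simp add: rules)
  show thesis
  proof (rule that[of "(y0, y1, y2)"])
    show "x \<cdot>\<^sub>1\<^sub>1\<^bsub>D\<^esub> (y0, y1, y2) = \<one>\<^sub>1\<^bsub>D\<^esub> Y"
      using ty ty' y0 by (simp add: e hcomp11[of _ Y X _ Y] hext_triple hident rules c1 c2
        YY.M.l_neg YY.M.a_assoc)
  qed (use y0 ty' in auto)
qed

text \<open>
  A right inverse \<open>y\<close> of \<open>x\<close> has a right inverse itself, which must be \<open>x\<close>. So checking one composite
  is enough to identify \<open>inv1\<close>. The constant coefficient is all that is
  needed of the inverses of the 1-cells between which \<open>HL\<close> and \<open>HR\<close> run, since \<open>HL\<close> and \<open>HR\<close> are multiples of \<open>h\<^sup>2\<close>.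
\<close>

lemma hinv1:
  assumes x: "x \<in> carrier (Cell1 D X Y)" and y0: "y0 \<in> carrier (Cell1 C Y X)"
    and inv: "fst x \<cdot>\<^sub>1\<^sub>1 y0 = \<one>\<^sub>1 Y" "y0 \<cdot>\<^sub>1\<^sub>1 fst x = \<one>\<^sub>1 X"
  shows hinverse_exists: "inverse1 D x (inv1 D x)"
    and hinv1_closed: "inv1 D x \<in> carrier (Cell1 D Y X)"
    and fst_hinv1: "fst (inv1 D x) = y0"
    and hinv1_unique: "\<And>z. \<lbrakk>z \<in> carrier (Cell1 D Y X); x \<cdot>\<^sub>1\<^sub>1\<^bsub>D\<^esub> z = \<one>\<^sub>1\<^bsub>D\<^esub> Y\<rbrakk> \<Longrightarrow> inv1 D x = z"
proof -
  have x0: "fst x \<in> carrier (Cell1 C X Y)"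
    using x by (simp add: fst_closed)
  obtain y where y: "y \<in> carrier (Cell1 D Y X)" "fst y = y0" "x \<cdot>\<^sub>1\<^sub>1\<^bsub>D\<^esub> y = \<one>\<^sub>1\<^bsub>D\<^esub> Y"
    using hright_inverse[OF x y0 inv(1)] .
  obtain w where w: "w \<in> carrier (Cell1 D X Y)" "y \<cdot>\<^sub>1\<^sub>1\<^bsub>D\<^esub> w = \<one>\<^sub>1\<^bsub>D\<^esub> X"
    using hright_inverse[OF y(1) x0 inv(2)[folded y(2)]] by blast
  have "w = x"
    using hassoc111[OF w(1) y(1) x] y(3) w(2) hident11[OF w(1)] hident11[OF x] by simp
  then have yx: "y \<cdot>\<^sub>1\<^sub>1\<^bsub>D\<^esub> x = \<one>\<^sub>1\<^bsub>D\<^esub> X"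
    using w by simp
  have unique: "z = y" if z: "z \<in> carrier (Cell1 D Y X)" "x \<cdot>\<^sub>1\<^sub>1\<^bsub>D\<^esub> z = \<one>\<^sub>1\<^bsub>D\<^esub> Y" for z
    using hassoc111[OF z(1) x y(1)] z(2) yx hident11[OF z(1)] hident11[OF y(1)] by simp
  have dc: "dom1 D x = X" "cod1 D x = Y"
    using dom_cod1[OF x0] by simp_all
  have inverse: "inverse1 D x y"
    unfolding inverse1_def dc using y yx by blast
  have "inv1 D x = y"
    unfolding inv1_def
  proof (rule the_equality)
    show "inverse1 D x y" by (rule inverse)
  next
    show "z = y" if "inverse1 D x z" for z
      using that unfolding inverse1_def dc by (intro unique) auto
  qed
  then show "inverse1 D x (inv1 D x)" "inv1 D x \<in> carrier (Cell1 D Y X)" "fst (inv1 D x) = y0"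
    using inverse y by simp_all
  show "inv1 D x = z" if "z \<in> carrier (Cell1 D Y X)" "x \<cdot>\<^sub>1\<^sub>1\<^bsub>D\<^esub> z = \<one>\<^sub>1\<^bsub>D\<^esub> Y" for z
    using unique[OF that] \<open>inv1 D x = y\<close> by simp
qed

end


section \<open>The deformed braiding\<close>

locale deformation = extended_category K C \<gamma> + totally_symmetric_i2b K C \<gamma> t +
  coherent_i2b K C \<gamma> t + coboundary_syllepsis K C \<gamma> t T
  for K :: "('k, 'y) ring_scheme"
    and C :: "('o, 'k, 'a, 'b) ch_mon_cat" (structure)
    and \<gamma> t :: "('o, 'a, 'b) ptrans"
    and T :: "'o \<Rightarrow> 'o \<Rightarrow> 'b" +
  assumes char_0: "\<And>n :: nat. 0 < n \<Longrightarrow> [n] \<cdot>\<^bsub>K\<^esub> \<one>\<^bsub>K\<^esub> \<noteq> \<zero>\<^bsub>K\<^esub>"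
begin

abbreviation recip :: "nat \<Rightarrow> 'k"
  where "recip n \<equiv> inv\<^bsub>K\<^esub> ([n] \<cdot>\<^bsub>K\<^esub> \<one>\<^bsub>K\<^esub>)"

lemma recip_closed: "0 < n \<Longrightarrow> recip n \<in> carrier K"
  using char_0[of n] by (simp add: field_Units)

lemma recip_1: "recip 1 = \<one>\<^bsub>K\<^esub>"
  by simp

lemma recip_2: "recip 2 \<oplus>\<^bsub>K\<^esub> recip 2 = \<one>\<^bsub>K\<^esub>"
  and recip_8: "recip 8 \<oplus>\<^bsub>K\<^esub> recip 8 = recip 2 \<otimes>\<^bsub>K\<^esub> recip 2"
proof -
  define a where "a = [(2::nat)] \<cdot>\<^bsub>K\<^esub> \<one>\<^bsub>K\<^esub>"
  have a: "a = \<one>\<^bsub>K\<^esub> \<oplus>\<^bsub>K\<^esub> \<one>\<^bsub>K\<^esub>"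
    by (simp add: a_def numeral_2_eq_2)
  have aK: "a \<in> carrier K" "inv\<^bsub>K\<^esub> a \<in> carrier K"
    using recip_closed[of 2] by (simp_all add: a_def)
  have inv_a: "inv\<^bsub>K\<^esub> a \<otimes>\<^bsub>K\<^esub> a = \<one>\<^bsub>K\<^esub>"
    using char_0[of 2] aK by (simp add: a_def field_Units)
  show half: "recip 2 \<oplus>\<^bsub>K\<^esub> recip 2 = \<one>\<^bsub>K\<^esub>"
    using inv_a aK(2) unfolding a_def[symmetric] by (simp add: a r_distr)
  have "[(8::nat)] \<cdot>\<^bsub>K\<^esub> \<one>\<^bsub>K\<^esub> = a \<otimes>\<^bsub>K\<^esub> a \<otimes>\<^bsub>K\<^esub> a"
    by (simp add: a eval_nat_numeral r_distr l_distr a_ac)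
  moreover have "(a \<otimes>\<^bsub>K\<^esub> a \<otimes>\<^bsub>K\<^esub> a) \<otimes>\<^bsub>K\<^esub> (inv\<^bsub>K\<^esub> a \<otimes>\<^bsub>K\<^esub> inv\<^bsub>K\<^esub> a \<otimes>\<^bsub>K\<^esub> inv\<^bsub>K\<^esub> a)
    = (inv\<^bsub>K\<^esub> a \<otimes>\<^bsub>K\<^esub> a) \<otimes>\<^bsub>K\<^esub> (inv\<^bsub>K\<^esub> a \<otimes>\<^bsub>K\<^esub> a) \<otimes>\<^bsub>K\<^esub> (inv\<^bsub>K\<^esub> a \<otimes>\<^bsub>K\<^esub> a)"
    using aK by (simp add: m_ac)
  ultimately have "recip 8 = inv\<^bsub>K\<^esub> a \<otimes>\<^bsub>K\<^esub> inv\<^bsub>K\<^esub> a \<otimes>\<^bsub>K\<^esub> inv\<^bsub>K\<^esub> a"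
    using inv_a aK by (simp add: comm_inv_char)
  then show "recip 8 \<oplus>\<^bsub>K\<^esub> recip 8 = recip 2 \<otimes>\<^bsub>K\<^esub> recip 2"
    using half aK unfolding a_def[symmetric]
    by (simp flip: r_distr)
qed

lemma gamma_closed: "\<gamma>\<langle>U, V\<rangle> \<in> carrier (Cell1 C (U \<otimes>\<^sub>0 V) (V \<otimes>\<^sub>0 U))"
  using \<gamma>.pt_cell_closed[of U V] by (simp add: op_bifun_def)

lemmas t_closed = t.pt_cell_closed

lemma gamma_h_cell: "(gamma_h C \<gamma>)\<langle>U, V\<rangle>
    = (\<gamma>\<langle>U, V\<rangle>, \<zero>\<^bsub>Cell1 C (U \<otimes>\<^sub>0 V) (V \<otimes>\<^sub>0 U)\<^esub>, \<zero>\<^bsub>Cell1 C (U \<otimes>\<^sub>0 V) (V \<otimes>\<^sub>0 U)\<^esub>)"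
  using dom_cod1[OF gamma_closed[of U V]] by (simp add: gamma_h_def hptrans_def hconst1_def)

lemma t_h_cell: "(t_h C t)\<langle>U, V\<rangle>
    = (t\<langle>U, V\<rangle>, \<zero>\<^bsub>Cell1 C (U \<otimes>\<^sub>0 V) (U \<otimes>\<^sub>0 V)\<^esub>, \<zero>\<^bsub>Cell1 C (U \<otimes>\<^sub>0 V) (U \<otimes>\<^sub>0 V)\<^esub>)"
  using dom_cod1[OF t_closed[of U V]] by (simp add: t_h_def hptrans_def hconst1_def)

text \<open>
  The coefficients of \<open>h\<close> and \<open>h\<^sup>2\<close> in \<open>e\<^sup>h\<^sup>t\<^sup>/\<^sup>2\<close>.
\<close>

definition exp1 :: "'o \<Rightarrow> 'o \<Rightarrow> 'a"
  where "exp1 U V = recip 2 \<odot>\<^bsub>Cell1 C (U \<otimes>\<^sub>0 V) (U \<otimes>\<^sub>0 V)\<^esub> t\<langle>U, V\<rangle>"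

definition exp2 :: "'o \<Rightarrow> 'o \<Rightarrow> 'a"
  where "exp2 U V = recip 8 \<odot>\<^bsub>Cell1 C (U \<otimes>\<^sub>0 V) (U \<otimes>\<^sub>0 V)\<^esub> (t\<langle>U, V\<rangle> \<cdot>\<^sub>1\<^sub>1 t\<langle>U, V\<rangle>)"

lemma exp_closed:
  "exp1 U V \<in> carrier (Cell1 C (U \<otimes>\<^sub>0 V) (U \<otimes>\<^sub>0 V))"
  "exp2 U V \<in> carrier (Cell1 C (U \<otimes>\<^sub>0 V) (U \<otimes>\<^sub>0 V))"
proof -
  interpret M: module K "Cell1 C (U \<otimes>\<^sub>0 V) (U \<otimes>\<^sub>0 V)" by (rule module_Cell1)
  show "exp1 U V \<in> carrier (Cell1 C (U \<otimes>\<^sub>0 V) (U \<otimes>\<^sub>0 V))"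
    and "exp2 U V \<in> carrier (Cell1 C (U \<otimes>\<^sub>0 V) (U \<otimes>\<^sub>0 V))"
    unfolding exp1_def exp2_def
    using t_closed comp11_closed[OF t_closed t_closed] recip_closed[of 2] recip_closed[of 8]
    by simp_all
qed

lemma exp_cell: "(exp_t K C t)\<langle>U, V\<rangle> = (\<one>\<^sub>1 (U \<otimes>\<^sub>0 V), exp1 U V, exp2 U V)"
proof -
  interpret M: module K "Cell1 C (U \<otimes>\<^sub>0 V) (U \<otimes>\<^sub>0 V)" by (rule module_Cell1)
  note ty = t_closed[of U V] comp11_closed[OF t_closed t_closed, of U V] ident_closed
    exp_closed[of U V]
  show ?thesis
    using ty recip_closed[of 2] recip_closed[of 8]
    by (simp add: exp_t_def Let_def pt_add_def pt_smult_def pt_comp_def pt_id_def t_h_cell hident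
        hcomp11[of _ "U \<otimes>\<^sub>0 V" "U \<otimes>\<^sub>0 V" _ "U \<otimes>\<^sub>0 V"] hext_triple
        hmodule_smult_h[OF M.module_axioms]
        comp11_rules[where U="U \<otimes>\<^sub>0 V" and V="U \<otimes>\<^sub>0 V" and W="U \<otimes>\<^sub>0 V"] flip: exp1_def exp2_def)
qed

lemma sigma_cell:
  "(sigma K C \<gamma> t)\<langle>U, V\<rangle> = (\<gamma>\<langle>U, V\<rangle>, \<gamma>\<langle>U, V\<rangle> \<cdot>\<^sub>1\<^sub>1 exp1 U V, \<gamma>\<langle>U, V\<rangle> \<cdot>\<^sub>1\<^sub>1 exp2 U V)"
proof -
  interpret M: module K "Cell1 C (U \<otimes>\<^sub>0 V) (V \<otimes>\<^sub>0 U)" by (rule module_Cell1)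
  show ?thesis
    using gamma_closed[of U V] exp_closed[of U V] ident_closed ident11
    by (simp add: sigma_def Let_def pt_comp_def gamma_h_cell exp_cell
        hcomp11[of _ "U \<otimes>\<^sub>0 V" "U \<otimes>\<^sub>0 V" _ "V \<otimes>\<^sub>0 U"] hext_triple
        comp11_rules[where U="U \<otimes>\<^sub>0 V" and V="U \<otimes>\<^sub>0 V" and W="V \<otimes>\<^sub>0 U"])
qed

text \<open>
  Since \<open>\<gamma>\<close> intertwines \<open>t\<langle>U, V\<rangle>\<close> and \<open>t\<langle>V, U\<rangle>\<close>, it can be moved past the exponential.
\<close>

lemma gamma_exp:
  "\<gamma>\<langle>U, V\<rangle> \<cdot>\<^sub>1\<^sub>1 exp1 U V = exp1 V U \<cdot>\<^sub>1\<^sub>1 \<gamma>\<langle>U, V\<rangle>"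
  "\<gamma>\<langle>U, V\<rangle> \<cdot>\<^sub>1\<^sub>1 exp2 U V = exp2 V U \<cdot>\<^sub>1\<^sub>1 \<gamma>\<langle>U, V\<rangle>"
proof -
  note ty = t_closed[of U V] t_closed[of V U] comp11_closed[OF t_closed t_closed, of U V]
    comp11_closed[OF t_closed t_closed, of V U] gamma_closed[of U V]
  note rules = comp11_rules[where U="U \<otimes>\<^sub>0 V" and V="U \<otimes>\<^sub>0 V" and W="V \<otimes>\<^sub>0 U"]
    comp11_rules[where U="U \<otimes>\<^sub>0 V" and V="V \<otimes>\<^sub>0 U" and W="V \<otimes>\<^sub>0 U"]
  show "\<gamma>\<langle>U, V\<rangle> \<cdot>\<^sub>1\<^sub>1 exp1 U V = exp1 V U \<cdot>\<^sub>1\<^sub>1 \<gamma>\<langle>U, V\<rangle>"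
    using ty recip_closed[of 2] by (simp add: exp1_def rules symmetric)
  have "\<gamma>\<langle>U, V\<rangle> \<cdot>\<^sub>1\<^sub>1 (t\<langle>U, V\<rangle> \<cdot>\<^sub>1\<^sub>1 t\<langle>U, V\<rangle>) = t\<langle>V, U\<rangle> \<cdot>\<^sub>1\<^sub>1 t\<langle>V, U\<rangle> \<cdot>\<^sub>1\<^sub>1 \<gamma>\<langle>U, V\<rangle>"
    using symmetric[of U V] assoc111[OF ty(1) ty(1) ty(5)] assoc111[OF ty(1) ty(5) ty(2)]
      assoc111[OF ty(5) ty(2) ty(2)] by simp
  then show "\<gamma>\<langle>U, V\<rangle> \<cdot>\<^sub>1\<^sub>1 exp2 U V = exp2 V U \<cdot>\<^sub>1\<^sub>1 \<gamma>\<langle>U, V\<rangle>"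
    using ty recip_closed[of 8] by (simp add: exp2_def rules)
qed

text \<open>
  This makes the coefficient of \<open>h\<^sup>2\<close> in \<open>e\<^sup>h\<^sup>t\<^sup>/\<^sup>2\<close> times \<open>e\<^sup>-\<^sup>h\<^sup>t\<^sup>/\<^sup>2\<close> vanish.
\<close>

lemma exp1_squared:
  "exp1 U V \<cdot>\<^sub>1\<^sub>1 exp1 U V = exp2 U V \<oplus>\<^bsub>Cell1 C (U \<otimes>\<^sub>0 V) (U \<otimes>\<^sub>0 V)\<^esub> exp2 U V"
proof -
  interpret M: module K "Cell1 C (U \<otimes>\<^sub>0 V) (U \<otimes>\<^sub>0 V)" by (rule module_Cell1)
  show ?thesis
    using t_closed[of U V] recip_closed[of 2] recip_closed[of 8]
      comp11_closed[OF t_closed t_closed, of U V]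
    by (simp add: exp1_def exp2_def comp11_rules[where U="U \<otimes>\<^sub>0 V" and V="U \<otimes>\<^sub>0 V" and W="U \<otimes>\<^sub>0 V"]
        recip_8 flip: M.smult_assoc1 M.smult_l_distr)
qed

abbreviation sigma_inv :: "('o, 'a \<times> 'a \<times> 'a, 'b \<times> 'b \<times> 'b) ptrans"
  where "sigma_inv \<equiv> pt_inv D (tensor D) (op_bifun (tensor D)) (sigma K C \<gamma> t)"

lemma sigma_closed: "(sigma K C \<gamma> t)\<langle>U, V\<rangle> \<in> carrier (Cell1 D (U \<otimes>\<^sub>0 V) (V \<otimes>\<^sub>0 U))"
  using comp11_closed[OF gamma_closed] exp_closed gamma_closed by (simp add: sigma_cell)

lemma sigma_inverse_pair:
  "fst ((sigma K C \<gamma> t)\<langle>U, V\<rangle>) \<cdot>\<^sub>1\<^sub>1 \<gamma>\<langle>V, U\<rangle> = \<one>\<^sub>1 (V \<otimes>\<^sub>0 U)"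
  "\<gamma>\<langle>V, U\<rangle> \<cdot>\<^sub>1\<^sub>1 fst ((sigma K C \<gamma> t)\<langle>U, V\<rangle>) = \<one>\<^sub>1 (U \<otimes>\<^sub>0 V)"
  by (simp_all add: sigma_cell braid_involutive)

text \<open>
  \<open>\<sigma>\<inverse>\<^sub>V\<^sub>U = \<gamma>\<^sub>U\<^sub>V e\<^sup>-\<^sup>h\<^sup>t\<^sup>/\<^sup>2\<close>: in the product with \<open>\<sigma>\<^sub>V\<^sub>U = e\<^sup>h\<^sup>t\<^sup>/\<^sup>2 \<gamma>\<^sub>V\<^sub>U\<close> the two braidings meet and cancel.
\<close>

lemma sigma_inv_cell:
  "sigma_inv\<langle>V, U\<rangle> = (\<gamma>\<langle>U, V\<rangle>,
     \<ominus>\<^bsub>Cell1 C (U \<otimes>\<^sub>0 V) (V \<otimes>\<^sub>0 U)\<^esub> (\<gamma>\<langle>U, V\<rangle> \<cdot>\<^sub>1\<^sub>1 exp1 U V), \<gamma>\<langle>U, V\<rangle> \<cdot>\<^sub>1\<^sub>1 exp2 U V)"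
proof -
  let ?X = "U \<otimes>\<^sub>0 V" and ?Y = "V \<otimes>\<^sub>0 U"
  interpret XX: module K "Cell1 C ?X ?X" by (rule module_Cell1)
  interpret XY: module K "Cell1 C ?X ?Y" by (rule module_Cell1)
  note ty = gamma_closed[of U V] gamma_closed[of V U] exp_closed[of U V]
    comp11_closed[OF gamma_closed exp_closed(1), of U V]
    comp11_closed[OF gamma_closed exp_closed(2), of U V]
    comp11_closed[OF exp_closed(1) exp_closed(1), of U V]
  note rules = comp11_rules[where U="?X" and V="?Y" and W="?X"]
  have gg: "\<gamma>\<langle>V, U\<rangle> \<cdot>\<^sub>1\<^sub>1 (\<gamma>\<langle>U, V\<rangle> \<cdot>\<^sub>1\<^sub>1 e) = e" if "e \<in> carrier (Cell1 C ?X ?X)" for e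
    using that ident11[OF that] assoc111[OF that ty(1) ty(2)] by (simp add: braid_involutive)
  have move: "\<gamma>\<langle>V, U\<rangle> \<cdot>\<^sub>1\<^sub>1 exp1 V U = exp1 U V \<cdot>\<^sub>1\<^sub>1 \<gamma>\<langle>V, U\<rangle>"
    "\<gamma>\<langle>V, U\<rangle> \<cdot>\<^sub>1\<^sub>1 exp2 V U = exp2 U V \<cdot>\<^sub>1\<^sub>1 \<gamma>\<langle>V, U\<rangle>"
    by (rule gamma_exp)+
  have move': "e \<cdot>\<^sub>1\<^sub>1 \<gamma>\<langle>V, U\<rangle> \<cdot>\<^sub>1\<^sub>1 \<gamma>\<langle>U, V\<rangle> = e"
    "e \<cdot>\<^sub>1\<^sub>1 \<gamma>\<langle>V, U\<rangle> \<cdot>\<^sub>1\<^sub>1 (\<gamma>\<langle>U, V\<rangle> \<cdot>\<^sub>1\<^sub>1 e') = e \<cdot>\<^sub>1\<^sub>1 e'"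
    "e \<cdot>\<^sub>1\<^sub>1 \<gamma>\<langle>V, U\<rangle> \<in> carrier (Cell1 C ?Y ?X)"
    if "e \<in> carrier (Cell1 C ?X ?X)" "e' \<in> carrier (Cell1 C ?X ?X)" for e e'
    using that ident11 ty comp11_closed[OF ty(1) that(2)] comp11_closed[OF that(1) ty(2)]
    by (simp_all add: assoc111[of _ ?X ?Y _ ?X _ ?X] gg braid_involutive)
  have cancel: "e \<ominus>\<^bsub>Cell1 C ?X ?X\<^esub> (e \<oplus>\<^bsub>Cell1 C ?X ?X\<^esub> e) \<oplus>\<^bsub>Cell1 C ?X ?X\<^esub> e = \<zero>\<^bsub>Cell1 C ?X ?X\<^esub>"
    if "e \<in> carrier (Cell1 C ?X ?X)" for e
    using that by (simp add: a_minus_def XX.M.minus_add XX.M.a_ac XX.M.r_neg XX.M.r_neg1 XX.M.r_neg2)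
  have "(sigma K C \<gamma> t)\<langle>V, U\<rangle> \<cdot>\<^sub>1\<^sub>1\<^bsub>D\<^esub> (\<gamma>\<langle>U, V\<rangle>,
     \<ominus>\<^bsub>Cell1 C ?X ?Y\<^esub> (\<gamma>\<langle>U, V\<rangle> \<cdot>\<^sub>1\<^sub>1 exp1 U V), \<gamma>\<langle>U, V\<rangle> \<cdot>\<^sub>1\<^sub>1 exp2 U V) = \<one>\<^sub>1\<^bsub>D\<^esub> ?X"
    using ty cancel[OF ty(4)]
    by (simp add: sigma_cell move hcomp11[of _ ?X ?Y _ ?X] hext_triple rules move' gg hident
        braid_involutive XX.M.l_neg exp1_squared a_minus_def)
  then show ?thesis
    using hinv1_unique[OF sigma_closed[of V U] gamma_closed sigma_inverse_pair] ty
    by (simp add: pt_inv_def)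
qed

end


section \<open>The syllepsis: boundary, symmetry and naturality\<close>

context deformation
begin

abbreviation Sig :: "'o \<Rightarrow> 'o \<Rightarrow> 'b \<times> 'b \<times> 'b"
  where "Sig U V \<equiv> h_over K 1 \<odot>\<^bsub>Cell2 D (U \<otimes>\<^sub>0 V) (V \<otimes>\<^sub>0 U)\<^esub>
    ((gamma_h C \<gamma>)\<langle>U, V\<rangle> \<cdot>\<^sub>1\<^sub>2\<^bsub>D\<^esub> hconst2 C (T U V))"

lemma gamma_T_closed: "\<gamma>\<langle>U, V\<rangle> \<cdot>\<^sub>1\<^sub>2 T U V \<in> carrier (Cell2 C (U \<otimes>\<^sub>0 V) (V \<otimes>\<^sub>0 U))"
  by (rule comp12_closed[OF gamma_closed T_closed])

lemma Sig_cell: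
  "Sig U V = (\<zero>\<^bsub>Cell2 C (U \<otimes>\<^sub>0 V) (V \<otimes>\<^sub>0 U)\<^esub>, \<gamma>\<langle>U, V\<rangle> \<cdot>\<^sub>1\<^sub>2 T U V,
     \<zero>\<^bsub>Cell2 C (U \<otimes>\<^sub>0 V) (V \<otimes>\<^sub>0 U)\<^esub>)"
proof -
  interpret M: module K "Cell2 C (U \<otimes>\<^sub>0 V) (V \<otimes>\<^sub>0 U)" by (rule module_Cell2)
  note rules = comp12_rules[where U="U \<otimes>\<^sub>0 V" and V="U \<otimes>\<^sub>0 V" and W="V \<otimes>\<^sub>0 U"]
  have "(gamma_h C \<gamma>)\<langle>U, V\<rangle> \<cdot>\<^sub>1\<^sub>2\<^bsub>D\<^esub> hconst2 C (T U V)
      = (\<gamma>\<langle>U, V\<rangle> \<cdot>\<^sub>1\<^sub>2 T U V, \<zero>\<^bsub>Cell2 C (U \<otimes>\<^sub>0 V) (V \<otimes>\<^sub>0 U)\<^esub>, \<zero>\<^bsub>Cell2 C (U \<otimes>\<^sub>0 V) (V \<otimes>\<^sub>0 U)\<^esub>)"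
    using gamma_closed[of U V] T_closed[of U V] dom_cod2[OF T_closed[of U V]]
    by (simp add: hconst2_def gamma_h_cell hcomp12[of _ "U \<otimes>\<^sub>0 V" "U \<otimes>\<^sub>0 V" _ "V \<otimes>\<^sub>0 U"]
        hext_triple rules)
  then show ?thesis
    using gamma_T_closed[of U V] recip_closed[of 1] recip_1
    by (simp add: hmodule_smult_h[OF M.module_axioms] del: One_nat_def)
qed

lemma exp1_double:
  "exp1 U V \<oplus>\<^bsub>Cell1 C (U \<otimes>\<^sub>0 V) (U \<otimes>\<^sub>0 V)\<^esub> exp1 U V = t\<langle>U, V\<rangle>"
proof -
  interpret M: module K "Cell1 C (U \<otimes>\<^sub>0 V) (U \<otimes>\<^sub>0 V)" by (rule module_Cell1)
  show ?thesis
    using t_closed[of U V] recip_closed[of 2]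
    by (simp add: exp1_def recip_2 flip: M.smult_l_distr)
qed

lemma bdry_Sig:
  "\<partial>\<^bsub>D\<^esub> (Sig U V) = (sigma K C \<gamma> t)\<langle>U, V\<rangle> \<ominus>\<^bsub>Cell1 D (U \<otimes>\<^sub>0 V) (V \<otimes>\<^sub>0 U)\<^esub> sigma_inv\<langle>V, U\<rangle>"
proof -
  let ?X = "U \<otimes>\<^sub>0 V" and ?Y = "V \<otimes>\<^sub>0 U"
  interpret XY: module K "Cell1 C ?X ?Y" by (rule module_Cell1)
  note ty = gamma_closed[of U V] exp_closed[of U V]
    comp11_closed[OF gamma_closed exp_closed(1), of U V]
    comp11_closed[OF gamma_closed exp_closed(2), of U V]
  have "\<gamma>\<langle>U, V\<rangle> \<cdot>\<^sub>1\<^sub>1 exp1 U V \<oplus>\<^bsub>Cell1 C ?X ?Y\<^esub> \<gamma>\<langle>U, V\<rangle> \<cdot>\<^sub>1\<^sub>1 exp1 U V = \<gamma>\<langle>U, V\<rangle> \<cdot>\<^sub>1\<^sub>1 t\<langle>U, V\<rangle>"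
    using ty by (simp add: exp1_double flip: comp11_rules(3)[where U="?X" and V="?X" and W="?Y"])
  then show ?thesis
    unfolding Sig_cell sigma_cell sigma_inv_cell
    using ty bdry_comp12[OF T_closed gamma_closed, of U V]
    by (simp add: hmap_def bdry_zero bdry_T hmodule_neg[OF group_Cell1] a_minus_def
        XY.M.r_neg XY.M.minus_minus)
qed

text \<open>
  Any two endo-2-cells satisfy \<open>(\<partial>\<phi>) \<phi>' = \<phi> (\<partial>\<phi>')\<close>; for \<open>\<phi> = \<phi>' = T\<close> this says that \<open>T\<close> commutes with
  its boundary \<open>t\<close>.
\<close>

lemma exp1_T: "exp1 U V \<cdot>\<^sub>1\<^sub>2 T U V = T U V \<cdot>\<^sub>2\<^sub>1 exp1 U V"
proof -
  let ?X = "U \<otimes>\<^sub>0 V"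
  have "t\<langle>U, V\<rangle> \<cdot>\<^sub>1\<^sub>2 T U V = T U V \<cdot>\<^sub>2\<^sub>1 t\<langle>U, V\<rangle>"
    using bdry_truncated[OF T_closed T_closed, of U V] by (simp add: bdry_T)
  then show ?thesis
    using t_closed[of U V] T_closed[of U V] recip_closed[of 2]
    by (simp add: exp1_def comp12_rules[where U="?X" and V="?X" and W="?X"]
        comp21_rules[where U="?X" and V="?X" and W="?X"])
qed

lemma Sig_symmetric:
  "Sig U V = sigma_inv\<langle>V, U\<rangle> \<cdot>\<^sub>1\<^sub>2\<^bsub>D\<^esub> Sig V U \<cdot>\<^sub>2\<^sub>1\<^bsub>D\<^esub> (sigma K C \<gamma> t)\<langle>U, V\<rangle>"
proof -
  let ?X = "U \<otimes>\<^sub>0 V" and ?Y = "V \<otimes>\<^sub>0 U"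
  let ?g = "\<gamma>\<langle>U, V\<rangle>" and ?g' = "\<gamma>\<langle>V, U\<rangle>" and ?e = "exp1 U V"
  let ?S = "?g' \<cdot>\<^sub>1\<^sub>2 T V U"
  interpret XY: module K "Cell2 C ?X ?Y" by (rule module_Cell2)
  interpret YY: module K "Cell2 C ?Y ?Y" by (rule module_Cell2)
  note ty = gamma_closed[of U V] gamma_closed[of V U] exp_closed[of U V]
    comp11_closed[OF gamma_closed exp_closed(1), of U V]
    comp11_closed[OF gamma_closed exp_closed(2), of U V] T_closed[of U V] gamma_T_closed[of V U]
    gamma_T_closed[of U V]
  note rules = comp12_rules[where U="?Y" and V="?X" and W="?Y"] comp21_rules[where U="?X" and V="?Y" and W="?Y"]
  have S: "?S \<cdot>\<^sub>2\<^sub>1 ?g = T U V"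
    using T_symmetric[of U V] by simp
  have order1: "?g \<cdot>\<^sub>1\<^sub>2 ?S \<cdot>\<^sub>2\<^sub>1 ?g = ?g \<cdot>\<^sub>1\<^sub>2 T U V"
    using ty by (simp add: assoc121[of _ ?X ?Y _ ?X _ ?Y] S)
  have "?g \<cdot>\<^sub>1\<^sub>2 ?S \<cdot>\<^sub>2\<^sub>1 (?g \<cdot>\<^sub>1\<^sub>1 ?e) = ?g \<cdot>\<^sub>1\<^sub>2 (T U V \<cdot>\<^sub>2\<^sub>1 ?e)"
    using ty by (simp add: assoc121[of _ ?X ?Y _ ?X _ ?Y] S flip: assoc211[of _ ?X ?X _ ?Y _ ?X])
  also have "\<dots> = (?g \<cdot>\<^sub>1\<^sub>1 ?e) \<cdot>\<^sub>1\<^sub>2 ?S \<cdot>\<^sub>2\<^sub>1 ?g"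
    using ty by (simp add: assoc121[of _ ?X ?Y _ ?X _ ?Y] S assoc112[of _ ?X ?X _ ?X _ ?Y] exp1_T)
  finally have order2: "?g \<cdot>\<^sub>1\<^sub>2 ?S \<cdot>\<^sub>2\<^sub>1 (?g \<cdot>\<^sub>1\<^sub>1 ?e) = (?g \<cdot>\<^sub>1\<^sub>1 ?e) \<cdot>\<^sub>1\<^sub>2 ?S \<cdot>\<^sub>2\<^sub>1 ?g" .
  show ?thesis
    unfolding Sig_cell sigma_cell sigma_inv_cell
    using ty comp12_closed[OF ty(1) ty(8)] comp12_closed[OF ty(5) ty(8)] order1 order2
      comp21_closed[OF comp12_closed[OF ty(5) ty(8)] ty(1)]
    by (simp add: hcomp12[of _ ?Y ?X _ ?Y] hcomp21[of _ ?X ?Y _ ?Y] hext_triple rules XY.M.r_neg)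
qed

text \<open>
  The coefficients of \<open>h\<close> and \<open>h\<^sup>2\<close> in the homotopy component of \<open>e\<^sup>h\<^sup>t\<^sup>/\<^sup>2\<close>, as functions of the
  coefficients \<open>\<theta>0\<close>, \<open>\<theta>1\<close> of \<open>1\<close>, \<open>h\<close> in \<open>t\<langle>f \<boxtimes> g\<rangle>\<close>. The term with \<open>1/8\<close> is the homotopy component of the square of \<open>t\<close>.
\<close>

definition htpy1 :: "'o \<Rightarrow> 'o \<Rightarrow> 'o \<Rightarrow> 'o \<Rightarrow> 'b \<Rightarrow> 'b"
  where "htpy1 U V U' V' \<theta>0 = recip 2 \<odot>\<^bsub>Cell2 C (U \<otimes>\<^sub>0 V) (U' \<otimes>\<^sub>0 V')\<^esub> \<theta>0"

definition htpy2 :: "'o \<Rightarrow> 'o \<Rightarrow> 'o \<Rightarrow> 'o \<Rightarrow> 'b \<Rightarrow> 'b \<Rightarrow> 'b"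
  where "htpy2 U V U' V' \<theta>0 \<theta>1 =
    recip 2 \<odot>\<^bsub>Cell2 C (U \<otimes>\<^sub>0 V) (U' \<otimes>\<^sub>0 V')\<^esub> \<theta>1 \<oplus>\<^bsub>Cell2 C (U \<otimes>\<^sub>0 V) (U' \<otimes>\<^sub>0 V')\<^esub>
    recip 8 \<odot>\<^bsub>Cell2 C (U \<otimes>\<^sub>0 V) (U' \<otimes>\<^sub>0 V')\<^esub>
      (\<theta>0 \<cdot>\<^sub>2\<^sub>1 t\<langle>U, V\<rangle> \<oplus>\<^bsub>Cell2 C (U \<otimes>\<^sub>0 V) (U' \<otimes>\<^sub>0 V')\<^esub> t\<langle>U', V'\<rangle> \<cdot>\<^sub>1\<^sub>2 \<theta>0)"

lemma htpy_closed:
  assumes "\<theta>0 \<in> carrier (Cell2 C (U \<otimes>\<^sub>0 V) (U' \<otimes>\<^sub>0 V'))" "\<theta>1 \<in> carrier (Cell2 C (U \<otimes>\<^sub>0 V) (U' \<otimes>\<^sub>0 V'))"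
  shows "htpy1 U V U' V' \<theta>0 \<in> carrier (Cell2 C (U \<otimes>\<^sub>0 V) (U' \<otimes>\<^sub>0 V'))"
    and "htpy2 U V U' V' \<theta>0 \<theta>1 \<in> carrier (Cell2 C (U \<otimes>\<^sub>0 V) (U' \<otimes>\<^sub>0 V'))"
proof -
  interpret M: module K "Cell2 C (U \<otimes>\<^sub>0 V) (U' \<otimes>\<^sub>0 V')" by (rule module_Cell2)
  show "htpy1 U V U' V' \<theta>0 \<in> carrier (Cell2 C (U \<otimes>\<^sub>0 V) (U' \<otimes>\<^sub>0 V'))"
    and "htpy2 U V U' V' \<theta>0 \<theta>1 \<in> carrier (Cell2 C (U \<otimes>\<^sub>0 V) (U' \<otimes>\<^sub>0 V'))"
    unfolding htpy1_def htpy2_def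
    using assms recip_closed[of 2] recip_closed[of 8] comp21_closed[OF assms(1) t_closed]
      comp12_closed[OF t_closed assms(1)]
    by simp_all
qed

text \<open>
  The homotopy component of \<open>e\<^sup>-\<^sup>h\<^sup>t\<^sup>/\<^sup>2\<close> has the coefficients \<open>-htpy1\<close> and
  \<open>-htpy2 + htpy1 exp1 + exp1 htpy1\<close>. The equations say that the difference of the two homotopy components is
  \<open>h t\<langle>f \<boxtimes> g\<rangle>\<close>.
\<close>

lemma htpy_double:
  assumes "\<theta>0 \<in> carrier (Cell2 C (U \<otimes>\<^sub>0 V) (U' \<otimes>\<^sub>0 V'))" "\<theta>1 \<in> carrier (Cell2 C (U \<otimes>\<^sub>0 V) (U' \<otimes>\<^sub>0 V'))"
  shows "htpy1 U V U' V' \<theta>0 \<oplus>\<^bsub>Cell2 C (U \<otimes>\<^sub>0 V) (U' \<otimes>\<^sub>0 V')\<^esub> htpy1 U V U' V' \<theta>0 = \<theta>0"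
    and "htpy2 U V U' V' \<theta>0 \<theta>1 \<oplus>\<^bsub>Cell2 C (U \<otimes>\<^sub>0 V) (U' \<otimes>\<^sub>0 V')\<^esub> htpy2 U V U' V' \<theta>0 \<theta>1
      = \<theta>1 \<oplus>\<^bsub>Cell2 C (U \<otimes>\<^sub>0 V) (U' \<otimes>\<^sub>0 V')\<^esub>
        (htpy1 U V U' V' \<theta>0 \<cdot>\<^sub>2\<^sub>1 exp1 U V
          \<oplus>\<^bsub>Cell2 C (U \<otimes>\<^sub>0 V) (U' \<otimes>\<^sub>0 V')\<^esub> exp1 U' V' \<cdot>\<^sub>1\<^sub>2 htpy1 U V U' V' \<theta>0)"
proof -
  let ?X = "U \<otimes>\<^sub>0 V" and ?X' = "U' \<otimes>\<^sub>0 V'"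
  interpret M: module K "Cell2 C ?X ?X'" by (rule module_Cell2)
  have half: "recip 2 \<odot>\<^bsub>Cell2 C ?X ?X'\<^esub> x \<oplus>\<^bsub>Cell2 C ?X ?X'\<^esub> recip 2 \<odot>\<^bsub>Cell2 C ?X ?X'\<^esub> x = x"
    if "x \<in> carrier (Cell2 C ?X ?X')" for x
    using that recip_closed[of 2] by (simp add: recip_2 flip: M.smult_l_distr)
  have quarter: "recip 8 \<odot>\<^bsub>Cell2 C ?X ?X'\<^esub> x \<oplus>\<^bsub>Cell2 C ?X ?X'\<^esub> recip 8 \<odot>\<^bsub>Cell2 C ?X ?X'\<^esub> x
      = recip 2 \<odot>\<^bsub>Cell2 C ?X ?X'\<^esub> (recip 2 \<odot>\<^bsub>Cell2 C ?X ?X'\<^esub> x)"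
    if "x \<in> carrier (Cell2 C ?X ?X')" for x
    using that recip_closed[of 2] recip_closed[of 8]
    by (simp add: recip_8 flip: M.smult_l_distr M.smult_assoc1)
  have shuffle: "(a \<oplus>\<^bsub>Cell2 C ?X ?X'\<^esub> b) \<oplus>\<^bsub>Cell2 C ?X ?X'\<^esub> (a \<oplus>\<^bsub>Cell2 C ?X ?X'\<^esub> b)
    = (a \<oplus>\<^bsub>Cell2 C ?X ?X'\<^esub> a) \<oplus>\<^bsub>Cell2 C ?X ?X'\<^esub> (b \<oplus>\<^bsub>Cell2 C ?X ?X'\<^esub> b)"
    if "a \<in> carrier (Cell2 C ?X ?X')" "b \<in> carrier (Cell2 C ?X ?X')" for a b
    using that by (simp add: M.M.a_ac)
  show "htpy1 U V U' V' \<theta>0 \<oplus>\<^bsub>Cell2 C ?X ?X'\<^esub> htpy1 U V U' V' \<theta>0 = \<theta>0"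
    unfolding htpy1_def using assms half by simp
  let ?s = "\<theta>0 \<cdot>\<^sub>2\<^sub>1 t\<langle>U, V\<rangle> \<oplus>\<^bsub>Cell2 C ?X ?X'\<^esub> t\<langle>U', V'\<rangle> \<cdot>\<^sub>1\<^sub>2 \<theta>0"
  have s: "?s \<in> carrier (Cell2 C ?X ?X')"
    using comp21_closed[OF assms(1) t_closed] comp12_closed[OF t_closed assms(1)] by simp
  have "htpy2 U V U' V' \<theta>0 \<theta>1 \<oplus>\<^bsub>Cell2 C ?X ?X'\<^esub> htpy2 U V U' V' \<theta>0 \<theta>1
      = \<theta>1 \<oplus>\<^bsub>Cell2 C ?X ?X'\<^esub> recip 2 \<odot>\<^bsub>Cell2 C ?X ?X'\<^esub> (recip 2 \<odot>\<^bsub>Cell2 C ?X ?X'\<^esub> ?s)"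
    unfolding htpy2_def
    by (subst shuffle)
      (use assms s recip_closed[of 2] recip_closed[of 8] half[OF assms(2)] quarter[OF s] in simp_all)
  also have "recip 2 \<odot>\<^bsub>Cell2 C ?X ?X'\<^esub> (recip 2 \<odot>\<^bsub>Cell2 C ?X ?X'\<^esub> ?s)
      = htpy1 U V U' V' \<theta>0 \<cdot>\<^sub>2\<^sub>1 exp1 U V
          \<oplus>\<^bsub>Cell2 C ?X ?X'\<^esub> exp1 U' V' \<cdot>\<^sub>1\<^sub>2 htpy1 U V U' V' \<theta>0"
    unfolding htpy1_def exp1_def
    using assms recip_closed[of 2] comp21_closed[OF assms(1) t_closed]
      comp12_closed[OF t_closed assms(1)] t_closed[of U V] t_closed[of U' V']
    by (simp add: M.smult_r_distr
        comp12_rules[where U="?X" and V="?X'" and W="?X'"] comp21_rules[where U="?X" and V="?X" and W="?X'"])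
  finally show "htpy2 U V U' V' \<theta>0 \<theta>1 \<oplus>\<^bsub>Cell2 C ?X ?X'\<^esub> htpy2 U V U' V' \<theta>0 \<theta>1
      = \<theta>1 \<oplus>\<^bsub>Cell2 C ?X ?X'\<^esub> (htpy1 U V U' V' \<theta>0 \<cdot>\<^sub>2\<^sub>1 exp1 U V
          \<oplus>\<^bsub>Cell2 C ?X ?X'\<^esub> exp1 U' V' \<cdot>\<^sub>1\<^sub>2 htpy1 U V U' V' \<theta>0)" .
qed

text \<open>
  In \<open>\<sigma>\<inverse>\<close> at \<open>g \<boxtimes> f\<close> the homotopy component of \<open>\<sigma>\<close> is conjugated; this moves the braiding to its other side, where it
  cancels against the braiding in \<open>\<sigma>\<inverse>\<close>.
\<close>

lemma gamma_htpy:
  assumes \<theta>: "\<theta>0 \<in> carrier (Cell2 C (U \<otimes>\<^sub>0 V) (U' \<otimes>\<^sub>0 V'))" "\<theta>1 \<in> carrier (Cell2 C (U \<otimes>\<^sub>0 V) (U' \<otimes>\<^sub>0 V'))"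
    and \<theta>': "\<theta>0' \<in> carrier (Cell2 C (V \<otimes>\<^sub>0 U) (V' \<otimes>\<^sub>0 U'))" "\<theta>1' \<in> carrier (Cell2 C (V \<otimes>\<^sub>0 U) (V' \<otimes>\<^sub>0 U'))"
    and swap: "\<gamma>\<langle>V', U'\<rangle> \<cdot>\<^sub>1\<^sub>2 \<theta>0' = \<theta>0 \<cdot>\<^sub>2\<^sub>1 \<gamma>\<langle>V, U\<rangle>" "\<gamma>\<langle>V', U'\<rangle> \<cdot>\<^sub>1\<^sub>2 \<theta>1' = \<theta>1 \<cdot>\<^sub>2\<^sub>1 \<gamma>\<langle>V, U\<rangle>"
  shows "\<gamma>\<langle>V', U'\<rangle> \<cdot>\<^sub>1\<^sub>2 htpy1 V U V' U' \<theta>0' = htpy1 U V U' V' \<theta>0 \<cdot>\<^sub>2\<^sub>1 \<gamma>\<langle>V, U\<rangle>"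
    and "\<gamma>\<langle>V', U'\<rangle> \<cdot>\<^sub>1\<^sub>2 htpy2 V U V' U' \<theta>0' \<theta>1' = htpy2 U V U' V' \<theta>0 \<theta>1 \<cdot>\<^sub>2\<^sub>1 \<gamma>\<langle>V, U\<rangle>"
proof -
  let ?X = "U \<otimes>\<^sub>0 V" and ?X' = "U' \<otimes>\<^sub>0 V'" and ?Y = "V \<otimes>\<^sub>0 U" and ?Y' = "V' \<otimes>\<^sub>0 U'"
  interpret XX: module K "Cell2 C ?X ?X'" by (rule module_Cell2)
  interpret YY: module K "Cell2 C ?Y ?Y'" by (rule module_Cell2)
  note ty = gamma_closed[of V U] gamma_closed[of V' U'] t_closed[of U V] t_closed[of U' V']
    t_closed[of V U] t_closed[of V' U'] recip_closed[of 2] recip_closed[of 8] \<theta> \<theta>'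
  note cl = comp21_closed[OF \<theta>(1) t_closed] comp12_closed[OF t_closed \<theta>(1)]
    comp21_closed[OF \<theta>'(1) t_closed] comp12_closed[OF t_closed \<theta>'(1)]
  note rules = comp12_rules[where U="?Y" and V="?Y'" and W="?X'"] comp21_rules[where U="?Y" and V="?X" and W="?X'"]
  show "\<gamma>\<langle>V', U'\<rangle> \<cdot>\<^sub>1\<^sub>2 htpy1 V U V' U' \<theta>0' = htpy1 U V U' V' \<theta>0 \<cdot>\<^sub>2\<^sub>1 \<gamma>\<langle>V, U\<rangle>"
    using ty by (simp add: htpy1_def rules swap)
  have "\<gamma>\<langle>V', U'\<rangle> \<cdot>\<^sub>1\<^sub>2 (\<theta>0' \<cdot>\<^sub>2\<^sub>1 t\<langle>V, U\<rangle>) = \<gamma>\<langle>V', U'\<rangle> \<cdot>\<^sub>1\<^sub>2 \<theta>0' \<cdot>\<^sub>2\<^sub>1 t\<langle>V, U\<rangle>"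
    using ty by (simp add: assoc121[of _ ?Y ?Y _ ?Y' _ ?X'])
  also have "\<dots> = \<theta>0 \<cdot>\<^sub>2\<^sub>1 (\<gamma>\<langle>V, U\<rangle> \<cdot>\<^sub>1\<^sub>1 t\<langle>V, U\<rangle>)"
    using ty by (simp add: swap assoc211[of _ ?Y ?Y _ ?X _ ?X'])
  also have "\<dots> = \<theta>0 \<cdot>\<^sub>2\<^sub>1 t\<langle>U, V\<rangle> \<cdot>\<^sub>2\<^sub>1 \<gamma>\<langle>V, U\<rangle>"
    using ty by (simp add: symmetric[of V U] assoc211[of _ ?Y ?X _ ?X _ ?X'])
  finally have left: "\<gamma>\<langle>V', U'\<rangle> \<cdot>\<^sub>1\<^sub>2 (\<theta>0' \<cdot>\<^sub>2\<^sub>1 t\<langle>V, U\<rangle>) = \<theta>0 \<cdot>\<^sub>2\<^sub>1 t\<langle>U, V\<rangle> \<cdot>\<^sub>2\<^sub>1 \<gamma>\<langle>V, U\<rangle>" .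
  have "\<gamma>\<langle>V', U'\<rangle> \<cdot>\<^sub>1\<^sub>2 (t\<langle>V', U'\<rangle> \<cdot>\<^sub>1\<^sub>2 \<theta>0') = t\<langle>U', V'\<rangle> \<cdot>\<^sub>1\<^sub>1 \<gamma>\<langle>V', U'\<rangle> \<cdot>\<^sub>1\<^sub>2 \<theta>0'"
    using ty by (simp add: symmetric[of V' U', symmetric] assoc112[of _ ?Y ?Y' _ ?Y' _ ?X'])
  also have "\<dots> = t\<langle>U', V'\<rangle> \<cdot>\<^sub>1\<^sub>2 \<theta>0 \<cdot>\<^sub>2\<^sub>1 \<gamma>\<langle>V, U\<rangle>"
    using ty by (simp add: swap assoc112[of _ ?Y ?Y' _ ?X' _ ?X'] assoc121[of _ ?Y ?X _ ?X' _ ?X'])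
  finally have right: "\<gamma>\<langle>V', U'\<rangle> \<cdot>\<^sub>1\<^sub>2 (t\<langle>V', U'\<rangle> \<cdot>\<^sub>1\<^sub>2 \<theta>0') = t\<langle>U', V'\<rangle> \<cdot>\<^sub>1\<^sub>2 \<theta>0 \<cdot>\<^sub>2\<^sub>1 \<gamma>\<langle>V, U\<rangle>" .
  show "\<gamma>\<langle>V', U'\<rangle> \<cdot>\<^sub>1\<^sub>2 htpy2 V U V' U' \<theta>0' \<theta>1' = htpy2 U V U' V' \<theta>0 \<theta>1 \<cdot>\<^sub>2\<^sub>1 \<gamma>\<langle>V, U\<rangle>"
    using ty cl by (simp add: htpy2_def rules swap left right)
qed

lemmas t_htpy_rules = bilinear_rules[OF t.pt_htpy_bilinear[of U U' V V'] module_Cell1 module_Cell1 module_Cell2]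
  for U U' V V'
lemmas t_htpy_closed =
  bilinear_closed[OF t.pt_htpy_bilinear module_Cell1 module_Cell1 module_Cell2]

lemma t_h_htpy:
  "\<lbrakk>fst f \<in> carrier (Cell1 C U U'); fst g \<in> carrier (Cell1 C V V')\<rbrakk>
    \<Longrightarrow> (t_h C t)\<langle>f \<boxtimes> g\<rangle> = hext (Cell2 C (U \<otimes>\<^sub>0 V) (U' \<otimes>\<^sub>0 V')) (\<lambda>f g. t\<langle>f \<boxtimes> g\<rangle>) f g"
  by (auto simp: t_h_def hptrans_def dest!: dom_cod1)

lemma gamma_htpy_zero:
  "\<lbrakk>f \<in> carrier (Cell1 C U U'); g \<in> carrier (Cell1 C V V')\<rbrakk>
    \<Longrightarrow> \<gamma>\<langle>f \<boxtimes> g\<rangle> = \<zero>\<^bsub>Cell2 C (U \<otimes>\<^sub>0 V) (V' \<otimes>\<^sub>0 U')\<^esub>"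
  using \<gamma>.htpy_zero[of f U U' g V V'] by (simp add: op_bifun_def)

lemma sigma_htpy:
  assumes f: "f0 \<in> carrier (Cell1 C U U')" "f1 \<in> carrier (Cell1 C U U')" "f2 \<in> carrier (Cell1 C U U')"
    and g: "g0 \<in> carrier (Cell1 C V V')" "g1 \<in> carrier (Cell1 C V V')" "g2 \<in> carrier (Cell1 C V V')"
    and \<theta>: "\<theta>0 = t\<langle>f0 \<boxtimes> g0\<rangle>"
      "\<theta>1 = t\<langle>f0 \<boxtimes> g1\<rangle> \<oplus>\<^bsub>Cell2 C (U \<otimes>\<^sub>0 V) (U' \<otimes>\<^sub>0 V')\<^esub> t\<langle>f1 \<boxtimes> g0\<rangle>"
  shows "(sigma K C \<gamma> t)\<langle>(f0, f1, f2) \<boxtimes> (g0, g1, g2)\<rangle>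
    = (\<zero>\<^bsub>Cell2 C (U \<otimes>\<^sub>0 V) (V' \<otimes>\<^sub>0 U')\<^esub>, \<gamma>\<langle>U', V'\<rangle> \<cdot>\<^sub>1\<^sub>2 htpy1 U V U' V' \<theta>0,
       \<gamma>\<langle>U', V'\<rangle> \<cdot>\<^sub>1\<^sub>2 htpy2 U V U' V' \<theta>0 \<theta>1)"
proof -
  let ?X = "U \<otimes>\<^sub>0 V" and ?X' = "U' \<otimes>\<^sub>0 V'" and ?Y' = "V' \<otimes>\<^sub>0 U'"
  interpret XX: module K "Cell2 C ?X ?X'" by (rule module_Cell2)
  interpret XY: module K "Cell2 C ?X ?Y'" by (rule module_Cell2)
  have dc: "dom1 C f0 = U" "cod1 C f0 = U'" "dom1 C g0 = V" "cod1 C g0 = V'"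
    using dom_cod1[OF f(1)] dom_cod1[OF g(1)] by simp_all
  have \<theta>_closed: "\<theta>0 \<in> carrier (Cell2 C ?X ?X')" "\<theta>1 \<in> carrier (Cell2 C ?X ?X')"
    using f g by (simp_all add: \<theta> t_htpy_closed)
  define \<theta>2 where "\<theta>2 = t\<langle>f0 \<boxtimes> g2\<rangle> \<oplus>\<^bsub>Cell2 C ?X ?X'\<^esub> t\<langle>f1 \<boxtimes> g1\<rangle> \<oplus>\<^bsub>Cell2 C ?X ?X'\<^esub> t\<langle>f2 \<boxtimes> g0\<rangle>"
  have \<theta>2_closed: "\<theta>2 \<in> carrier (Cell2 C ?X ?X')"
    using f g by (simp add: \<theta>2_def t_htpy_closed)
  have th: "(t_h C t)\<langle>(f0, f1, f2) \<boxtimes> (g0, g1, g2)\<rangle> = (\<theta>0, \<theta>1, \<theta>2)"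
    using f g by (simp add: t_h_htpy[of _ U U' _ V V'] hext_triple \<theta> \<theta>2_def)
  have gh: "(gamma_h C \<gamma>)\<langle>(f0, f1, f2) \<boxtimes> (g0, g1, g2)\<rangle>
      = (\<zero>\<^bsub>Cell2 C ?X ?Y'\<^esub>, \<zero>\<^bsub>Cell2 C ?X ?Y'\<^esub>, \<zero>\<^bsub>Cell2 C ?X ?Y'\<^esub>)"
    using f g by (simp add: gamma_h_def hptrans_def op_bifun_def dc hext_triple
        gamma_htpy_zero[of _ U U' _ V V'])
  note ty = t_closed[of U V] t_closed[of U' V'] recip_closed[of 2] recip_closed[of 8]
    \<theta>_closed \<theta>2_closed comp21_closed[OF \<theta>_closed(1) t_closed] comp12_closed[OF t_closed \<theta>_closed(1)]
    comp21_closed[OF \<theta>_closed(2) t_closed] comp12_closed[OF t_closed \<theta>_closed(2)]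
    comp21_closed[OF \<theta>2_closed t_closed] comp12_closed[OF t_closed \<theta>2_closed]
  have square: "(pt_comp D (tensor D) (tensor D) (t_h C t) (t_h C t))\<langle>(f0, f1, f2) \<boxtimes> (g0, g1, g2)\<rangle>
      = (\<theta>0 \<cdot>\<^sub>2\<^sub>1 t\<langle>U, V\<rangle> \<oplus>\<^bsub>Cell2 C ?X ?X'\<^esub> t\<langle>U', V'\<rangle> \<cdot>\<^sub>1\<^sub>2 \<theta>0,
         \<theta>1 \<cdot>\<^sub>2\<^sub>1 t\<langle>U, V\<rangle> \<oplus>\<^bsub>Cell2 C ?X ?X'\<^esub> t\<langle>U', V'\<rangle> \<cdot>\<^sub>1\<^sub>2 \<theta>1,
         \<theta>2 \<cdot>\<^sub>2\<^sub>1 t\<langle>U, V\<rangle> \<oplus>\<^bsub>Cell2 C ?X ?X'\<^esub> t\<langle>U', V'\<rangle> \<cdot>\<^sub>1\<^sub>2 \<theta>2)"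
    using ty by (simp add: pt_comp_def th dc t_h_cell hcomp12[of _ ?X ?X' _ ?X'] hcomp21[of _ ?X ?X _ ?X']
        hext_triple comp12_rules[where U="?X" and V="?X'" and W="?X'"] comp21_rules[where U="?X" and V="?X" and W="?X'"])
  have exp: "(exp_t K C t)\<langle>(f0, f1, f2) \<boxtimes> (g0, g1, g2)\<rangle>
      = (\<zero>\<^bsub>Cell2 C ?X ?X'\<^esub>, htpy1 U V U' V' \<theta>0, htpy2 U V U' V' \<theta>0 \<theta>1)"
    using ty unfolding exp_t_def Let_def pt_add_def pt_smult_def
    by (simp add: pt_id_def th square dc hmodule_smult_h[OF XX.module_axioms] htpy1_def htpy2_def)
  show ?thesis
    using gamma_closed[of U' V'] htpy_closed[OF \<theta>_closed] ident_closed exp_closed[of U V]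
      comp12_closed[OF gamma_closed htpy_closed(1)[OF \<theta>_closed]]
      comp12_closed[OF gamma_closed htpy_closed(2)[OF \<theta>_closed]]
    by (simp add: sigma_def Let_def pt_comp_def gh exp exp_cell dc gamma_h_cell op_bifun_def
        hcomp12[of _ ?X ?X' _ ?Y'] hcomp21[of _ ?X ?X _ ?Y'] hext_triple
        comp12_rules[where U="?X" and V="?X'" and W="?Y'"] comp21_rules[where U="?X" and V="?X" and W="?Y'"])
qed

lemma gamma_natural:
  assumes "f \<in> carrier (Cell1 C U U')" "g \<in> carrier (Cell1 C V V')"
  shows "(g \<otimes>\<^sub>1\<^sub>1 f) \<cdot>\<^sub>1\<^sub>1 \<gamma>\<langle>U, V\<rangle> = \<gamma>\<langle>U', V'\<rangle> \<cdot>\<^sub>1\<^sub>1 (f \<otimes>\<^sub>1\<^sub>1 g)"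
proof -
  interpret M: module K "Cell1 C (U \<otimes>\<^sub>0 V) (V' \<otimes>\<^sub>0 U')" by (rule module_Cell1)
  have "(g \<otimes>\<^sub>1\<^sub>1 f) \<cdot>\<^sub>1\<^sub>1 \<gamma>\<langle>U, V\<rangle> \<ominus>\<^bsub>Cell1 C (U \<otimes>\<^sub>0 V) (V' \<otimes>\<^sub>0 U')\<^esub> \<gamma>\<langle>U', V'\<rangle> \<cdot>\<^sub>1\<^sub>1 (f \<otimes>\<^sub>1\<^sub>1 g)
      = \<zero>\<^bsub>Cell1 C (U \<otimes>\<^sub>0 V) (V' \<otimes>\<^sub>0 U')\<^esub>"
    using \<gamma>.bdry_pt_htpy[OF assms] by (simp add: op_bifun_def gamma_htpy_zero[OF assms] bdry_zero)
  moreover have "(g \<otimes>\<^sub>1\<^sub>1 f) \<cdot>\<^sub>1\<^sub>1 \<gamma>\<langle>U, V\<rangle> \<in> carrier (Cell1 C (U \<otimes>\<^sub>0 V) (V' \<otimes>\<^sub>0 U'))"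
    "\<gamma>\<langle>U', V'\<rangle> \<cdot>\<^sub>1\<^sub>1 (f \<otimes>\<^sub>1\<^sub>1 g) \<in> carrier (Cell1 C (U \<otimes>\<^sub>0 V) (V' \<otimes>\<^sub>0 U'))"
    using assms by (auto intro: comp11_closed tens11_closed gamma_closed)
  ultimately show ?thesis
    using M.M.minus_equality M.M.minus_minus by (metis M.M.a_inv_closed a_minus_def)
qed

lemma T_htpy_add:
  assumes "f \<in> carrier (Cell1 C U U')" "g \<in> carrier (Cell1 C V V')"
  shows "(f \<otimes>\<^sub>1\<^sub>1 g) \<cdot>\<^sub>1\<^sub>2 T U V
    = T U' V' \<cdot>\<^sub>2\<^sub>1 (f \<otimes>\<^sub>1\<^sub>1 g) \<oplus>\<^bsub>Cell2 C (U \<otimes>\<^sub>0 V) (U' \<otimes>\<^sub>0 V')\<^esub> t\<langle>f \<boxtimes> g\<rangle>"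
proof -
  interpret M: module K "Cell2 C (U \<otimes>\<^sub>0 V) (U' \<otimes>\<^sub>0 V')" by (rule module_Cell2)
  have "(f \<otimes>\<^sub>1\<^sub>1 g) \<cdot>\<^sub>1\<^sub>2 T U V \<in> carrier (Cell2 C (U \<otimes>\<^sub>0 V) (U' \<otimes>\<^sub>0 V'))"
    "T U' V' \<cdot>\<^sub>2\<^sub>1 (f \<otimes>\<^sub>1\<^sub>1 g) \<in> carrier (Cell2 C (U \<otimes>\<^sub>0 V) (U' \<otimes>\<^sub>0 V'))"
    using assms by (auto intro: comp12_closed comp21_closed tens11_closed T_closed)
  then show ?thesis
    by (simp add: T_htpy[OF assms, symmetric] a_minus_def M.M.a_lcomm[of _ "(f \<otimes>\<^sub>1\<^sub>1 g) \<cdot>\<^sub>1\<^sub>2 T U V"] M.M.r_neg)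
qed

text \<open>
  After \<open>\<gamma>\<close> has been moved to the left everywhere, the claim is an identity between the coefficients
  of \<open>T\<close> and of the homotopy components of \<open>e\<^sup>h\<^sup>t\<^sup>/\<^sup>2\<close> and \<open>e\<^sup>-\<^sup>h\<^sup>t\<^sup>/\<^sup>2\<close>, where \<open>htpy_double\<close> meets the
  naturality defect \<open>T_htpy\<close> of \<open>T\<close>.
\<close>

lemma Sig_htpy:
  assumes "f \<in> carrier (Cell1 D U U')" "g \<in> carrier (Cell1 D V V')"
  shows "Sig U' V' \<cdot>\<^sub>2\<^sub>1\<^bsub>D\<^esub> (f \<otimes>\<^sub>1\<^sub>1\<^bsub>D\<^esub> g)
      \<oplus>\<^bsub>Cell2 D (U \<otimes>\<^sub>0 V) (V' \<otimes>\<^sub>0 U')\<^esub> (sigma K C \<gamma> t)\<langle>f \<boxtimes> g\<rangle>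
    = sigma_inv\<langle>g \<boxtimes> f\<rangle> \<oplus>\<^bsub>Cell2 D (U \<otimes>\<^sub>0 V) (V' \<otimes>\<^sub>0 U')\<^esub> (g \<otimes>\<^sub>1\<^sub>1\<^bsub>D\<^esub> f) \<cdot>\<^sub>1\<^sub>2\<^bsub>D\<^esub> Sig U V"
proof -
  let ?X = "U \<otimes>\<^sub>0 V" and ?X' = "U' \<otimes>\<^sub>0 V'" and ?Y = "V \<otimes>\<^sub>0 U" and ?Y' = "V' \<otimes>\<^sub>0 U'"
  interpret XX1: module K "Cell1 C ?X ?X'" by (rule module_Cell1)
  interpret YY1: module K "Cell1 C ?Y ?Y'" by (rule module_Cell1)
  interpret XY1: module K "Cell1 C ?X ?Y'" by (rule module_Cell1)
  interpret XX: module K "Cell2 C ?X ?X'" by (rule module_Cell2)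
  interpret YY: module K "Cell2 C ?Y ?Y'" by (rule module_Cell2)
  interpret XY: module K "Cell2 C ?X ?Y'" by (rule module_Cell2)
  interpret YX: module K "Cell2 C ?Y ?X'" by (rule module_Cell2)
  from assms obtain f0 f1 f2 g0 g1 g2 where e: "f = (f0, f1, f2)" "g = (g0, g1, g2)"
    and f: "f0 \<in> carrier (Cell1 C U U')" "f1 \<in> carrier (Cell1 C U U')" "f2 \<in> carrier (Cell1 C U U')"
    and g: "g0 \<in> carrier (Cell1 C V V')" "g1 \<in> carrier (Cell1 C V V')" "g2 \<in> carrier (Cell1 C V V')"
    by (auto elim!: hmodule_carrierE)
  have dc: "dom1 C f0 = U" "cod1 C f0 = U'" "dom1 C g0 = V" "cod1 C g0 = V'"
    using dom_cod1[OF f(1)] dom_cod1[OF g(1)] by simp_all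
  define F0 where "F0 = f0 \<otimes>\<^sub>1\<^sub>1 g0"
  define F1 where "F1 = f0 \<otimes>\<^sub>1\<^sub>1 g1 \<oplus>\<^bsub>Cell1 C ?X ?X'\<^esub> f1 \<otimes>\<^sub>1\<^sub>1 g0"
  define F2 where "F2 = f0 \<otimes>\<^sub>1\<^sub>1 g2 \<oplus>\<^bsub>Cell1 C ?X ?X'\<^esub> f1 \<otimes>\<^sub>1\<^sub>1 g1 \<oplus>\<^bsub>Cell1 C ?X ?X'\<^esub> f2 \<otimes>\<^sub>1\<^sub>1 g0"
  define G0 where "G0 = g0 \<otimes>\<^sub>1\<^sub>1 f0"
  define G1 where "G1 = g0 \<otimes>\<^sub>1\<^sub>1 f1 \<oplus>\<^bsub>Cell1 C ?Y ?Y'\<^esub> g1 \<otimes>\<^sub>1\<^sub>1 f0"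
  define G2 where "G2 = g0 \<otimes>\<^sub>1\<^sub>1 f2 \<oplus>\<^bsub>Cell1 C ?Y ?Y'\<^esub> g1 \<otimes>\<^sub>1\<^sub>1 f1 \<oplus>\<^bsub>Cell1 C ?Y ?Y'\<^esub> g2 \<otimes>\<^sub>1\<^sub>1 f0"
  define \<theta>0 where "\<theta>0 = t\<langle>f0 \<boxtimes> g0\<rangle>"
  define \<theta>1 where "\<theta>1 = t\<langle>f0 \<boxtimes> g1\<rangle> \<oplus>\<^bsub>Cell2 C ?X ?X'\<^esub> t\<langle>f1 \<boxtimes> g0\<rangle>"
  define \<theta>0' where "\<theta>0' = t\<langle>g0 \<boxtimes> f0\<rangle>"
  define \<theta>1' where "\<theta>1' = t\<langle>g0 \<boxtimes> f1\<rangle> \<oplus>\<^bsub>Cell2 C ?Y ?Y'\<^esub> t\<langle>g1 \<boxtimes> f0\<rangle>"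
  have F: "F0 \<in> carrier (Cell1 C ?X ?X')" "F1 \<in> carrier (Cell1 C ?X ?X')" "F2 \<in> carrier (Cell1 C ?X ?X')"
    and G: "G0 \<in> carrier (Cell1 C ?Y ?Y')" "G1 \<in> carrier (Cell1 C ?Y ?Y')" "G2 \<in> carrier (Cell1 C ?Y ?Y')"
    and \<theta>: "\<theta>0 \<in> carrier (Cell2 C ?X ?X')" "\<theta>1 \<in> carrier (Cell2 C ?X ?X')"
    and \<theta>': "\<theta>0' \<in> carrier (Cell2 C ?Y ?Y')" "\<theta>1' \<in> carrier (Cell2 C ?Y ?Y')"
    unfolding F0_def F1_def F2_def G0_def G1_def G2_def \<theta>0_def \<theta>1_def \<theta>0'_def \<theta>1'_def
    using f g by (simp_all add: tens11_closed t_htpy_closed)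
  have FF: "f \<otimes>\<^sub>1\<^sub>1\<^bsub>D\<^esub> g = (F0, F1, F2)" and GG: "g \<otimes>\<^sub>1\<^sub>1\<^bsub>D\<^esub> f = (G0, G1, G2)"
    unfolding e F0_def F1_def F2_def G0_def G1_def G2_def
    using f g by (simp_all add: htens11[of _ U U' _ V V'] htens11[of _ V V' _ U U'] hext_triple)
  note ty = gamma_closed[of U V] gamma_closed[of U' V'] gamma_closed[of V U] gamma_closed[of V' U']
    T_closed[of U V] T_closed[of U' V'] exp_closed[of U V] exp_closed[of U' V']
  have nat0: "G0 \<cdot>\<^sub>1\<^sub>1 \<gamma>\<langle>U, V\<rangle> = \<gamma>\<langle>U', V'\<rangle> \<cdot>\<^sub>1\<^sub>1 F0"
    unfolding F0_def G0_def using f g by (simp add: gamma_natural)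
  have nat1: "G1 \<cdot>\<^sub>1\<^sub>1 \<gamma>\<langle>U, V\<rangle> = \<gamma>\<langle>U', V'\<rangle> \<cdot>\<^sub>1\<^sub>1 F1"
    unfolding F1_def G1_def using f g ty
      tens11_closed[OF f(1) g(2)] tens11_closed[OF f(2) g(1)]
      tens11_closed[OF g(2) f(1)] tens11_closed[OF g(1) f(2)]
      comp11_closed[OF ty(2) tens11_closed[OF f(1) g(2)]]
      comp11_closed[OF ty(2) tens11_closed[OF f(2) g(1)]]
    by (simp add: comp11_rules[where U="?X" and V="?Y" and W="?Y'"] comp11_rules[where U="?X" and V="?X'" and W="?Y'"]
        gamma_natural XY1.M.a_comm)
  have T0: "F0 \<cdot>\<^sub>1\<^sub>2 T U V = T U' V' \<cdot>\<^sub>2\<^sub>1 F0 \<oplus>\<^bsub>Cell2 C ?X ?X'\<^esub> \<theta>0"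
    unfolding F0_def \<theta>0_def using f g by (simp add: T_htpy_add)
  have T1: "F1 \<cdot>\<^sub>1\<^sub>2 T U V = T U' V' \<cdot>\<^sub>2\<^sub>1 F1 \<oplus>\<^bsub>Cell2 C ?X ?X'\<^esub> \<theta>1"
    unfolding F1_def \<theta>1_def using f g ty
      tens11_closed[OF f(1) g(2)] tens11_closed[OF f(2) g(1)]
      t_htpy_closed[OF f(1) g(2)] t_htpy_closed[OF f(2) g(1)]
      comp21_closed[OF ty(6) tens11_closed[OF f(1) g(2)]]
      comp21_closed[OF ty(6) tens11_closed[OF f(2) g(1)]]
    by (simp add: comp12_rules[where U="?X" and V="?X" and W="?X'"] comp21_rules[where U="?X" and V="?X'" and W="?X'"]
        T_htpy_add XX.M.a_ac)
  have swap0: "\<gamma>\<langle>V', U'\<rangle> \<cdot>\<^sub>1\<^sub>2 \<theta>0' = \<theta>0 \<cdot>\<^sub>2\<^sub>1 \<gamma>\<langle>V, U\<rangle>"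
    unfolding \<theta>0_def \<theta>0'_def using f g by (simp add: symmetric_htpy)
  have swap1: "\<gamma>\<langle>V', U'\<rangle> \<cdot>\<^sub>1\<^sub>2 \<theta>1' = \<theta>1 \<cdot>\<^sub>2\<^sub>1 \<gamma>\<langle>V, U\<rangle>"
    unfolding \<theta>1_def \<theta>1'_def using f g ty
      t_htpy_closed[OF f(1) g(2)] t_htpy_closed[OF f(2) g(1)]
      t_htpy_closed[OF g(2) f(1)] t_htpy_closed[OF g(1) f(2)]
      comp21_closed[OF t_htpy_closed[OF f(1) g(2)] ty(3)]
      comp21_closed[OF t_htpy_closed[OF f(2) g(1)] ty(3)]
    by (simp add: comp12_rules[where U="?Y" and V="?Y'" and W="?X'"] comp21_rules[where U="?Y" and V="?X" and W="?X'"]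
        symmetric_htpy YX.M.a_comm)
  let ?e1 = "htpy1 U V U' V' \<theta>0" and ?e2 = "htpy2 U V U' V' \<theta>0 \<theta>1"
  let ?g = "\<gamma>\<langle>U, V\<rangle>" and ?g' = "\<gamma>\<langle>U', V'\<rangle>" and ?gi = "\<gamma>\<langle>V, U\<rangle>"
  let ?x = "exp1 U V" and ?x' = "exp1 U' V'"
  let ?p = "\<lambda>a b. a \<oplus>\<^bsub>Cell2 C ?X ?X'\<^esub> b" and ?n = "\<lambda>a. \<ominus>\<^bsub>Cell2 C ?X ?X'\<^esub> a"
  note ec = htpy_closed[OF \<theta>]
  note cl = comp21_closed[OF ec(1) ty(3)] comp21_closed[OF ec(2) ty(3)]
    comp11_closed[OF ty(2) ty(9)] comp11_closed[OF ty(2) ty(10)]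
    comp11_closed[OF ty(1) ty(7)] comp11_closed[OF ty(1) ty(8)]
  have sf: "(sigma K C \<gamma> t)\<langle>f \<boxtimes> g\<rangle> = (\<zero>\<^bsub>Cell2 C ?X ?Y'\<^esub>, ?g' \<cdot>\<^sub>1\<^sub>2 ?e1, ?g' \<cdot>\<^sub>1\<^sub>2 ?e2)"
    unfolding e by (rule sigma_htpy[OF f g \<theta>0_def \<theta>1_def])
  have sg: "(sigma K C \<gamma> t)\<langle>g \<boxtimes> f\<rangle> = (\<zero>\<^bsub>Cell2 C ?Y ?X'\<^esub>, ?e1 \<cdot>\<^sub>2\<^sub>1 ?gi, ?e2 \<cdot>\<^sub>2\<^sub>1 ?gi)"
    unfolding e sigma_htpy[OF g f \<theta>0'_def \<theta>1'_def] gamma_htpy[OF \<theta> \<theta>' swap0 swap1] by simp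
  \<comment> \<open>the braidings of \<open>\<sigma>\<close> at \<open>V, U\<close> and of \<open>\<sigma>\<inverse>\<close> cancel\<close>
  have unbraid: "(w \<cdot>\<^sub>1\<^sub>2 (a \<cdot>\<^sub>2\<^sub>1 ?gi)) \<cdot>\<^sub>2\<^sub>1 (?g \<cdot>\<^sub>1\<^sub>1 z) = w \<cdot>\<^sub>1\<^sub>2 (a \<cdot>\<^sub>2\<^sub>1 z)"
    "(w \<cdot>\<^sub>1\<^sub>2 (a \<cdot>\<^sub>2\<^sub>1 ?gi)) \<cdot>\<^sub>2\<^sub>1 ?g = w \<cdot>\<^sub>1\<^sub>2 a"
    if "a \<in> carrier (Cell2 C ?X ?X')" "w \<in> carrier (Cell1 C ?X' ?Y')" "z \<in> carrier (Cell1 C ?X ?X)" for a w z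
    using that ty comp21_closed[OF that(1) ty(3)] comp11_closed[OF ty(1) that(3)] ident11[OF that(3)]
      ident2[OF that(1)]
    by (simp_all add: assoc121[of _ ?X ?Y _ ?X' _ ?Y'] assoc211[of _ ?X ?Y _ ?X _ ?X'] braid_involutive
        flip: assoc111[of _ ?X ?X _ ?Y _ ?X])
  have si: "sigma_inv\<langle>g \<boxtimes> f\<rangle> = (\<zero>\<^bsub>Cell2 C ?X ?Y'\<^esub>, \<ominus>\<^bsub>Cell2 C ?X ?Y'\<^esub> (?g' \<cdot>\<^sub>1\<^sub>2 ?e1),
      \<ominus>\<^bsub>Cell2 C ?X ?Y'\<^esub> (?g' \<cdot>\<^sub>1\<^sub>2 (?p ?e2 (?n (?p (?e1 \<cdot>\<^sub>2\<^sub>1 ?x) (?x' \<cdot>\<^sub>1\<^sub>2 ?e1))))))"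
  proof -
    have "inv1 D ((sigma K C \<gamma> t)\<langle>V, U\<rangle>) = sigma_inv\<langle>V, U\<rangle>" for V U
      by (simp add: pt_inv_def)
    then have "sigma_inv\<langle>g \<boxtimes> f\<rangle> = \<ominus>\<^bsub>hmodule (Cell2 C ?X ?Y')\<^esub>
        (sigma_inv\<langle>V', U'\<rangle> \<cdot>\<^sub>1\<^sub>2\<^bsub>D\<^esub> (sigma K C \<gamma> t)\<langle>g \<boxtimes> f\<rangle> \<cdot>\<^sub>2\<^sub>1\<^bsub>D\<^esub> sigma_inv\<langle>V, U\<rangle>)"
      by (simp add: pt_inv_def op_bifun_def e dc)
    moreover have "sigma_inv\<langle>V', U'\<rangle> \<cdot>\<^sub>1\<^sub>2\<^bsub>D\<^esub> (sigma K C \<gamma> t)\<langle>g \<boxtimes> f\<rangle> \<cdot>\<^sub>2\<^sub>1\<^bsub>D\<^esub> sigma_inv\<langle>V, U\<rangle>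
      = (\<zero>\<^bsub>Cell2 C ?X ?Y'\<^esub>, ?g' \<cdot>\<^sub>1\<^sub>2 ?e1,
         ?g' \<cdot>\<^sub>1\<^sub>2 (?p ?e2 (?n (?p (?e1 \<cdot>\<^sub>2\<^sub>1 ?x) (?x' \<cdot>\<^sub>1\<^sub>2 ?e1)))))"
    proof -
      have product: "(\<gamma>\<langle>U', V'\<rangle>, \<ominus>\<^bsub>Cell1 C ?X' ?Y'\<^esub> (?g' \<cdot>\<^sub>1\<^sub>1 ?x'), ?g' \<cdot>\<^sub>1\<^sub>1 exp2 U' V')
          \<cdot>\<^sub>1\<^sub>2\<^bsub>D\<^esub> (\<zero>\<^bsub>Cell2 C ?Y ?X'\<^esub>, ?e1 \<cdot>\<^sub>2\<^sub>1 ?gi, ?e2 \<cdot>\<^sub>2\<^sub>1 ?gi)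
        = (\<zero>\<^bsub>Cell2 C ?Y ?Y'\<^esub>, ?g' \<cdot>\<^sub>1\<^sub>2 (?e1 \<cdot>\<^sub>2\<^sub>1 ?gi),
           ?g' \<cdot>\<^sub>1\<^sub>2 (?e2 \<cdot>\<^sub>2\<^sub>1 ?gi) \<oplus>\<^bsub>Cell2 C ?Y ?Y'\<^esub>
             \<ominus>\<^bsub>Cell2 C ?Y ?Y'\<^esub> ((?g' \<cdot>\<^sub>1\<^sub>1 ?x') \<cdot>\<^sub>1\<^sub>2 (?e1 \<cdot>\<^sub>2\<^sub>1 ?gi)))"
        using ty cl
        by (simp add: hcomp12[of _ ?Y ?X' _ ?Y'] hext_triple comp12_rules[where U="?Y" and V="?X'" and W="?Y'"])
      show ?thesis
        unfolding sg sigma_inv_cell product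
        using ty ec cl unbraid
          comp12_closed[OF ty(2) cl(1)] comp12_closed[OF ty(2) cl(2)] comp12_closed[OF cl(3) cl(1)]
          comp21_closed[OF ec(1) ty(7)] comp12_closed[OF ty(9) ec(1)]
          comp12_closed[OF ty(2) comp21_closed[OF ec(1) ty(7)]]
          comp12_closed[OF ty(2) comp12_closed[OF ty(9) ec(1)]]
          comp12_closed[OF ty(2) ec(1)] comp12_closed[OF ty(2) ec(2)]
        by (simp add: hcomp21[of _ ?X ?Y _ ?Y'] hext_triple comp21_rules[where U="?X" and V="?Y" and W="?Y'"]
            comp12_rules[where U="?X" and V="?X'" and W="?Y'"] assoc112[of _ ?X ?X' _ ?X' _ ?Y']
            XX.M.minus_add XY.M.a_ac)
    qed
    moreover have "?g' \<cdot>\<^sub>1\<^sub>2 ?e1 \<in> carrier (Cell2 C ?X ?Y')"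
      "?g' \<cdot>\<^sub>1\<^sub>2 (?p ?e2 (?n (?p (?e1 \<cdot>\<^sub>2\<^sub>1 ?x) (?x' \<cdot>\<^sub>1\<^sub>2 ?e1)))) \<in> carrier (Cell2 C ?X ?Y')"
      using ec ty comp21_closed[OF ec(1) ty(7)] comp12_closed[OF ty(9) ec(1)]
      by (simp_all add: comp12_rules(1)[where U="?X" and V="?X'" and W="?Y'"])
    ultimately show ?thesis
      by (simp add: hmodule_neg[OF group_Cell2])
  qed
  let ?a0 = "T U' V' \<cdot>\<^sub>2\<^sub>1 F0" and ?a1 = "T U' V' \<cdot>\<^sub>2\<^sub>1 F1"
  let ?r = "?p (?e1 \<cdot>\<^sub>2\<^sub>1 ?x) (?x' \<cdot>\<^sub>1\<^sub>2 ?e1)"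
  have a: "?a0 \<in> carrier (Cell2 C ?X ?X')" "?a1 \<in> carrier (Cell2 C ?X ?X')"
    using comp21_closed[OF ty(6) F(1)] comp21_closed[OF ty(6) F(2)] by auto
  have r: "?r \<in> carrier (Cell2 C ?X ?X')"
    using comp21_closed[OF ec(1) ty(7)] comp12_closed[OF ty(9) ec(1)] by simp
  have "?p (?n ?e1) (?p ?a0 \<theta>0) = ?p (?n ?e1) (?p ?a0 (?p ?e1 ?e1))"
    by (simp add: htpy_double[OF \<theta>])
  also have "\<dots> = ?p ?a0 ?e1"
    using a ec by (simp add: XX.M.a_lcomm[of _ ?a0] XX.M.r_neg2 XX.M.r_neg1)
  finally have order1: "?p ?a0 ?e1 = ?p (?n ?e1) (?p ?a0 \<theta>0)" by simp
  have "?p (?n (?p ?e2 (?n ?r))) (?p ?a1 \<theta>1) = ?p (?n ?e2) (?p ?a1 (?p \<theta>1 ?r))"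
    using a r ec \<theta> by (simp add: XX.M.minus_add XX.M.minus_minus XX.M.a_ac)
  also have "\<dots> = ?p (?n ?e2) (?p ?a1 (?p ?e2 ?e2))"
    by (simp add: htpy_double[OF \<theta>])
  also have "\<dots> = ?p ?a1 ?e2"
    using a ec by (simp add: XX.M.a_lcomm[of _ ?a1] XX.M.r_neg2 XX.M.r_neg1)
  finally have order2: "?p ?a1 ?e2 = ?p (?n (?p ?e2 (?n ?r))) (?p ?a1 \<theta>1)" by simp
  have lhs: "Sig U' V' \<cdot>\<^sub>2\<^sub>1\<^bsub>D\<^esub> (f \<otimes>\<^sub>1\<^sub>1\<^bsub>D\<^esub> g)
      = (\<zero>\<^bsub>Cell2 C ?X ?Y'\<^esub>, ?g' \<cdot>\<^sub>1\<^sub>2 ?a0, ?g' \<cdot>\<^sub>1\<^sub>2 ?a1)"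
    unfolding Sig_cell FF
    using ty F gamma_T_closed[of U' V'] comp12_closed[OF ty(2) a(1)] comp12_closed[OF ty(2) a(2)]
    by (simp add: hcomp21[of _ ?X ?X' _ ?Y'] hext_triple comp21_rules[where U="?X" and V="?X'" and W="?Y'"]
        assoc121[of _ ?X ?X' _ ?X' _ ?Y'])
  have move: "G \<cdot>\<^sub>1\<^sub>2 (?g \<cdot>\<^sub>1\<^sub>2 T U V) = ?g' \<cdot>\<^sub>1\<^sub>2 (F \<cdot>\<^sub>1\<^sub>2 T U V)"
    if "G \<cdot>\<^sub>1\<^sub>1 ?g = ?g' \<cdot>\<^sub>1\<^sub>1 F" "G \<in> carrier (Cell1 C ?Y ?Y')" "F \<in> carrier (Cell1 C ?X ?X')" for F G
    using assoc112[OF ty(5) ty(1) that(2)] assoc112[OF ty(5) that(3) ty(2)] that(1) by simp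
  have rhs: "(g \<otimes>\<^sub>1\<^sub>1\<^bsub>D\<^esub> f) \<cdot>\<^sub>1\<^sub>2\<^bsub>D\<^esub> Sig U V
      = (\<zero>\<^bsub>Cell2 C ?X ?Y'\<^esub>, ?g' \<cdot>\<^sub>1\<^sub>2 ?p ?a0 \<theta>0, ?g' \<cdot>\<^sub>1\<^sub>2 ?p ?a1 \<theta>1)"
    unfolding Sig_cell GG
    using ty G gamma_T_closed[of U V] move[OF nat0 G(1) F(1)] move[OF nat1 G(2) F(2)] a \<theta>
      comp12_closed[OF ty(2), of "?p ?a0 \<theta>0" ?X] comp12_closed[OF ty(2), of "?p ?a1 \<theta>1" ?X]
    by (simp add: hcomp12[of _ ?X ?Y _ ?Y'] hext_triple comp12_rules(1,6,7)[where U="?X" and V="?Y" and W="?Y'"]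
        T0 T1)
  note rules = comp12_rules[where U="?X" and V="?X'" and W="?Y'"]
  have "?g' \<cdot>\<^sub>1\<^sub>2 ?p ?a0 ?e1 = ?g' \<cdot>\<^sub>1\<^sub>2 ?p (?n ?e1) (?p ?a0 \<theta>0)"
    "?g' \<cdot>\<^sub>1\<^sub>2 ?p ?a1 ?e2 = ?g' \<cdot>\<^sub>1\<^sub>2 ?p (?n (?p ?e2 (?n ?r))) (?p ?a1 \<theta>1)"
    by (simp_all only: order1 order2)
  then show ?thesis
    unfolding lhs rhs sf si
    using a ec r \<theta> ty by (simp add: rules(3,9))
qed

end


section \<open>Braiding three objects\<close>

context extended_category
begin

text \<open>
  With \<open>P\<close>, \<open>Q\<close> elementary braidings, this passes a 2-cell across \<open>Q P\<close> when \<open>Q\<close> relates it to another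
  2-cell by total symmetry, and \<open>P\<close> relates that one to \<open>\<L> + \<R>\<close> by coherence.
\<close>

lemma move_across:
  assumes P: "P \<in> carrier (Cell1 C X Z)" "P' \<in> carrier (Cell1 C Z X)" "P \<cdot>\<^sub>1\<^sub>1 P' = \<one>\<^sub>1 Z"
    and Q: "Q \<in> carrier (Cell1 C Z Y)"
    and cells: "\<rho> \<in> carrier (Cell2 C Y Y)" "\<rho>' \<in> carrier (Cell2 C Z Z)" "\<kappa> \<in> carrier (Cell2 C X X)"
    and Q_move: "\<rho> \<cdot>\<^sub>2\<^sub>1 Q = Q \<cdot>\<^sub>1\<^sub>2 \<rho>'"
    and P_move: "\<ominus>\<^bsub>Cell2 C X X\<^esub> (P' \<cdot>\<^sub>1\<^sub>2 \<rho>' \<cdot>\<^sub>2\<^sub>1 P) = \<kappa>"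
  shows "\<rho> \<cdot>\<^sub>2\<^sub>1 (Q \<cdot>\<^sub>1\<^sub>1 P) = \<ominus>\<^bsub>Cell2 C X Y\<^esub> ((Q \<cdot>\<^sub>1\<^sub>1 P) \<cdot>\<^sub>1\<^sub>2 \<kappa>)"
proof -
  interpret XX: module K "Cell2 C X X" by (rule module_Cell2)
  interpret XZ: module K "Cell2 C X Z" by (rule module_Cell2)
  interpret XY: module K "Cell2 C X Y" by (rule module_Cell2)
  note \<rho>'P = comp21_closed[OF cells(2) P(1)]
  have "P \<cdot>\<^sub>1\<^sub>2 (P' \<cdot>\<^sub>1\<^sub>2 (\<rho>' \<cdot>\<^sub>2\<^sub>1 P)) = \<rho>' \<cdot>\<^sub>2\<^sub>1 P"
    using assoc112[OF \<rho>'P P(2,1)] ident2[OF \<rho>'P] by (simp add: P(3))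
  then have "P \<cdot>\<^sub>1\<^sub>2 \<kappa> = \<ominus>\<^bsub>Cell2 C X Z\<^esub> (\<rho>' \<cdot>\<^sub>2\<^sub>1 P)"
    using comp12_closed[OF P(2) \<rho>'P] P(1)
    by (simp add: P_move[symmetric] assoc121[OF P(1) cells(2) P(2)] comp12_rules(9)[where U=X and V=X])
  then have "(Q \<cdot>\<^sub>1\<^sub>1 P) \<cdot>\<^sub>1\<^sub>2 \<kappa> = \<ominus>\<^bsub>Cell2 C X Y\<^esub> (Q \<cdot>\<^sub>1\<^sub>2 (\<rho>' \<cdot>\<^sub>2\<^sub>1 P))"
    using \<rho>'P Q by (simp add: assoc112[OF cells(3) P(1) Q] comp12_rules(9)[where U=X and V=Z])
  also have "Q \<cdot>\<^sub>1\<^sub>2 (\<rho>' \<cdot>\<^sub>2\<^sub>1 P) = \<rho> \<cdot>\<^sub>2\<^sub>1 (Q \<cdot>\<^sub>1\<^sub>1 P)"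
    by (simp add: Q_move assoc121[OF P(1) cells(2) Q, symmetric] assoc211[OF P(1) Q cells(1), symmetric])
  finally show ?thesis
    using comp21_closed[OF cells(1) comp11_closed[OF Q P(1)]] by (simp add: XY.M.minus_minus)
qed

text \<open>
  The shape of the additivity axioms of \<open>T\<close> after composition with a braiding \<open>Q P\<close> of one object
  past two.
\<close>

lemma split_across:
  assumes P: "P \<in> carrier (Cell1 C X Z)" "P' \<in> carrier (Cell1 C Z X)" "P \<cdot>\<^sub>1\<^sub>1 P' = \<one>\<^sub>1 Z"
    and Q: "Q \<in> carrier (Cell1 C Z Y)"
    and cells: "\<tau> \<in> carrier (Cell2 C X X)" "\<tau>' \<in> carrier (Cell2 C Z Z)"
  shows "(Q \<cdot>\<^sub>1\<^sub>1 P) \<cdot>\<^sub>1\<^sub>2 (\<tau> \<oplus>\<^bsub>Cell2 C X X\<^esub> P' \<cdot>\<^sub>1\<^sub>2 \<tau>' \<cdot>\<^sub>2\<^sub>1 P)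
    = Q \<cdot>\<^sub>1\<^sub>2 (P \<cdot>\<^sub>1\<^sub>2 \<tau>) \<oplus>\<^bsub>Cell2 C X Y\<^esub> (Q \<cdot>\<^sub>1\<^sub>2 \<tau>') \<cdot>\<^sub>2\<^sub>1 P"
proof -
  note \<tau>'P = comp21_closed[OF cells(2) P(1)]
  have "P \<cdot>\<^sub>1\<^sub>2 (P' \<cdot>\<^sub>1\<^sub>2 (\<tau>' \<cdot>\<^sub>2\<^sub>1 P)) = \<tau>' \<cdot>\<^sub>2\<^sub>1 P"
    using assoc112[OF \<tau>'P P(2,1)] ident2[OF \<tau>'P] by (simp add: P(3))
  then show ?thesis
    using comp12_closed[OF P(2) \<tau>'P] comp11_closed[OF Q P(1)] cells(1)
    by (simp add: assoc121[OF P(1) cells(2) P(2)] assoc121[OF P(1) cells(2) Q]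
        comp12_rules(3)[where U=X and V=X and W=Y] assoc112[of _ X X P Z Q Y] P Q)
qed

end

context deformation
begin

definition swap12 :: "'o \<Rightarrow> 'o \<Rightarrow> 'o \<Rightarrow> 'a"
  where "swap12 U V W = \<gamma>\<langle>U, V\<rangle> \<otimes>\<^sub>1\<^sub>1 \<one>\<^sub>1 W"

definition swap23 :: "'o \<Rightarrow> 'o \<Rightarrow> 'o \<Rightarrow> 'a"
  where "swap23 U V W = \<one>\<^sub>1 U \<otimes>\<^sub>1\<^sub>1 \<gamma>\<langle>V, W\<rangle>"

definition T12 :: "'o \<Rightarrow> 'o \<Rightarrow> 'o \<Rightarrow> 'b"
  where "T12 U V W = T U V \<otimes>\<^sub>2\<^sub>1 \<one>\<^sub>1 W"

definition T23 :: "'o \<Rightarrow> 'o \<Rightarrow> 'o \<Rightarrow> 'b"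
  where "T23 U V W = \<one>\<^sub>1 U \<otimes>\<^sub>1\<^sub>2 T V W"

text \<open>
  The constant coefficients of \<open>\<L>\<close> and \<open>\<R>\<close>; the others vanish.
\<close>

definition Lt :: "'o \<Rightarrow> 'o \<Rightarrow> 'o \<Rightarrow> 'b"
  where "Lt U V W = t\<langle>t\<langle>U, V\<rangle> \<boxtimes> \<one>\<^sub>1 W\<rangle>"

definition Rt :: "'o \<Rightarrow> 'o \<Rightarrow> 'o \<Rightarrow> 'b"
  where "Rt U V W = t\<langle>\<one>\<^sub>1 U \<boxtimes> t\<langle>V, W\<rangle>\<rangle>"

lemma whiskered_closed:
  "swap12 U V W \<in> carrier (Cell1 C (U \<otimes>\<^sub>0 (V \<otimes>\<^sub>0 W)) (V \<otimes>\<^sub>0 (U \<otimes>\<^sub>0 W)))"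
  "swap23 U V W \<in> carrier (Cell1 C (U \<otimes>\<^sub>0 (V \<otimes>\<^sub>0 W)) (U \<otimes>\<^sub>0 (W \<otimes>\<^sub>0 V)))"
  "T12 U V W \<in> carrier (Cell2 C (U \<otimes>\<^sub>0 (V \<otimes>\<^sub>0 W)) (U \<otimes>\<^sub>0 (V \<otimes>\<^sub>0 W)))"
  "T23 U V W \<in> carrier (Cell2 C (U \<otimes>\<^sub>0 (V \<otimes>\<^sub>0 W)) (U \<otimes>\<^sub>0 (V \<otimes>\<^sub>0 W)))"
  "Lt U V W \<in> carrier (Cell2 C (U \<otimes>\<^sub>0 (V \<otimes>\<^sub>0 W)) (U \<otimes>\<^sub>0 (V \<otimes>\<^sub>0 W)))"
  "Rt U V W \<in> carrier (Cell2 C (U \<otimes>\<^sub>0 (V \<otimes>\<^sub>0 W)) (U \<otimes>\<^sub>0 (V \<otimes>\<^sub>0 W)))"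
  using tens11_closed[OF gamma_closed[of U V] ident_closed[of W]]
    tens11_closed[OF ident_closed[of U] gamma_closed[of V W]]
    tens21_closed[OF T_closed[of U V] ident_closed[of W]]
    tens12_closed[OF ident_closed[of U] T_closed[of V W]]
    t_htpy_closed[OF t_closed[of U V] ident_closed[of W]]
    t_htpy_closed[OF ident_closed[of U] t_closed[of V W]]
  by (simp_all add: swap12_def swap23_def T12_def T23_def Lt_def Rt_def tens_assoc0)

lemma ident_ident: "\<one>\<^sub>1 U \<cdot>\<^sub>1\<^sub>1 \<one>\<^sub>1 U = \<one>\<^sub>1 U"
  using ident11[OF ident_closed[of U]] by simp

lemma swap_inverse:
  "swap12 V U W \<cdot>\<^sub>1\<^sub>1 swap12 U V W = \<one>\<^sub>1 (U \<otimes>\<^sub>0 (V \<otimes>\<^sub>0 W))"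
  "swap23 U W V \<cdot>\<^sub>1\<^sub>1 swap23 U V W = \<one>\<^sub>1 (U \<otimes>\<^sub>0 (V \<otimes>\<^sub>0 W))"
  using f11_comp11[OF gamma_closed[of U V] gamma_closed[of V U] ident_closed[of W] ident_closed[of W]]
    f11_comp11[OF ident_closed[of U] ident_closed[of U] gamma_closed[of V W] gamma_closed[of W V]]
  by (simp_all add: swap12_def swap23_def braid_involutive ident_ident f11_ident tens_assoc0)

lemma hexagon_right: "\<gamma>\<langle>U, V \<otimes>\<^sub>0 W\<rangle> = swap23 V U W \<cdot>\<^sub>1\<^sub>1 swap12 U V W"
  by (simp add: braid_hexagon swap12_def swap23_def)

text \<open>
  The inverse of the hexagon identity for \<open>\<gamma>\<langle>W, U \<otimes> V\<rangle>\<close>.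
\<close>

lemma hexagon_left: "\<gamma>\<langle>U \<otimes>\<^sub>0 V, W\<rangle> = swap12 U W V \<cdot>\<^sub>1\<^sub>1 swap23 U V W"
proof -
  let ?X = "U \<otimes>\<^sub>0 (V \<otimes>\<^sub>0 W)" and ?Z = "U \<otimes>\<^sub>0 (W \<otimes>\<^sub>0 V)" and ?Y = "W \<otimes>\<^sub>0 (U \<otimes>\<^sub>0 V)"
  let ?g = "\<gamma>\<langle>U \<otimes>\<^sub>0 V, W\<rangle>"
  note P = whiskered_closed(1)[of U W V] and P' = whiskered_closed(1)[of W U V]
    and Q = whiskered_closed(2)[of U V W] and Q' = whiskered_closed(2)[of U W V]
  have g: "?g \<in> carrier (Cell1 C ?X ?Y)"
    using gamma_closed[of "U \<otimes>\<^sub>0 V" W] by (simp add: tens_assoc0)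
  note PQ = comp11_closed[OF P Q] and QP = comp11_closed[OF Q' P']
  have "(swap23 U W V \<cdot>\<^sub>1\<^sub>1 swap12 W U V) \<cdot>\<^sub>1\<^sub>1 (swap12 U W V \<cdot>\<^sub>1\<^sub>1 swap23 U V W)
      = swap23 U W V \<cdot>\<^sub>1\<^sub>1 (swap12 W U V \<cdot>\<^sub>1\<^sub>1 swap12 U W V \<cdot>\<^sub>1\<^sub>1 swap23 U V W)"
    by (simp add: assoc111[OF PQ P' Q'] assoc111[OF Q P P'])
  also have "\<dots> = \<one>\<^sub>1 ?X"
    using ident11[OF Q] by (simp add: swap_inverse)
  finally have id: "(swap23 U W V \<cdot>\<^sub>1\<^sub>1 swap12 W U V) \<cdot>\<^sub>1\<^sub>1 (swap12 U W V \<cdot>\<^sub>1\<^sub>1 swap23 U V W) = \<one>\<^sub>1 ?X" .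
  have "?g \<cdot>\<^sub>1\<^sub>1 (swap23 U W V \<cdot>\<^sub>1\<^sub>1 swap12 W U V) = \<one>\<^sub>1 ?Y"
    using braid_involutive[of "U \<otimes>\<^sub>0 V" W] by (simp add: hexagon_right)
  then show ?thesis
    using assoc111[OF PQ QP g] ident11[OF PQ] ident11[OF g] id by simp
qed

text \<open>
  Symmetry of \<open>t\<close> exchanges its two arguments up to composition with invertible braidings.
\<close>

lemma totally_symmetric_right:
  "t\<langle>\<one>\<^sub>1 U \<boxtimes> \<gamma>\<langle>V, W\<rangle>\<rangle> = \<zero>\<^bsub>Cell2 C (U \<otimes>\<^sub>0 (V \<otimes>\<^sub>0 W)) (U \<otimes>\<^sub>0 (W \<otimes>\<^sub>0 V))\<^esub>"
proof -
  let ?x = "t\<langle>\<one>\<^sub>1 U \<boxtimes> \<gamma>\<langle>V, W\<rangle>\<rangle>"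
  let ?X = "U \<otimes>\<^sub>0 (V \<otimes>\<^sub>0 W)" and ?X' = "U \<otimes>\<^sub>0 (W \<otimes>\<^sub>0 V)" and ?Y' = "(W \<otimes>\<^sub>0 V) \<otimes>\<^sub>0 U"
  note x = t_htpy_closed[OF ident_closed[of U] gamma_closed[of V W]]
  note g = gamma_closed[of U "W \<otimes>\<^sub>0 V"] and g' = gamma_closed[of "W \<otimes>\<^sub>0 V" U]
  have "\<gamma>\<langle>U, W \<otimes>\<^sub>0 V\<rangle> \<cdot>\<^sub>1\<^sub>2 ?x = \<zero>\<^bsub>Cell2 C ?X ?Y'\<^esub>"
    using symmetric_htpy[OF ident_closed[of U] gamma_closed[of V W]] totally_symmetric[of V W U]
      gamma_closed[of U "V \<otimes>\<^sub>0 W"]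
    by (simp add: comp21_rules(6)[where U="?X" and V="V \<otimes>\<^sub>0 W \<otimes>\<^sub>0 U"])
  then have "(\<gamma>\<langle>W \<otimes>\<^sub>0 V, U\<rangle> \<cdot>\<^sub>1\<^sub>1 \<gamma>\<langle>U, W \<otimes>\<^sub>0 V\<rangle>) \<cdot>\<^sub>1\<^sub>2 ?x = \<zero>\<^bsub>Cell2 C ?X ?X'\<^esub>"
    using assoc112[OF x g g'] g' by (simp add: comp12_rules(7)[where U="?X" and V="?Y'"])
  then show ?thesis
    using ident2[OF x] by (simp add: braid_involutive)
qed

text \<open>
  Expanding \<open>t\<close> at the two sides of \<open>t\<langle>V, U\<rangle> \<gamma> = \<gamma> t\<langle>U, V\<rangle>\<close> leaves one term each, since total symmetry
  kills the other. The same argument on the right gives \<open>Rt_swap23\<close>.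
\<close>

lemma Lt_swap12: "Lt V U W \<cdot>\<^sub>2\<^sub>1 swap12 U V W = swap12 U V W \<cdot>\<^sub>1\<^sub>2 Lt U V W"
proof -
  let ?X = "U \<otimes>\<^sub>0 (V \<otimes>\<^sub>0 W)" and ?Y = "V \<otimes>\<^sub>0 (U \<otimes>\<^sub>0 W)"
  interpret M: module K "Cell2 C ?X ?Y" by (rule module_Cell2)
  note ty = gamma_closed[of U V] t_closed[of U V] t_closed[of V U] ident_closed[of W]
  have zero: "t\<langle>\<gamma>\<langle>U, V\<rangle> \<boxtimes> \<one>\<^sub>1 W\<rangle> = \<zero>\<^bsub>Cell2 C ?X ?Y\<^esub>"
    using totally_symmetric[of U V W] by (simp add: tens_assoc0)
  have t1: "t\<langle>U, V\<rangle> \<otimes>\<^sub>1\<^sub>1 \<one>\<^sub>1 W \<in> carrier (Cell1 C ?X ?X)" "t\<langle>V, U\<rangle> \<otimes>\<^sub>1\<^sub>1 \<one>\<^sub>1 W \<in> carrier (Cell1 C ?Y ?Y)"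
    using tens11_closed[OF ty(2,4)] tens11_closed[OF ty(3,4)] by (simp_all add: tens_assoc0)
  note whiskered_closed(1)[of U V W] whiskered_closed(5)[of U V W] whiskered_closed(5)[of V U W]
  then have cl: "swap12 U V W \<cdot>\<^sub>1\<^sub>2 Lt U V W \<in> carrier (Cell2 C ?X ?Y)"
    "Lt V U W \<cdot>\<^sub>2\<^sub>1 swap12 U V W \<in> carrier (Cell2 C ?X ?Y)"
    by (blast intro: comp12_closed comp21_closed)+
  have "t\<langle>t\<langle>V, U\<rangle> \<cdot>\<^sub>1\<^sub>1 \<gamma>\<langle>U, V\<rangle> \<boxtimes> \<one>\<^sub>1 W \<cdot>\<^sub>1\<^sub>1 \<one>\<^sub>1 W\<rangle> = Lt V U W \<cdot>\<^sub>2\<^sub>1 swap12 U V W"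
    using t.pt_htpy_comp[OF ty(1,3,4,4)] t1 cl zero
    by (simp add: tens_assoc0 comp12_rules(7)[where U="?X" and V="?Y" and W="?Y"] flip: Lt_def swap12_def)
  moreover have "t\<langle>\<gamma>\<langle>U, V\<rangle> \<cdot>\<^sub>1\<^sub>1 t\<langle>U, V\<rangle> \<boxtimes> \<one>\<^sub>1 W \<cdot>\<^sub>1\<^sub>1 \<one>\<^sub>1 W\<rangle> = swap12 U V W \<cdot>\<^sub>1\<^sub>2 Lt U V W"
    using t.pt_htpy_comp[OF ty(2,1,4,4)] t1 cl zero
    by (simp add: tens_assoc0 comp21_rules(6)[where U="?X" and V="?X" and W="?Y"] flip: Lt_def swap12_def)
  ultimately show ?thesis
    by (simp add: symmetric)
qed

lemma Rt_swap23: "Rt U W V \<cdot>\<^sub>2\<^sub>1 swap23 U V W = swap23 U V W \<cdot>\<^sub>1\<^sub>2 Rt U V W"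
proof -
  let ?X = "U \<otimes>\<^sub>0 (V \<otimes>\<^sub>0 W)" and ?Y = "U \<otimes>\<^sub>0 (W \<otimes>\<^sub>0 V)"
  interpret M: module K "Cell2 C ?X ?Y" by (rule module_Cell2)
  note ty = gamma_closed[of V W] t_closed[of V W] t_closed[of W V] ident_closed[of U]
  note zero = totally_symmetric_right[of U V W]
  have t1: "\<one>\<^sub>1 U \<otimes>\<^sub>1\<^sub>1 t\<langle>V, W\<rangle> \<in> carrier (Cell1 C ?X ?X)" "\<one>\<^sub>1 U \<otimes>\<^sub>1\<^sub>1 t\<langle>W, V\<rangle> \<in> carrier (Cell1 C ?Y ?Y)"
    using tens11_closed[OF ty(4,2)] tens11_closed[OF ty(4,3)] by simp_all
  note whiskered_closed(2)[of U V W] whiskered_closed(6)[of U V W] whiskered_closed(6)[of U W V]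
  then have cl: "swap23 U V W \<cdot>\<^sub>1\<^sub>2 Rt U V W \<in> carrier (Cell2 C ?X ?Y)"
    "Rt U W V \<cdot>\<^sub>2\<^sub>1 swap23 U V W \<in> carrier (Cell2 C ?X ?Y)"
    by (blast intro: comp12_closed comp21_closed)+
  have "t\<langle>\<one>\<^sub>1 U \<cdot>\<^sub>1\<^sub>1 \<one>\<^sub>1 U \<boxtimes> t\<langle>W, V\<rangle> \<cdot>\<^sub>1\<^sub>1 \<gamma>\<langle>V, W\<rangle>\<rangle> = Rt U W V \<cdot>\<^sub>2\<^sub>1 swap23 U V W"
    using t.pt_htpy_comp[OF ty(4,4,1,3)] t1 cl zero
    by (simp add: comp12_rules(7)[where U="?X" and V="?Y" and W="?Y"] flip: Rt_def swap23_def)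
  moreover have "t\<langle>\<one>\<^sub>1 U \<cdot>\<^sub>1\<^sub>1 \<one>\<^sub>1 U \<boxtimes> \<gamma>\<langle>V, W\<rangle> \<cdot>\<^sub>1\<^sub>1 t\<langle>V, W\<rangle>\<rangle> = swap23 U V W \<cdot>\<^sub>1\<^sub>2 Rt U V W"
    using t.pt_htpy_comp[OF ty(4,4,2,1)] t1 cl zero
    by (simp add: comp21_rules(6)[where U="?X" and V="?X" and W="?Y"] flip: Rt_def swap23_def)
  ultimately show ?thesis
    by (simp add: symmetric)
qed

text \<open>
  \<open>\<gamma>\<langle>U, V \<otimes> W\<rangle>\<close> first swaps \<open>U, V\<close>, which coherence controls, and then \<open>U, W\<close>, which total symmetry controls.
\<close>

lemma Rt_gamma:
  "Rt V W U \<cdot>\<^sub>2\<^sub>1 \<gamma>\<langle>U, V \<otimes>\<^sub>0 W\<rangle> = \<ominus>\<^bsub>Cell2 C (U \<otimes>\<^sub>0 (V \<otimes>\<^sub>0 W)) (V \<otimes>\<^sub>0 (W \<otimes>\<^sub>0 U))\<^esub>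
    (\<gamma>\<langle>U, V \<otimes>\<^sub>0 W\<rangle> \<cdot>\<^sub>1\<^sub>2 (Lt U V W \<oplus>\<^bsub>Cell2 C (U \<otimes>\<^sub>0 (V \<otimes>\<^sub>0 W)) (U \<otimes>\<^sub>0 (V \<otimes>\<^sub>0 W))\<^esub> Rt U V W))"
proof -
  let ?X = "U \<otimes>\<^sub>0 (V \<otimes>\<^sub>0 W)"
  interpret M: module K "Cell2 C ?X ?X" by (rule module_Cell2)
  have coherent: "\<ominus>\<^bsub>Cell2 C ?X ?X\<^esub> (swap12 V U W \<cdot>\<^sub>1\<^sub>2 Rt V U W \<cdot>\<^sub>2\<^sub>1 swap12 U V W)
      = Lt U V W \<oplus>\<^bsub>Cell2 C ?X ?X\<^esub> Rt U V W"
    using coherent_left[of U V W] by (simp add: swap12_def Lt_def Rt_def tens_assoc0)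
  show ?thesis
    unfolding hexagon_right
    by (rule move_across[OF whiskered_closed(1) whiskered_closed(1) swap_inverse(1)
          whiskered_closed(2) whiskered_closed(6) whiskered_closed(6) _ Rt_swap23 coherent])
      (use whiskered_closed in simp)
qed

lemma Lt_gamma:
  "Lt W U V \<cdot>\<^sub>2\<^sub>1 \<gamma>\<langle>U \<otimes>\<^sub>0 V, W\<rangle> = \<ominus>\<^bsub>Cell2 C (U \<otimes>\<^sub>0 (V \<otimes>\<^sub>0 W)) (W \<otimes>\<^sub>0 (U \<otimes>\<^sub>0 V))\<^esub>
    (\<gamma>\<langle>U \<otimes>\<^sub>0 V, W\<rangle> \<cdot>\<^sub>1\<^sub>2 (Lt U V W \<oplus>\<^bsub>Cell2 C (U \<otimes>\<^sub>0 (V \<otimes>\<^sub>0 W)) (U \<otimes>\<^sub>0 (V \<otimes>\<^sub>0 W))\<^esub> Rt U V W))"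
proof -
  let ?X = "U \<otimes>\<^sub>0 (V \<otimes>\<^sub>0 W)"
  interpret M: module K "Cell2 C ?X ?X" by (rule module_Cell2)
  have coherent: "\<ominus>\<^bsub>Cell2 C ?X ?X\<^esub> (swap23 U W V \<cdot>\<^sub>1\<^sub>2 Lt U W V \<cdot>\<^sub>2\<^sub>1 swap23 U V W)
      = Lt U V W \<oplus>\<^bsub>Cell2 C ?X ?X\<^esub> Rt U V W"
    using coherent_right[of U V W] by (simp add: swap23_def Lt_def Rt_def tens_assoc0)
  show ?thesis
    unfolding hexagon_left
    by (rule move_across[OF whiskered_closed(2) whiskered_closed(2) swap_inverse(2)
          whiskered_closed(1) whiskered_closed(5) whiskered_closed(5) _ Lt_swap12 coherent])
      (use whiskered_closed in simp)
qed

lemma Lt_Rt_gamma: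
  "Lt V W U \<cdot>\<^sub>2\<^sub>1 \<gamma>\<langle>U, V \<otimes>\<^sub>0 W\<rangle> = \<gamma>\<langle>U, V \<otimes>\<^sub>0 W\<rangle> \<cdot>\<^sub>1\<^sub>2 Rt U V W"
  "Rt W U V \<cdot>\<^sub>2\<^sub>1 \<gamma>\<langle>U \<otimes>\<^sub>0 V, W\<rangle> = \<gamma>\<langle>U \<otimes>\<^sub>0 V, W\<rangle> \<cdot>\<^sub>1\<^sub>2 Lt U V W"
  using symmetric_htpy[OF ident_closed[of U] t_closed[of V W]]
    symmetric_htpy[OF t_closed[of U V] ident_closed[of W]]
  by (simp_all add: Lt_def Rt_def)

end


section \<open>The hexagon axioms of the syllepsis\<close>

context extended_category
begin

lemma whisker_right:
  assumes "s0 \<in> carrier (Cell1 C U V)" "s1 \<in> carrier (Cell1 C U V)" "s2 \<in> carrier (Cell1 C U V)"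
  shows "(s0, s1, s2) \<otimes>\<^sub>1\<^sub>1\<^bsub>D\<^esub> \<one>\<^sub>1\<^bsub>D\<^esub> W = (s0 \<otimes>\<^sub>1\<^sub>1 \<one>\<^sub>1 W, s1 \<otimes>\<^sub>1\<^sub>1 \<one>\<^sub>1 W, s2 \<otimes>\<^sub>1\<^sub>1 \<one>\<^sub>1 W)"
proof -
  interpret M: module K "Cell1 C (U \<otimes>\<^sub>0 W) (V \<otimes>\<^sub>0 W)" by (rule module_Cell1)
  show ?thesis
    using assms ident_closed[of W] by (simp add: hident htens11[of _ U V _ W W] hext_triple
        tens11_rules[where U=U and U'=V and V=W and V'=W])
qed

lemma whisker_left:
  assumes "s0 \<in> carrier (Cell1 C U V)" "s1 \<in> carrier (Cell1 C U V)" "s2 \<in> carrier (Cell1 C U V)"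
  shows "\<one>\<^sub>1\<^bsub>D\<^esub> W \<otimes>\<^sub>1\<^sub>1\<^bsub>D\<^esub> (s0, s1, s2) = (\<one>\<^sub>1 W \<otimes>\<^sub>1\<^sub>1 s0, \<one>\<^sub>1 W \<otimes>\<^sub>1\<^sub>1 s1, \<one>\<^sub>1 W \<otimes>\<^sub>1\<^sub>1 s2)"
proof -
  interpret M: module K "Cell1 C (W \<otimes>\<^sub>0 U) (W \<otimes>\<^sub>0 V)" by (rule module_Cell1)
  show ?thesis
    using assms ident_closed[of W] by (simp add: hident htens11[of _ W W _ U V] hext_triple
        tens11_rules[where U=W and U'=W and V=U and V'=V])
qed

lemma whisker2_right:
  assumes "\<phi> \<in> carrier (Cell2 C U V)"
  shows "(\<zero>\<^bsub>Cell2 C U V\<^esub>, \<phi>, \<zero>\<^bsub>Cell2 C U V\<^esub>) \<otimes>\<^sub>2\<^sub>1\<^bsub>D\<^esub> \<one>\<^sub>1\<^bsub>D\<^esub> W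
    = (\<zero>\<^bsub>Cell2 C (U \<otimes>\<^sub>0 W) (V \<otimes>\<^sub>0 W)\<^esub>, \<phi> \<otimes>\<^sub>2\<^sub>1 \<one>\<^sub>1 W, \<zero>\<^bsub>Cell2 C (U \<otimes>\<^sub>0 W) (V \<otimes>\<^sub>0 W)\<^esub>)"
proof -
  interpret M: module K "Cell2 C (U \<otimes>\<^sub>0 W) (V \<otimes>\<^sub>0 W)" by (rule module_Cell2)
  show ?thesis
    using assms ident_closed[of W] by (simp add: hident htens21[of _ U V _ W W] hext_triple
        tens21_rules[where U=U and U'=V and V=W and V'=W])
qed

lemma whisker2_left:
  assumes "\<phi> \<in> carrier (Cell2 C U V)"
  shows "\<one>\<^sub>1\<^bsub>D\<^esub> W \<otimes>\<^sub>1\<^sub>2\<^bsub>D\<^esub> (\<zero>\<^bsub>Cell2 C U V\<^esub>, \<phi>, \<zero>\<^bsub>Cell2 C U V\<^esub>)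
    = (\<zero>\<^bsub>Cell2 C (W \<otimes>\<^sub>0 U) (W \<otimes>\<^sub>0 V)\<^esub>, \<one>\<^sub>1 W \<otimes>\<^sub>1\<^sub>2 \<phi>, \<zero>\<^bsub>Cell2 C (W \<otimes>\<^sub>0 U) (W \<otimes>\<^sub>0 V)\<^esub>)"
proof -
  interpret M: module K "Cell2 C (W \<otimes>\<^sub>0 U) (W \<otimes>\<^sub>0 V)" by (rule module_Cell2)
  show ?thesis
    using assms ident_closed[of W] by (simp add: hident htens12[of _ W W _ U V] hext_triple
        tens12_rules[where U=W and U'=W and V=U and V'=V])
qed

lemma inv1_unipotent:
  assumes a: "a \<in> carrier (Cell1 C X X)"
  shows "inverse1 D (\<one>\<^sub>1 X, \<zero>\<^bsub>Cell1 C X X\<^esub>, a) (inv1 D (\<one>\<^sub>1 X, \<zero>\<^bsub>Cell1 C X X\<^esub>, a))"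
    and "inv1 D (\<one>\<^sub>1 X, \<zero>\<^bsub>Cell1 C X X\<^esub>, a) = (\<one>\<^sub>1 X, \<zero>\<^bsub>Cell1 C X X\<^esub>, \<ominus>\<^bsub>Cell1 C X X\<^esub> a)"
proof -
  interpret M: module K "Cell1 C X X" by (rule module_Cell1)
  let ?x = "(\<one>\<^sub>1 X, \<zero>\<^bsub>Cell1 C X X\<^esub>, a)"
  have x: "?x \<in> carrier (Cell1 D X X)"
    using a ident_closed by simp
  have one: "fst ?x \<cdot>\<^sub>1\<^sub>1 \<one>\<^sub>1 X = \<one>\<^sub>1 X" "\<one>\<^sub>1 X \<cdot>\<^sub>1\<^sub>1 fst ?x = \<one>\<^sub>1 X"
    using ident11[OF ident_closed[of X]] by simp_all
  show "inverse1 D ?x (inv1 D ?x)"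
    by (rule hinverse_exists[OF x ident_closed one])
  show "inv1 D ?x = (\<one>\<^sub>1 X, \<zero>\<^bsub>Cell1 C X X\<^esub>, \<ominus>\<^bsub>Cell1 C X X\<^esub> a)"
  proof (rule hinv1_unique[OF x ident_closed one])
    show "?x \<cdot>\<^sub>1\<^sub>1\<^bsub>D\<^esub> (\<one>\<^sub>1 X, \<zero>\<^bsub>Cell1 C X X\<^esub>, \<ominus>\<^bsub>Cell1 C X X\<^esub> a) = \<one>\<^sub>1\<^bsub>D\<^esub> X"
      using a ident_closed[of X] ident11
      by (simp add: hcomp11[of _ X X _ X] hext_triple comp11_rules[where U=X and V=X and W=X] hident M.M.l_neg)
  qed (use a ident_closed in simp)
qed

text \<open>
  Both hexagon axioms have this form. Here \<open>B\<close> and \<open>A\<close> are the whiskered \<open>\<gamma> T\<close> of the first and the second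
  elementary braiding \<open>P\<close> and \<open>Q\<close>, the \<open>h\<close>-coefficients of \<open>\<sigma>\<close> and \<open>\<sigma>\<inverse>\<close> being \<open>r \<partial>B\<close> and \<open>-r \<partial>A\<close> with
  \<open>r = 1/2\<close>. In degree \<open>h\<^sup>2\<close> the contributions \<open>r (\<partial>A) B\<close> and \<open>-r A (\<partial>B)\<close> cancel. The coefficients \<open>aX\<close>,
  \<open>aY\<close>, \<open>aZ\<close> of the associators and \<open>p2\<close>, \<open>q2\<close> only meet multiples of \<open>h\<close>, and \<open>H\<close> is the component shared by \<open>HL\<close> and
  \<open>HR\<inverse>\<close>, or by \<open>HR\<close> and \<open>HL\<inverse>\<close>.
\<close>

lemma hexagon_expansion:
  assumes a: "aX \<in> carrier (Cell1 C X X)" "aY \<in> carrier (Cell1 C Y Y)" "aZ \<in> carrier (Cell1 C Z Z)"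
    and P: "P \<in> carrier (Cell1 C X Z)" "p2 \<in> carrier (Cell1 C X Z)"
    and Q: "Q \<in> carrier (Cell1 C Z Y)" "q2 \<in> carrier (Cell1 C Z Y)"
    and A: "A \<in> carrier (Cell2 C Z Y)" and B: "B \<in> carrier (Cell2 C X Z)"
    and H: "H \<in> carrier (Cell2 C X Y)" and r: "r \<in> carrier K"
  shows "(\<zero>\<^bsub>Cell2 C X Y\<^esub>, \<zero>\<^bsub>Cell2 C X Y\<^esub>, H)
    = (\<one>\<^sub>1 Y, \<zero>\<^bsub>Cell1 C Y Y\<^esub>, aY) \<cdot>\<^sub>1\<^sub>2\<^bsub>D\<^esub>
        (\<zero>\<^bsub>Cell2 C X Y\<^esub>, Q \<cdot>\<^sub>1\<^sub>2 B \<oplus>\<^bsub>Cell2 C X Y\<^esub> A \<cdot>\<^sub>2\<^sub>1 P, \<zero>\<^bsub>Cell2 C X Y\<^esub>) \<cdot>\<^sub>2\<^sub>1\<^bsub>D\<^esub>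
        (\<one>\<^sub>1 X, \<zero>\<^bsub>Cell1 C X X\<^esub>, aX)
      \<oplus>\<^bsub>Cell2 D X Y\<^esub> (\<zero>\<^bsub>Cell2 C X Y\<^esub>, \<zero>\<^bsub>Cell2 C X Y\<^esub>, H)
      \<ominus>\<^bsub>Cell2 D X Y\<^esub> (Q, \<ominus>\<^bsub>Cell1 C Z Y\<^esub> (r \<odot>\<^bsub>Cell1 C Z Y\<^esub> (\<partial> A)), q2) \<cdot>\<^sub>1\<^sub>1\<^bsub>D\<^esub>
        (\<one>\<^sub>1 Z, \<zero>\<^bsub>Cell1 C Z Z\<^esub>, aZ) \<cdot>\<^sub>1\<^sub>2\<^bsub>D\<^esub> (\<zero>\<^bsub>Cell2 C X Z\<^esub>, B, \<zero>\<^bsub>Cell2 C X Z\<^esub>)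
      \<ominus>\<^bsub>Cell2 D X Y\<^esub> (\<zero>\<^bsub>Cell2 C Z Y\<^esub>, A, \<zero>\<^bsub>Cell2 C Z Y\<^esub>) \<cdot>\<^sub>2\<^sub>1\<^bsub>D\<^esub>
        (\<one>\<^sub>1 Z, \<zero>\<^bsub>Cell1 C Z Z\<^esub>, aZ) \<cdot>\<^sub>2\<^sub>1\<^bsub>D\<^esub> (P, r \<odot>\<^bsub>Cell1 C X Z\<^esub> (\<partial> B), p2)"
proof -
  interpret XY: module K "Cell2 C X Y" by (rule module_Cell2)
  interpret ZY: module K "Cell2 C Z Y" by (rule module_Cell2)
  interpret ZY1: module K "Cell1 C Z Y" by (rule module_Cell1)
  interpret XZ1: module K "Cell1 C X Z" by (rule module_Cell1)
  note dA = bdry_closed[OF A] and dB = bdry_closed[OF B]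
  let ?S = "Q \<cdot>\<^sub>1\<^sub>2 B \<oplus>\<^bsub>Cell2 C X Y\<^esub> A \<cdot>\<^sub>2\<^sub>1 P"
  let ?dA = "\<ominus>\<^bsub>Cell1 C Z Y\<^esub> (r \<odot>\<^bsub>Cell1 C Z Y\<^esub> (\<partial> A))" and ?dB = "r \<odot>\<^bsub>Cell1 C X Z\<^esub> (\<partial> B)"
  note QB = comp12_closed[OF Q(1) B] and AP = comp21_closed[OF A P(1)]
    and AdB = comp21_closed[OF A dB]
  have S: "?S \<in> carrier (Cell2 C X Y)"
    using QB AP by simp
  have dA': "?dA \<in> carrier (Cell1 C Z Y)" and dB': "?dB \<in> carrier (Cell1 C X Z)"
    using dA dB r by simp_all
  have one: "(\<one>\<^sub>1 Y, \<zero>\<^bsub>Cell1 C Y Y\<^esub>, aY) \<cdot>\<^sub>1\<^sub>2\<^bsub>D\<^esub> (\<zero>\<^bsub>Cell2 C X Y\<^esub>, ?S, \<zero>\<^bsub>Cell2 C X Y\<^esub>) \<cdot>\<^sub>2\<^sub>1\<^bsub>D\<^esub>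
        (\<one>\<^sub>1 X, \<zero>\<^bsub>Cell1 C X X\<^esub>, aX) = (\<zero>\<^bsub>Cell2 C X Y\<^esub>, ?S, \<zero>\<^bsub>Cell2 C X Y\<^esub>)"
    using a S ident_closed ident2[OF S]
    by (simp add: hcomp12[of _ X Y _ Y] hcomp21[of _ X X _ Y] hext_triple
        comp12_rules(6,7)[where U=X and V=Y and W=Y] comp21_rules(6,7)[where U=X and V=X and W=Y])
  have "(Q, ?dA, q2) \<cdot>\<^sub>1\<^sub>1\<^bsub>D\<^esub> (\<one>\<^sub>1 Z, \<zero>\<^bsub>Cell1 C Z Z\<^esub>, aZ)
      = (Q, ?dA, Q \<cdot>\<^sub>1\<^sub>1 aZ \<oplus>\<^bsub>Cell1 C Z Y\<^esub> q2)"
    using a Q dA' ident_closed ident11[OF Q(1)] ident11[OF Q(2)] ident11[OF dA'] comp11_closed[OF Q(1) a(3)]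
    by (simp add: hcomp11[of _ Z Z _ Y] hext_triple comp11_rules(6,7)[where U=Z and V=Z and W=Y])
  then have two: "(Q, ?dA, q2) \<cdot>\<^sub>1\<^sub>1\<^bsub>D\<^esub> (\<one>\<^sub>1 Z, \<zero>\<^bsub>Cell1 C Z Z\<^esub>, aZ) \<cdot>\<^sub>1\<^sub>2\<^bsub>D\<^esub>
        (\<zero>\<^bsub>Cell2 C X Z\<^esub>, B, \<zero>\<^bsub>Cell2 C X Z\<^esub>)
      = (\<zero>\<^bsub>Cell2 C X Y\<^esub>, Q \<cdot>\<^sub>1\<^sub>2 B, \<ominus>\<^bsub>Cell2 C X Y\<^esub> (r \<odot>\<^bsub>Cell2 C X Y\<^esub> (A \<cdot>\<^sub>2\<^sub>1 \<partial> B)))"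
    using a Q B dA dA' r QB AdB comp11_closed[OF Q(1) a(3)] bdry_truncated[OF B A]
    by (simp add: hcomp12[of _ X Z _ Y] hext_triple
        comp12_rules(4,6,7,8)[where U=X and V=Z and W=Y])
  have "(\<zero>\<^bsub>Cell2 C Z Y\<^esub>, A, \<zero>\<^bsub>Cell2 C Z Y\<^esub>) \<cdot>\<^sub>2\<^sub>1\<^bsub>D\<^esub> (\<one>\<^sub>1 Z, \<zero>\<^bsub>Cell1 C Z Z\<^esub>, aZ)
      = (\<zero>\<^bsub>Cell2 C Z Y\<^esub>, A, \<zero>\<^bsub>Cell2 C Z Y\<^esub>)"
    using a A ident_closed ident2[OF A]
    by (simp add: hcomp21[of _ Z Z _ Y] hext_triple comp21_rules(6,7)[where U=Z and V=Z and W=Y])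
  then have three: "(\<zero>\<^bsub>Cell2 C Z Y\<^esub>, A, \<zero>\<^bsub>Cell2 C Z Y\<^esub>) \<cdot>\<^sub>2\<^sub>1\<^bsub>D\<^esub>
        (\<one>\<^sub>1 Z, \<zero>\<^bsub>Cell1 C Z Z\<^esub>, aZ) \<cdot>\<^sub>2\<^sub>1\<^bsub>D\<^esub> (P, ?dB, p2)
      = (\<zero>\<^bsub>Cell2 C X Y\<^esub>, A \<cdot>\<^sub>2\<^sub>1 P, r \<odot>\<^bsub>Cell2 C X Y\<^esub> (A \<cdot>\<^sub>2\<^sub>1 \<partial> B))"
    using A P dB dB' r AP AdB
    by (simp add: hcomp21[of _ X Z _ Y] hext_triple comp21_rules(5,6,7)[where U=X and V=Z and W=Y])
  have "?S \<ominus>\<^bsub>Cell2 C X Y\<^esub> Q \<cdot>\<^sub>1\<^sub>2 B \<ominus>\<^bsub>Cell2 C X Y\<^esub> A \<cdot>\<^sub>2\<^sub>1 P = \<zero>\<^bsub>Cell2 C X Y\<^esub>"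
    using QB AP XY.M.r_neg[OF S] by (simp add: a_minus_def XY.M.minus_add XY.M.a_assoc)
  then show ?thesis
    unfolding one two three
    using QB AP AdB S H r
    by (simp add: hmodule_minus[OF group_Cell2])
      (simp add: a_minus_def XY.M.minus_minus XY.M.a_assoc XY.M.r_neg)
qed

lemma mod_inv_top:
  assumes x: "x \<in> carrier (Cell1 D X Y)" "fst x = g" and x': "x' \<in> carrier (Cell1 D X Y)" "fst x' = g"
    and g: "g \<in> carrier (Cell1 C X Y)" "g' \<in> carrier (Cell1 C Y X)"
    and inv: "g \<cdot>\<^sub>1\<^sub>1 g' = \<one>\<^sub>1 Y" "g' \<cdot>\<^sub>1\<^sub>1 g = \<one>\<^sub>1 X"
    and \<xi>: "\<xi> \<in> carrier (Cell2 C X X)" and r: "r \<in> carrier K"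
  shows "mod_inv D X Y x x' (\<zero>\<^bsub>Cell2 C X Y\<^esub>, \<zero>\<^bsub>Cell2 C X Y\<^esub>, r \<odot>\<^bsub>Cell2 C X Y\<^esub> (g \<cdot>\<^sub>1\<^sub>2 \<xi>))
    = (\<zero>\<^bsub>Cell2 C Y X\<^esub>, \<zero>\<^bsub>Cell2 C Y X\<^esub>, r \<odot>\<^bsub>Cell2 C Y X\<^esub> (\<ominus>\<^bsub>Cell2 C Y X\<^esub> (\<xi> \<cdot>\<^sub>2\<^sub>1 g')))"
proof -
  interpret XY: module K "Cell2 C X Y" by (rule module_Cell2)
  interpret XX: module K "Cell2 C X X" by (rule module_Cell2)
  interpret YX: module K "Cell2 C Y X" by (rule module_Cell2)
  have "inv1 D x \<in> carrier (Cell1 D Y X)" "fst (inv1 D x) = g'"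
    using hinv1_closed[OF x(1) g(2)] fst_hinv1[OF x(1) g(2)] x(2) inv by auto
  then obtain y1 y2 where y: "inv1 D x = (g', y1, y2)"
    and y_closed: "y1 \<in> carrier (Cell1 C Y X)" "y2 \<in> carrier (Cell1 C Y X)"
    by (cases "inv1 D x") auto
  have "inv1 D x' \<in> carrier (Cell1 D Y X)" "fst (inv1 D x') = g'"
    using hinv1_closed[OF x'(1) g(2)] fst_hinv1[OF x'(1) g(2)] x'(2) inv by auto
  then obtain y1' y2' where y': "inv1 D x' = (g', y1', y2')"
    and y'_closed: "y1' \<in> carrier (Cell1 C Y X)" "y2' \<in> carrier (Cell1 C Y X)"
    by (cases "inv1 D x'") auto
  have "g' \<cdot>\<^sub>1\<^sub>2 (g \<cdot>\<^sub>1\<^sub>2 \<xi>) = \<xi>"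
    using assoc112[OF \<xi> g] ident2[OF \<xi>] by (simp add: inv)
  then show ?thesis
    using y_closed y'_closed \<xi> g r comp12_closed[OF g(1) \<xi>] comp21_closed[OF \<xi> g(2)]
    by (simp add: mod_inv_def y y' hcomp12[of _ X Y _ X] hcomp21[of _ Y X _ X] hext_triple
        comp12_rules[where U=X and V=Y and W=X] comp21_rules[where U=Y and V=X and W=X] hmodule_neg[OF group_Cell2]
        YX.smult_r_minus)
qed

end

context deformation
begin

lemma alpha_cell:
  obtains a where "a \<in> carrier (Cell1 C (U \<otimes>\<^sub>0 (V \<otimes>\<^sub>0 W)) (U \<otimes>\<^sub>0 (V \<otimes>\<^sub>0 W)))"
    "alpha K C t U V W = (\<one>\<^sub>1 (U \<otimes>\<^sub>0 (V \<otimes>\<^sub>0 W)),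
       \<zero>\<^bsub>Cell1 C (U \<otimes>\<^sub>0 (V \<otimes>\<^sub>0 W)) (U \<otimes>\<^sub>0 (V \<otimes>\<^sub>0 W))\<^esub>, a)"
proof -
  let ?X = "U \<otimes>\<^sub>0 (V \<otimes>\<^sub>0 W)"
  interpret M: module K "Cell1 C ?X ?X" by (rule module_Cell1)
  interpret H: abelian_group "hmodule (Cell1 C ?X ?X)"
    by (rule abelian_group_hmodule) (rule M.M.abelian_group_axioms)
  have th: "(t_h C t)\<langle>U, V\<rangle> \<in> carrier (Cell1 D (U \<otimes>\<^sub>0 V) (U \<otimes>\<^sub>0 V))" for U V
    using t_closed by (simp add: t_h_cell)
  have ts: "t12 C t U V W \<in> carrier (Cell1 D ?X ?X)" "t23 C t U V W \<in> carrier (Cell1 D ?X ?X)"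
    unfolding t12_def t23_def
    using htens11_closed[OF th[of U V] hident_closed[of W]] htens11_closed[OF hident_closed[of U] th[of V W]]
    by (simp_all add: tens_assoc0)
  let ?c = "t12 C t U V W \<cdot>\<^sub>1\<^sub>1\<^bsub>D\<^esub> t23 C t U V W \<ominus>\<^bsub>hmodule (Cell1 C ?X ?X)\<^esub>
    t23 C t U V W \<cdot>\<^sub>1\<^sub>1\<^bsub>D\<^esub> t12 C t U V W"
  have "?c \<in> carrier (hmodule (Cell1 C ?X ?X))"
    using hcomp11_closed[OF ts(1) ts(2)] hcomp11_closed[OF ts(2) ts(1)]
    by (simp add: a_minus_def)
  then obtain c0 c1 c2 where c: "?c = (c0, c1, c2)" and cc: "c0 \<in> carrier (Cell1 C ?X ?X)"
    "c1 \<in> carrier (Cell1 C ?X ?X)" "c2 \<in> carrier (Cell1 C ?X ?X)"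
    by (rule hmodule_carrierE)
  show thesis
  proof (rule that)
    show "recip 24 \<odot>\<^bsub>Cell1 C ?X ?X\<^esub> c0 \<in> carrier (Cell1 C ?X ?X)"
      using cc recip_closed[of 24] by simp
    show "alpha K C t U V W = (\<one>\<^sub>1 ?X, \<zero>\<^bsub>Cell1 C ?X ?X\<^esub>, recip 24 \<odot>\<^bsub>Cell1 C ?X ?X\<^esub> c0)"
      using cc recip_closed[of 24] ident_closed
      by (simp add: alpha_def Let_def tens_assoc0 c hident hmodule_smult_h[OF M.module_axioms])
  qed
qed

lemma alpha_inv_cell:
  obtains a where "a \<in> carrier (Cell1 C (U \<otimes>\<^sub>0 (V \<otimes>\<^sub>0 W)) (U \<otimes>\<^sub>0 (V \<otimes>\<^sub>0 W)))"
    "inv1 D (alpha K C t U V W) = (\<one>\<^sub>1 (U \<otimes>\<^sub>0 (V \<otimes>\<^sub>0 W)),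
       \<zero>\<^bsub>Cell1 C (U \<otimes>\<^sub>0 (V \<otimes>\<^sub>0 W)) (U \<otimes>\<^sub>0 (V \<otimes>\<^sub>0 W))\<^esub>, a)"
proof -
  let ?X = "U \<otimes>\<^sub>0 (V \<otimes>\<^sub>0 W)"
  interpret M: module K "Cell1 C ?X ?X" by (rule module_Cell1)
  obtain a where a: "a \<in> carrier (Cell1 C ?X ?X)"
    "alpha K C t U V W = (\<one>\<^sub>1 ?X, \<zero>\<^bsub>Cell1 C ?X ?X\<^esub>, a)"
    by (rule alpha_cell)
  show thesis
    by (rule that[of "\<ominus>\<^bsub>Cell1 C ?X ?X\<^esub> a"]) (use a inv1_unipotent(2)[OF a(1)] in simp_all)
qed

lemma alpha_closed:
  "alpha K C t U V W \<in> carrier (Cell1 D (U \<otimes>\<^sub>0 (V \<otimes>\<^sub>0 W)) (U \<otimes>\<^sub>0 (V \<otimes>\<^sub>0 W)))"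
  "inv1 D (alpha K C t U V W) \<in> carrier (Cell1 D (U \<otimes>\<^sub>0 (V \<otimes>\<^sub>0 W)) (U \<otimes>\<^sub>0 (V \<otimes>\<^sub>0 W)))"
  "fst (alpha K C t U V W) = \<one>\<^sub>1 (U \<otimes>\<^sub>0 (V \<otimes>\<^sub>0 W))"
  "fst (inv1 D (alpha K C t U V W)) = \<one>\<^sub>1 (U \<otimes>\<^sub>0 (V \<otimes>\<^sub>0 W))"
  by (rule alpha_cell[of U V W], simp add: ident_closed,
      rule alpha_inv_cell[of U V W], simp add: ident_closed,
      rule alpha_cell[of U V W], simp,
      rule alpha_inv_cell[of U V W], simp)

lemma alpha_inverse:
  "invertible1 D (U \<otimes>\<^sub>0 (V \<otimes>\<^sub>0 W)) (U \<otimes>\<^sub>0 (V \<otimes>\<^sub>0 W)) (alpha K C t U V W)"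
proof -
  let ?X = "U \<otimes>\<^sub>0 (V \<otimes>\<^sub>0 W)"
  obtain a where a: "a \<in> carrier (Cell1 C ?X ?X)"
    "alpha K C t U V W = (\<one>\<^sub>1 ?X, \<zero>\<^bsub>Cell1 C ?X ?X\<^esub>, a)"
    by (rule alpha_cell)
  show ?thesis
    unfolding invertible1_def using alpha_closed(1)[of U V W] inv1_unipotent(1)[OF a(1)]
    unfolding a(2) by blast
qed

lemma left_right_t_cell:
  "left_t C t U V W = (Lt U V W, \<zero>\<^bsub>Cell2 C (U \<otimes>\<^sub>0 (V \<otimes>\<^sub>0 W)) (U \<otimes>\<^sub>0 (V \<otimes>\<^sub>0 W))\<^esub>,
     \<zero>\<^bsub>Cell2 C (U \<otimes>\<^sub>0 (V \<otimes>\<^sub>0 W)) (U \<otimes>\<^sub>0 (V \<otimes>\<^sub>0 W))\<^esub>)"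
  "right_t C t U V W = (Rt U V W, \<zero>\<^bsub>Cell2 C (U \<otimes>\<^sub>0 (V \<otimes>\<^sub>0 W)) (U \<otimes>\<^sub>0 (V \<otimes>\<^sub>0 W))\<^esub>,
     \<zero>\<^bsub>Cell2 C (U \<otimes>\<^sub>0 (V \<otimes>\<^sub>0 W)) (U \<otimes>\<^sub>0 (V \<otimes>\<^sub>0 W))\<^esub>)"
proof -
  let ?X = "U \<otimes>\<^sub>0 (V \<otimes>\<^sub>0 W)"
  interpret M: module K "Cell2 C ?X ?X" by (rule module_Cell2)
  note ty = t_closed[of U V] t_closed[of V W] ident_closed[of U] ident_closed[of W]
  show "left_t C t U V W = (Lt U V W, \<zero>\<^bsub>Cell2 C ?X ?X\<^esub>, \<zero>\<^bsub>Cell2 C ?X ?X\<^esub>)"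
    using ty by (simp add: left_t_def t_h_cell hident t_h_htpy[of _ "U \<otimes>\<^sub>0 V" "U \<otimes>\<^sub>0 V" _ W W]
        hext_triple t_htpy_rules[where U="U \<otimes>\<^sub>0 V" and U'="U \<otimes>\<^sub>0 V" and V=W and V'=W] tens_assoc0 flip: Lt_def)
  show "right_t C t U V W = (Rt U V W, \<zero>\<^bsub>Cell2 C ?X ?X\<^esub>, \<zero>\<^bsub>Cell2 C ?X ?X\<^esub>)"
    using ty by (simp add: right_t_def t_h_cell hident t_h_htpy[of _ U U _ "V \<otimes>\<^sub>0 W" "V \<otimes>\<^sub>0 W"]
        hext_triple t_htpy_rules[where U=U and U'=U and V="V \<otimes>\<^sub>0 W" and V'="V \<otimes>\<^sub>0 W"] flip: Rt_def)
qed

lemma gamma3_closed: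
  "\<gamma>\<langle>U, V \<otimes>\<^sub>0 W\<rangle> \<in> carrier (Cell1 C (U \<otimes>\<^sub>0 (V \<otimes>\<^sub>0 W)) (V \<otimes>\<^sub>0 (W \<otimes>\<^sub>0 U)))"
  "\<gamma>\<langle>U \<otimes>\<^sub>0 V, W\<rangle> \<in> carrier (Cell1 C (U \<otimes>\<^sub>0 (V \<otimes>\<^sub>0 W)) (W \<otimes>\<^sub>0 (U \<otimes>\<^sub>0 V)))"
  using gamma_closed[of U "V \<otimes>\<^sub>0 W"] gamma_closed[of "U \<otimes>\<^sub>0 V" W] by (simp_all add: tens_assoc0)

lemma hex_cell:
  "hexL K C \<gamma> t U V W
      = (\<zero>\<^bsub>Cell2 C (U \<otimes>\<^sub>0 (V \<otimes>\<^sub>0 W)) (V \<otimes>\<^sub>0 (W \<otimes>\<^sub>0 U))\<^esub>, \<zero>\<^bsub>Cell2 C (U \<otimes>\<^sub>0 (V \<otimes>\<^sub>0 W)) (V \<otimes>\<^sub>0 (W \<otimes>\<^sub>0 U))\<^esub>,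
         recip 24 \<odot>\<^bsub>Cell2 C (U \<otimes>\<^sub>0 (V \<otimes>\<^sub>0 W)) (V \<otimes>\<^sub>0 (W \<otimes>\<^sub>0 U))\<^esub> (\<gamma>\<langle>U, V \<otimes>\<^sub>0 W\<rangle> \<cdot>\<^sub>1\<^sub>2
           (Lt U V W \<oplus>\<^bsub>Cell2 C (U \<otimes>\<^sub>0 (V \<otimes>\<^sub>0 W)) (U \<otimes>\<^sub>0 (V \<otimes>\<^sub>0 W))\<^esub> Lt U V W
             \<oplus>\<^bsub>Cell2 C (U \<otimes>\<^sub>0 (V \<otimes>\<^sub>0 W)) (U \<otimes>\<^sub>0 (V \<otimes>\<^sub>0 W))\<^esub> Rt U V W)))"
  "hexR K C \<gamma> t U V W
      = (\<zero>\<^bsub>Cell2 C (U \<otimes>\<^sub>0 (V \<otimes>\<^sub>0 W)) (W \<otimes>\<^sub>0 (U \<otimes>\<^sub>0 V))\<^esub>, \<zero>\<^bsub>Cell2 C (U \<otimes>\<^sub>0 (V \<otimes>\<^sub>0 W)) (W \<otimes>\<^sub>0 (U \<otimes>\<^sub>0 V))\<^esub>,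
         recip 24 \<odot>\<^bsub>Cell2 C (U \<otimes>\<^sub>0 (V \<otimes>\<^sub>0 W)) (W \<otimes>\<^sub>0 (U \<otimes>\<^sub>0 V))\<^esub> (\<gamma>\<langle>U \<otimes>\<^sub>0 V, W\<rangle> \<cdot>\<^sub>1\<^sub>2
           (Lt U V W \<oplus>\<^bsub>Cell2 C (U \<otimes>\<^sub>0 (V \<otimes>\<^sub>0 W)) (U \<otimes>\<^sub>0 (V \<otimes>\<^sub>0 W))\<^esub> Rt U V W
             \<oplus>\<^bsub>Cell2 C (U \<otimes>\<^sub>0 (V \<otimes>\<^sub>0 W)) (U \<otimes>\<^sub>0 (V \<otimes>\<^sub>0 W))\<^esub> Rt U V W)))"
proof -
  let ?X = "U \<otimes>\<^sub>0 (V \<otimes>\<^sub>0 W)" and ?Y = "V \<otimes>\<^sub>0 (W \<otimes>\<^sub>0 U)" and ?Z = "W \<otimes>\<^sub>0 (U \<otimes>\<^sub>0 V)"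
  interpret M: module K "Cell2 C ?X ?X" by (rule module_Cell2)
  interpret L: module K "Cell2 C ?X ?Y" by (rule module_Cell2)
  interpret R: module K "Cell2 C ?X ?Z" by (rule module_Cell2)
  note ty = whiskered_closed(5,6)[of U V W] gamma3_closed[of U V W]
    recip_closed[of 24]
  show "hexL K C \<gamma> t U V W
      = (\<zero>\<^bsub>Cell2 C ?X ?Y\<^esub>, \<zero>\<^bsub>Cell2 C ?X ?Y\<^esub>,
         recip 24 \<odot>\<^bsub>Cell2 C ?X ?Y\<^esub> (\<gamma>\<langle>U, V \<otimes>\<^sub>0 W\<rangle> \<cdot>\<^sub>1\<^sub>2
           (Lt U V W \<oplus>\<^bsub>Cell2 C ?X ?X\<^esub> Lt U V W
             \<oplus>\<^bsub>Cell2 C ?X ?X\<^esub> Rt U V W)))"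
    unfolding hexL_def Let_def left_right_t_cell gamma_h_cell
    using ty comp12_closed[OF ty(3), of _ "?X"]
    by (simp add: tens_assoc0 hcomp12[of _ "?X" "?X" _ "?Y"] hext_triple
        hmodule_smult_h[OF L.module_axioms] comp12_rules(1,6,7)[where U="?X" and V="?X" and W="?Y"])
  show "hexR K C \<gamma> t U V W
      = (\<zero>\<^bsub>Cell2 C ?X ?Z\<^esub>, \<zero>\<^bsub>Cell2 C ?X ?Z\<^esub>,
         recip 24 \<odot>\<^bsub>Cell2 C ?X ?Z\<^esub> (\<gamma>\<langle>U \<otimes>\<^sub>0 V, W\<rangle> \<cdot>\<^sub>1\<^sub>2
           (Lt U V W \<oplus>\<^bsub>Cell2 C ?X ?X\<^esub> Rt U V W
             \<oplus>\<^bsub>Cell2 C ?X ?X\<^esub> Rt U V W)))"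
    unfolding hexR_def Let_def left_right_t_cell gamma_h_cell
    using ty comp12_closed[OF ty(4), of _ "?X"]
    by (simp add: tens_assoc0 hcomp12[of _ "?X" "?X" _ "?Z"] hext_triple
        hmodule_smult_h[OF R.module_axioms] comp12_rules(1,6,7)[where U="?X" and V="?X" and W="?Z"])
qed

text \<open>
  \<open>(\<L> + 2\<R>) \<gamma> = \<gamma> (\<R> - 2 (\<L> + \<R>)) = -\<gamma> (2\<L> + \<R>)\<close>, with \<open>\<L>\<close>, \<open>\<R>\<close> at \<open>V, W, U\<close> on the left and at
  \<open>U, V, W\<close> on the right of \<open>\<gamma>\<close>.
\<close>

lemma hexR_inverse:
  assumes "x \<in> carrier (Cell1 D (V \<otimes>\<^sub>0 (W \<otimes>\<^sub>0 U)) (U \<otimes>\<^sub>0 (V \<otimes>\<^sub>0 W)))" "fst x = \<gamma>\<langle>V \<otimes>\<^sub>0 W, U\<rangle>"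
    and "x' \<in> carrier (Cell1 D (V \<otimes>\<^sub>0 (W \<otimes>\<^sub>0 U)) (U \<otimes>\<^sub>0 (V \<otimes>\<^sub>0 W)))" "fst x' = \<gamma>\<langle>V \<otimes>\<^sub>0 W, U\<rangle>"
  shows "mod_inv D (V \<otimes>\<^sub>0 (W \<otimes>\<^sub>0 U)) (U \<otimes>\<^sub>0 (V \<otimes>\<^sub>0 W)) x x' (hexR K C \<gamma> t V W U) = hexL K C \<gamma> t U V W"
proof -
  let ?X = "U \<otimes>\<^sub>0 (V \<otimes>\<^sub>0 W)" and ?Y = "V \<otimes>\<^sub>0 (W \<otimes>\<^sub>0 U)" and ?g = "\<gamma>\<langle>U, V \<otimes>\<^sub>0 W\<rangle>"
  interpret XX: module K "Cell2 C ?X ?X" by (rule module_Cell2)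
  interpret XY: module K "Cell2 C ?X ?Y" by (rule module_Cell2)
  interpret YY: module K "Cell2 C ?Y ?Y" by (rule module_Cell2)
  note LR = whiskered_closed(5,6)[of U V W] and LR' = whiskered_closed(5,6)[of V W U]
  note g = gamma3_closed(1)[of U V W] and g' = gamma3_closed(2)[of V W U]
  note gL = comp12_closed[OF g LR(1)] and gR = comp12_closed[OF g LR(2)]
  have inv: "?g \<cdot>\<^sub>1\<^sub>1 \<gamma>\<langle>V \<otimes>\<^sub>0 W, U\<rangle> = \<one>\<^sub>1 ?Y" "\<gamma>\<langle>V \<otimes>\<^sub>0 W, U\<rangle> \<cdot>\<^sub>1\<^sub>1 ?g = \<one>\<^sub>1 ?X"
    using braid_involutive[of U "V \<otimes>\<^sub>0 W"] braid_involutive[of "V \<otimes>\<^sub>0 W" U] by (simp_all add: tens_assoc0)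
  let ?\<xi> = "Lt V W U \<oplus>\<^bsub>Cell2 C ?Y ?Y\<^esub> Rt V W U \<oplus>\<^bsub>Cell2 C ?Y ?Y\<^esub> Rt V W U"
  have \<xi>: "?\<xi> \<in> carrier (Cell2 C ?Y ?Y)"
    using LR' by simp
  have "\<ominus>\<^bsub>Cell2 C ?X ?Y\<^esub> (?\<xi> \<cdot>\<^sub>2\<^sub>1 ?g)
      = ?g \<cdot>\<^sub>1\<^sub>2 (Lt U V W \<oplus>\<^bsub>Cell2 C ?X ?X\<^esub> Lt U V W \<oplus>\<^bsub>Cell2 C ?X ?X\<^esub> Rt U V W)"
    using LR LR' g gL gR
    by (simp add: comp21_rules(2)[where U="?X" and V="?Y"] Lt_Rt_gamma Rt_gamma comp12_rules(1,3)[where U="?X" and V="?X"]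
        XY.M.minus_add XY.M.minus_minus XY.M.a_ac XY.M.r_neg XY.M.r_neg1 XY.M.r_neg2)
  then show ?thesis
    using mod_inv_top[OF assms g' g inv(2) inv(1) \<xi> recip_closed[of 24]]
    by (simp add: hex_cell)
qed

text \<open>
  \<open>(2\<L> + \<R>) \<gamma> = \<gamma> (-2 (\<L> + \<R>) + \<L>) = -\<gamma> (\<L> + 2\<R>)\<close>, now with \<open>W, U, V\<close> on the left of \<open>\<gamma>\<close>.
\<close>

lemma hexL_inverse:
  assumes "x \<in> carrier (Cell1 D (W \<otimes>\<^sub>0 (U \<otimes>\<^sub>0 V)) (U \<otimes>\<^sub>0 (V \<otimes>\<^sub>0 W)))" "fst x = \<gamma>\<langle>W, U \<otimes>\<^sub>0 V\<rangle>"
    and "x' \<in> carrier (Cell1 D (W \<otimes>\<^sub>0 (U \<otimes>\<^sub>0 V)) (U \<otimes>\<^sub>0 (V \<otimes>\<^sub>0 W)))" "fst x' = \<gamma>\<langle>W, U \<otimes>\<^sub>0 V\<rangle>"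
  shows "mod_inv D (W \<otimes>\<^sub>0 (U \<otimes>\<^sub>0 V)) (U \<otimes>\<^sub>0 (V \<otimes>\<^sub>0 W)) x x' (hexL K C \<gamma> t W U V) = hexR K C \<gamma> t U V W"
proof -
  let ?X = "U \<otimes>\<^sub>0 (V \<otimes>\<^sub>0 W)" and ?Y = "W \<otimes>\<^sub>0 (U \<otimes>\<^sub>0 V)" and ?g = "\<gamma>\<langle>U \<otimes>\<^sub>0 V, W\<rangle>"
  interpret XX: module K "Cell2 C ?X ?X" by (rule module_Cell2)
  interpret XY: module K "Cell2 C ?X ?Y" by (rule module_Cell2)
  interpret YY: module K "Cell2 C ?Y ?Y" by (rule module_Cell2)
  note LR = whiskered_closed(5,6)[of U V W] and LR' = whiskered_closed(5,6)[of W U V]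
  note g = gamma3_closed(2)[of U V W] and g' = gamma3_closed(1)[of W U V]
  note gL = comp12_closed[OF g LR(1)] and gR = comp12_closed[OF g LR(2)]
  have inv: "?g \<cdot>\<^sub>1\<^sub>1 \<gamma>\<langle>W, U \<otimes>\<^sub>0 V\<rangle> = \<one>\<^sub>1 ?Y" "\<gamma>\<langle>W, U \<otimes>\<^sub>0 V\<rangle> \<cdot>\<^sub>1\<^sub>1 ?g = \<one>\<^sub>1 ?X"
    using braid_involutive[of W "U \<otimes>\<^sub>0 V"] braid_involutive[of "U \<otimes>\<^sub>0 V" W] by (simp_all add: tens_assoc0)
  let ?\<xi> = "Lt W U V \<oplus>\<^bsub>Cell2 C ?Y ?Y\<^esub> Lt W U V \<oplus>\<^bsub>Cell2 C ?Y ?Y\<^esub> Rt W U V"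
  have \<xi>: "?\<xi> \<in> carrier (Cell2 C ?Y ?Y)"
    using LR' by simp
  have "\<ominus>\<^bsub>Cell2 C ?X ?Y\<^esub> (?\<xi> \<cdot>\<^sub>2\<^sub>1 ?g)
      = ?g \<cdot>\<^sub>1\<^sub>2 (Lt U V W \<oplus>\<^bsub>Cell2 C ?X ?X\<^esub> Rt U V W \<oplus>\<^bsub>Cell2 C ?X ?X\<^esub> Rt U V W)"
    using LR LR' g gL gR
    by (simp add: comp21_rules(2)[where U="?X" and V="?Y"] Lt_Rt_gamma Lt_gamma comp12_rules(1,3)[where U="?X" and V="?X"]
        XY.M.minus_add XY.M.minus_minus XY.M.a_ac XY.M.r_neg XY.M.r_neg1 XY.M.r_neg2)
  then show ?thesis
    using mod_inv_top[OF assms g' g inv(2) inv(1) \<xi> recip_closed[of 24]]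
    by (simp add: hex_cell)
qed

definition gammaT12 :: "'o \<Rightarrow> 'o \<Rightarrow> 'o \<Rightarrow> 'b"
  where "gammaT12 U V W = (\<gamma>\<langle>U, V\<rangle> \<cdot>\<^sub>1\<^sub>2 T U V) \<otimes>\<^sub>2\<^sub>1 \<one>\<^sub>1 W"

definition gammaT23 :: "'o \<Rightarrow> 'o \<Rightarrow> 'o \<Rightarrow> 'b"
  where "gammaT23 U V W = \<one>\<^sub>1 U \<otimes>\<^sub>1\<^sub>2 (\<gamma>\<langle>V, W\<rangle> \<cdot>\<^sub>1\<^sub>2 T V W)"

lemma gammaT_closed:
  "gammaT12 U V W \<in> carrier (Cell2 C (U \<otimes>\<^sub>0 (V \<otimes>\<^sub>0 W)) (V \<otimes>\<^sub>0 (U \<otimes>\<^sub>0 W)))"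
  "gammaT23 U V W \<in> carrier (Cell2 C (U \<otimes>\<^sub>0 (V \<otimes>\<^sub>0 W)) (U \<otimes>\<^sub>0 (W \<otimes>\<^sub>0 V)))"
  using tens21_closed[OF gamma_T_closed[of U V] ident_closed[of W]]
    tens12_closed[OF ident_closed[of U] gamma_T_closed[of V W]]
  by (simp_all add: gammaT12_def gammaT23_def tens_assoc0)

lemma gammaT_factor:
  "gammaT12 U V W = swap12 U V W \<cdot>\<^sub>1\<^sub>2 T12 U V W" "gammaT23 U V W = swap23 U V W \<cdot>\<^sub>1\<^sub>2 T23 U V W"
  using f21_comp12[OF T_closed[of U V] gamma_closed[of U V] ident_closed[of W] ident_closed[of W]]
    f12_comp12[OF ident_closed[of U] ident_closed[of U] T_closed[of V W] gamma_closed[of V W]]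
  by (simp_all add: gammaT12_def gammaT23_def swap12_def swap23_def T12_def T23_def ident_ident)

text \<open>
  Writing the \<open>h\<close>-coefficient of \<open>\<sigma>\<close> as a boundary brings the hexagons into the form of
  \<open>hexagon_expansion\<close>, because whiskering commutes with \<open>\<partial>\<close>.
\<close>

lemma gamma_exp1:
  "\<gamma>\<langle>U, V\<rangle> \<cdot>\<^sub>1\<^sub>1 exp1 U V = recip 2 \<odot>\<^bsub>Cell1 C (U \<otimes>\<^sub>0 V) (V \<otimes>\<^sub>0 U)\<^esub> (\<partial> (\<gamma>\<langle>U, V\<rangle> \<cdot>\<^sub>1\<^sub>2 T U V))"
  using bdry_comp12[OF T_closed gamma_closed, of U V] gamma_closed[of U V] t_closed[of U V] recip_closed[of 2]
  by (simp add: bdry_T exp1_def comp11_rules(5)[where U="U \<otimes>\<^sub>0 V" and V="U \<otimes>\<^sub>0 V" and W="V \<otimes>\<^sub>0 U"])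

lemma gamma_exp1_whiskered:
  "(\<gamma>\<langle>U, V\<rangle> \<cdot>\<^sub>1\<^sub>1 exp1 U V) \<otimes>\<^sub>1\<^sub>1 \<one>\<^sub>1 W
    = recip 2 \<odot>\<^bsub>Cell1 C (U \<otimes>\<^sub>0 (V \<otimes>\<^sub>0 W)) (V \<otimes>\<^sub>0 (U \<otimes>\<^sub>0 W))\<^esub> (\<partial> (gammaT12 U V W))"
  "\<one>\<^sub>1 U \<otimes>\<^sub>1\<^sub>1 (\<gamma>\<langle>V, W\<rangle> \<cdot>\<^sub>1\<^sub>1 exp1 V W)
    = recip 2 \<odot>\<^bsub>Cell1 C (U \<otimes>\<^sub>0 (V \<otimes>\<^sub>0 W)) (U \<otimes>\<^sub>0 (W \<otimes>\<^sub>0 V))\<^esub> (\<partial> (gammaT23 U V W))"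
  using bdry_f21[OF gamma_T_closed[of U V] ident_closed[of W]]
    bdry_f12[OF ident_closed[of U] gamma_T_closed[of V W]]
    tens11_rules(4)[OF recip_closed[of 2] bdry_closed[OF gamma_T_closed[of U V]] ident_closed[of W]]
    tens11_rules(5)[OF recip_closed[of 2] ident_closed[of U] bdry_closed[OF gamma_T_closed[of V W]]]
  by (simp_all add: gamma_exp1 gammaT12_def gammaT23_def tens_assoc0)

lemma sigma_whisker_right:
  obtains p q where
    "p \<in> carrier (Cell1 C (U \<otimes>\<^sub>0 (V \<otimes>\<^sub>0 W)) (V \<otimes>\<^sub>0 (U \<otimes>\<^sub>0 W)))"
    "q \<in> carrier (Cell1 C (U \<otimes>\<^sub>0 (V \<otimes>\<^sub>0 W)) (V \<otimes>\<^sub>0 (U \<otimes>\<^sub>0 W)))"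
    "(sigma K C \<gamma> t)\<langle>U, V\<rangle> \<otimes>\<^sub>1\<^sub>1\<^bsub>D\<^esub> \<one>\<^sub>1\<^bsub>D\<^esub> W = (swap12 U V W,
       recip 2 \<odot>\<^bsub>Cell1 C (U \<otimes>\<^sub>0 (V \<otimes>\<^sub>0 W)) (V \<otimes>\<^sub>0 (U \<otimes>\<^sub>0 W))\<^esub> (\<partial> (gammaT12 U V W)), p)"
    "sigma_inv\<langle>V, U\<rangle> \<otimes>\<^sub>1\<^sub>1\<^bsub>D\<^esub> \<one>\<^sub>1\<^bsub>D\<^esub> W = (swap12 U V W,
       \<ominus>\<^bsub>Cell1 C (U \<otimes>\<^sub>0 (V \<otimes>\<^sub>0 W)) (V \<otimes>\<^sub>0 (U \<otimes>\<^sub>0 W))\<^esub>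
         (recip 2 \<odot>\<^bsub>Cell1 C (U \<otimes>\<^sub>0 (V \<otimes>\<^sub>0 W)) (V \<otimes>\<^sub>0 (U \<otimes>\<^sub>0 W))\<^esub> (\<partial> (gammaT12 U V W))), q)"
proof -
  let ?e = "\<gamma>\<langle>U, V\<rangle> \<cdot>\<^sub>1\<^sub>1 exp1 U V" and ?e2 = "\<gamma>\<langle>U, V\<rangle> \<cdot>\<^sub>1\<^sub>1 exp2 U V"
  interpret M: module K "Cell1 C (U \<otimes>\<^sub>0 V) (V \<otimes>\<^sub>0 U)" by (rule module_Cell1)
  note ty = gamma_closed[of U V] comp11_closed[OF gamma_closed exp_closed(1), of U V]
    comp11_closed[OF gamma_closed exp_closed(2), of U V]
  note e2 = tens11_closed[OF ty(3) ident_closed[of W], unfolded tens_assoc0]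
  have "(\<ominus>\<^bsub>Cell1 C (U \<otimes>\<^sub>0 V) (V \<otimes>\<^sub>0 U)\<^esub> ?e) \<otimes>\<^sub>1\<^sub>1 \<one>\<^sub>1 W
      = \<ominus>\<^bsub>Cell1 C (U \<otimes>\<^sub>0 (V \<otimes>\<^sub>0 W)) (V \<otimes>\<^sub>0 (U \<otimes>\<^sub>0 W))\<^esub> (?e \<otimes>\<^sub>1\<^sub>1 \<one>\<^sub>1 W)"
    using tens11_rules(8)[OF ty(2) ident_closed[of W]] by (simp add: tens_assoc0)
  then show thesis
    using ty by (intro that[OF e2 e2])
      (simp_all add: sigma_cell sigma_inv_cell whisker_right[of _ "U \<otimes>\<^sub>0 V" "V \<otimes>\<^sub>0 U"]
        gamma_exp1_whiskered flip: swap12_def)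
qed

lemma sigma_whisker_left:
  obtains p q where
    "p \<in> carrier (Cell1 C (U \<otimes>\<^sub>0 (V \<otimes>\<^sub>0 W)) (U \<otimes>\<^sub>0 (W \<otimes>\<^sub>0 V)))"
    "q \<in> carrier (Cell1 C (U \<otimes>\<^sub>0 (V \<otimes>\<^sub>0 W)) (U \<otimes>\<^sub>0 (W \<otimes>\<^sub>0 V)))"
    "\<one>\<^sub>1\<^bsub>D\<^esub> U \<otimes>\<^sub>1\<^sub>1\<^bsub>D\<^esub> (sigma K C \<gamma> t)\<langle>V, W\<rangle> = (swap23 U V W,
       recip 2 \<odot>\<^bsub>Cell1 C (U \<otimes>\<^sub>0 (V \<otimes>\<^sub>0 W)) (U \<otimes>\<^sub>0 (W \<otimes>\<^sub>0 V))\<^esub> (\<partial> (gammaT23 U V W)), p)"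
    "\<one>\<^sub>1\<^bsub>D\<^esub> U \<otimes>\<^sub>1\<^sub>1\<^bsub>D\<^esub> sigma_inv\<langle>W, V\<rangle> = (swap23 U V W,
       \<ominus>\<^bsub>Cell1 C (U \<otimes>\<^sub>0 (V \<otimes>\<^sub>0 W)) (U \<otimes>\<^sub>0 (W \<otimes>\<^sub>0 V))\<^esub>
         (recip 2 \<odot>\<^bsub>Cell1 C (U \<otimes>\<^sub>0 (V \<otimes>\<^sub>0 W)) (U \<otimes>\<^sub>0 (W \<otimes>\<^sub>0 V))\<^esub> (\<partial> (gammaT23 U V W))), q)"
proof -
  let ?e = "\<gamma>\<langle>V, W\<rangle> \<cdot>\<^sub>1\<^sub>1 exp1 V W" and ?e2 = "\<gamma>\<langle>V, W\<rangle> \<cdot>\<^sub>1\<^sub>1 exp2 V W"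
  interpret M: module K "Cell1 C (V \<otimes>\<^sub>0 W) (W \<otimes>\<^sub>0 V)" by (rule module_Cell1)
  note ty = gamma_closed[of V W] comp11_closed[OF gamma_closed exp_closed(1), of V W]
    comp11_closed[OF gamma_closed exp_closed(2), of V W]
  note e2 = tens11_closed[OF ident_closed[of U] ty(3)]
  note neg = tens11_rules(9)[OF ident_closed[of U] ty(2)]
  show thesis
    using ty neg by (intro that[OF e2 e2])
      (simp_all add: sigma_cell sigma_inv_cell whisker_left[of _ "V \<otimes>\<^sub>0 W" "W \<otimes>\<^sub>0 V"]
        gamma_exp1_whiskered flip: swap23_def)
qed

lemma Sig_whiskered:
  "Sig U V \<otimes>\<^sub>2\<^sub>1\<^bsub>D\<^esub> \<one>\<^sub>1\<^bsub>D\<^esub> W = (\<zero>\<^bsub>Cell2 C (U \<otimes>\<^sub>0 (V \<otimes>\<^sub>0 W)) (V \<otimes>\<^sub>0 (U \<otimes>\<^sub>0 W))\<^esub>, gammaT12 U V W,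
     \<zero>\<^bsub>Cell2 C (U \<otimes>\<^sub>0 (V \<otimes>\<^sub>0 W)) (V \<otimes>\<^sub>0 (U \<otimes>\<^sub>0 W))\<^esub>)"
  "\<one>\<^sub>1\<^bsub>D\<^esub> U \<otimes>\<^sub>1\<^sub>2\<^bsub>D\<^esub> Sig V W = (\<zero>\<^bsub>Cell2 C (U \<otimes>\<^sub>0 (V \<otimes>\<^sub>0 W)) (U \<otimes>\<^sub>0 (W \<otimes>\<^sub>0 V))\<^esub>, gammaT23 U V W,
     \<zero>\<^bsub>Cell2 C (U \<otimes>\<^sub>0 (V \<otimes>\<^sub>0 W)) (U \<otimes>\<^sub>0 (W \<otimes>\<^sub>0 V))\<^esub>)"
  unfolding Sig_cell whisker2_right[OF gamma_T_closed] whisker2_left[OF gamma_T_closed]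
  by (simp_all add: gammaT12_def gammaT23_def tens_assoc0)

lemma gamma_T_split:
  "\<gamma>\<langle>U, V \<otimes>\<^sub>0 W\<rangle> \<cdot>\<^sub>1\<^sub>2 T U (V \<otimes>\<^sub>0 W) = swap23 V U W \<cdot>\<^sub>1\<^sub>2 gammaT12 U V W
    \<oplus>\<^bsub>Cell2 C (U \<otimes>\<^sub>0 (V \<otimes>\<^sub>0 W)) (V \<otimes>\<^sub>0 (W \<otimes>\<^sub>0 U))\<^esub> gammaT23 V U W \<cdot>\<^sub>2\<^sub>1 swap12 U V W"
  "\<gamma>\<langle>U \<otimes>\<^sub>0 V, W\<rangle> \<cdot>\<^sub>1\<^sub>2 T (U \<otimes>\<^sub>0 V) W = swap12 U W V \<cdot>\<^sub>1\<^sub>2 gammaT23 U V W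
    \<oplus>\<^bsub>Cell2 C (U \<otimes>\<^sub>0 (V \<otimes>\<^sub>0 W)) (W \<otimes>\<^sub>0 (U \<otimes>\<^sub>0 V))\<^esub> gammaT12 U W V \<cdot>\<^sub>2\<^sub>1 swap23 U V W"
  using split_across[OF whiskered_closed(1)[of U V W] whiskered_closed(1)[of V U W] swap_inverse(1)
      whiskered_closed(2) whiskered_closed(3) whiskered_closed(4)]
    split_across[OF whiskered_closed(2)[of U V W] whiskered_closed(2)[of U W V] swap_inverse(2)
      whiskered_closed(1) whiskered_closed(4) whiskered_closed(3)]
  by (simp_all add: hexagon_right hexagon_left gammaT_factor
      T_right[folded swap12_def T12_def T23_def, unfolded tens_assoc0]
      T_left[folded swap23_def T12_def T23_def, unfolded tens_assoc0])

lemma hex_top_closed: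
  obtains HL HR where "HL \<in> carrier (Cell2 C (U \<otimes>\<^sub>0 (V \<otimes>\<^sub>0 W)) (V \<otimes>\<^sub>0 (W \<otimes>\<^sub>0 U)))"
    "HR \<in> carrier (Cell2 C (U \<otimes>\<^sub>0 (V \<otimes>\<^sub>0 W)) (W \<otimes>\<^sub>0 (U \<otimes>\<^sub>0 V)))"
    "hexL K C \<gamma> t U V W = (\<zero>\<^bsub>Cell2 C (U \<otimes>\<^sub>0 (V \<otimes>\<^sub>0 W)) (V \<otimes>\<^sub>0 (W \<otimes>\<^sub>0 U))\<^esub>,
       \<zero>\<^bsub>Cell2 C (U \<otimes>\<^sub>0 (V \<otimes>\<^sub>0 W)) (V \<otimes>\<^sub>0 (W \<otimes>\<^sub>0 U))\<^esub>, HL)"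
    "hexR K C \<gamma> t U V W = (\<zero>\<^bsub>Cell2 C (U \<otimes>\<^sub>0 (V \<otimes>\<^sub>0 W)) (W \<otimes>\<^sub>0 (U \<otimes>\<^sub>0 V))\<^esub>,
       \<zero>\<^bsub>Cell2 C (U \<otimes>\<^sub>0 (V \<otimes>\<^sub>0 W)) (W \<otimes>\<^sub>0 (U \<otimes>\<^sub>0 V))\<^esub>, HR)"
proof -
  interpret M: module K "Cell2 C (U \<otimes>\<^sub>0 (V \<otimes>\<^sub>0 W)) (U \<otimes>\<^sub>0 (V \<otimes>\<^sub>0 W))" by (rule module_Cell2)
  interpret L: module K "Cell2 C (U \<otimes>\<^sub>0 (V \<otimes>\<^sub>0 W)) (V \<otimes>\<^sub>0 (W \<otimes>\<^sub>0 U))" by (rule module_Cell2)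
  interpret R: module K "Cell2 C (U \<otimes>\<^sub>0 (V \<otimes>\<^sub>0 W)) (W \<otimes>\<^sub>0 (U \<otimes>\<^sub>0 V))" by (rule module_Cell2)
  note LR = whiskered_closed(5,6)[of U V W]
  show thesis
    by (rule that[OF _ _ hex_cell])
      (use LR recip_closed[of 24] comp12_closed[OF gamma3_closed(1)[of U V W]]
        comp12_closed[OF gamma3_closed(2)[of U V W]] in simp_all)
qed

lemma Sig_hexL:
  "hexL K C \<gamma> t U V W =
     alpha K C t V W U \<cdot>\<^sub>1\<^sub>2\<^bsub>D\<^esub> Sig U (V \<otimes>\<^sub>0 W) \<cdot>\<^sub>2\<^sub>1\<^bsub>D\<^esub> alpha K C t U V W
     \<oplus>\<^bsub>Cell2 D (U \<otimes>\<^sub>0 (V \<otimes>\<^sub>0 W)) (V \<otimes>\<^sub>0 (W \<otimes>\<^sub>0 U))\<^esub> hexL K C \<gamma> t U V W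
     \<ominus>\<^bsub>Cell2 D (U \<otimes>\<^sub>0 (V \<otimes>\<^sub>0 W)) (V \<otimes>\<^sub>0 (W \<otimes>\<^sub>0 U))\<^esub>
       (\<one>\<^sub>1\<^bsub>D\<^esub> V \<otimes>\<^sub>1\<^sub>1\<^bsub>D\<^esub> sigma_inv\<langle>W, U\<rangle>) \<cdot>\<^sub>1\<^sub>1\<^bsub>D\<^esub> alpha K C t V U W \<cdot>\<^sub>1\<^sub>2\<^bsub>D\<^esub> (Sig U V \<otimes>\<^sub>2\<^sub>1\<^bsub>D\<^esub> \<one>\<^sub>1\<^bsub>D\<^esub> W)
     \<ominus>\<^bsub>Cell2 D (U \<otimes>\<^sub>0 (V \<otimes>\<^sub>0 W)) (V \<otimes>\<^sub>0 (W \<otimes>\<^sub>0 U))\<^esub>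
       (\<one>\<^sub>1\<^bsub>D\<^esub> V \<otimes>\<^sub>1\<^sub>2\<^bsub>D\<^esub> Sig U W) \<cdot>\<^sub>2\<^sub>1\<^bsub>D\<^esub> alpha K C t V U W \<cdot>\<^sub>2\<^sub>1\<^bsub>D\<^esub>
         ((sigma K C \<gamma> t)\<langle>U, V\<rangle> \<otimes>\<^sub>1\<^sub>1\<^bsub>D\<^esub> \<one>\<^sub>1\<^bsub>D\<^esub> W)"
proof -
  let ?X = "U \<otimes>\<^sub>0 (V \<otimes>\<^sub>0 W)" and ?Y = "V \<otimes>\<^sub>0 (W \<otimes>\<^sub>0 U)" and ?Z = "V \<otimes>\<^sub>0 (U \<otimes>\<^sub>0 W)"
  obtain aX where aX: "aX \<in> carrier (Cell1 C ?X ?X)"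
    "alpha K C t U V W = (\<one>\<^sub>1 ?X, \<zero>\<^bsub>Cell1 C ?X ?X\<^esub>, aX)"
    by (rule alpha_cell)
  obtain aY where aY: "aY \<in> carrier (Cell1 C ?Y ?Y)"
    "alpha K C t V W U = (\<one>\<^sub>1 ?Y, \<zero>\<^bsub>Cell1 C ?Y ?Y\<^esub>, aY)"
    by (rule alpha_cell)
  obtain aZ where aZ: "aZ \<in> carrier (Cell1 C ?Z ?Z)"
    "alpha K C t V U W = (\<one>\<^sub>1 ?Z, \<zero>\<^bsub>Cell1 C ?Z ?Z\<^esub>, aZ)"
    by (rule alpha_cell)
  obtain H where H: "H \<in> carrier (Cell2 C ?X ?Y)"
    "hexL K C \<gamma> t U V W = (\<zero>\<^bsub>Cell2 C ?X ?Y\<^esub>, \<zero>\<^bsub>Cell2 C ?X ?Y\<^esub>, H)"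
    by (rule hex_top_closed[of U V W])
  obtain p where p: "p \<in> carrier (Cell1 C ?X ?Z)" "(sigma K C \<gamma> t)\<langle>U, V\<rangle> \<otimes>\<^sub>1\<^sub>1\<^bsub>D\<^esub> \<one>\<^sub>1\<^bsub>D\<^esub> W
      = (swap12 U V W, recip 2 \<odot>\<^bsub>Cell1 C ?X ?Z\<^esub> (\<partial> (gammaT12 U V W)), p)"
    by (rule sigma_whisker_right[of U V W])
  obtain q where q: "q \<in> carrier (Cell1 C ?Z ?Y)" "\<one>\<^sub>1\<^bsub>D\<^esub> V \<otimes>\<^sub>1\<^sub>1\<^bsub>D\<^esub> sigma_inv\<langle>W, U\<rangle>
      = (swap23 V U W, \<ominus>\<^bsub>Cell1 C ?Z ?Y\<^esub> (recip 2 \<odot>\<^bsub>Cell1 C ?Z ?Y\<^esub> (\<partial> (gammaT23 V U W))), q)"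
    by (rule sigma_whisker_left[of V U W])
  have Sig: "Sig U (V \<otimes>\<^sub>0 W) = (\<zero>\<^bsub>Cell2 C ?X ?Y\<^esub>, swap23 V U W \<cdot>\<^sub>1\<^sub>2 gammaT12 U V W
      \<oplus>\<^bsub>Cell2 C ?X ?Y\<^esub> gammaT23 V U W \<cdot>\<^sub>2\<^sub>1 swap12 U V W, \<zero>\<^bsub>Cell2 C ?X ?Y\<^esub>)"
    unfolding Sig_cell gamma_T_split by (simp add: tens_assoc0)
  show ?thesis
    unfolding aX(2) aY(2) aZ(2) H(2) p(2) q(2) Sig Sig_whiskered
    by (rule hexagon_expansion[OF aX(1) aY(1) aZ(1) whiskered_closed(1) p(1) whiskered_closed(2) q(1)
          gammaT_closed(2,1) H(1) recip_closed]) simp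
qed

lemma Sig_hexR:
  "hexR K C \<gamma> t U V W =
     inv1 D (alpha K C t W U V) \<cdot>\<^sub>1\<^sub>2\<^bsub>D\<^esub> Sig (U \<otimes>\<^sub>0 V) W \<cdot>\<^sub>2\<^sub>1\<^bsub>D\<^esub> inv1 D (alpha K C t U V W)
     \<oplus>\<^bsub>Cell2 D (U \<otimes>\<^sub>0 (V \<otimes>\<^sub>0 W)) (W \<otimes>\<^sub>0 (U \<otimes>\<^sub>0 V))\<^esub> hexR K C \<gamma> t U V W
     \<ominus>\<^bsub>Cell2 D (U \<otimes>\<^sub>0 (V \<otimes>\<^sub>0 W)) (W \<otimes>\<^sub>0 (U \<otimes>\<^sub>0 V))\<^esub>
       (sigma_inv\<langle>W, U\<rangle> \<otimes>\<^sub>1\<^sub>1\<^bsub>D\<^esub> \<one>\<^sub>1\<^bsub>D\<^esub> V) \<cdot>\<^sub>1\<^sub>1\<^bsub>D\<^esub> inv1 D (alpha K C t U W V) \<cdot>\<^sub>1\<^sub>2\<^bsub>D\<^esub>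
         (\<one>\<^sub>1\<^bsub>D\<^esub> U \<otimes>\<^sub>1\<^sub>2\<^bsub>D\<^esub> Sig V W)
     \<ominus>\<^bsub>Cell2 D (U \<otimes>\<^sub>0 (V \<otimes>\<^sub>0 W)) (W \<otimes>\<^sub>0 (U \<otimes>\<^sub>0 V))\<^esub>
       (Sig U W \<otimes>\<^sub>2\<^sub>1\<^bsub>D\<^esub> \<one>\<^sub>1\<^bsub>D\<^esub> V) \<cdot>\<^sub>2\<^sub>1\<^bsub>D\<^esub> inv1 D (alpha K C t U W V) \<cdot>\<^sub>2\<^sub>1\<^bsub>D\<^esub>
         (\<one>\<^sub>1\<^bsub>D\<^esub> U \<otimes>\<^sub>1\<^sub>1\<^bsub>D\<^esub> (sigma K C \<gamma> t)\<langle>V, W\<rangle>)"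
proof -
  let ?X = "U \<otimes>\<^sub>0 (V \<otimes>\<^sub>0 W)" and ?Y = "W \<otimes>\<^sub>0 (U \<otimes>\<^sub>0 V)" and ?Z = "U \<otimes>\<^sub>0 (W \<otimes>\<^sub>0 V)"
  obtain aX where aX: "aX \<in> carrier (Cell1 C ?X ?X)"
    "inv1 D (alpha K C t U V W) = (\<one>\<^sub>1 ?X, \<zero>\<^bsub>Cell1 C ?X ?X\<^esub>, aX)"
    by (rule alpha_inv_cell)
  obtain aY where aY: "aY \<in> carrier (Cell1 C ?Y ?Y)"
    "inv1 D (alpha K C t W U V) = (\<one>\<^sub>1 ?Y, \<zero>\<^bsub>Cell1 C ?Y ?Y\<^esub>, aY)"
    by (rule alpha_inv_cell)
  obtain aZ where aZ: "aZ \<in> carrier (Cell1 C ?Z ?Z)"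
    "inv1 D (alpha K C t U W V) = (\<one>\<^sub>1 ?Z, \<zero>\<^bsub>Cell1 C ?Z ?Z\<^esub>, aZ)"
    by (rule alpha_inv_cell)
  obtain H where H: "H \<in> carrier (Cell2 C ?X ?Y)"
    "hexR K C \<gamma> t U V W = (\<zero>\<^bsub>Cell2 C ?X ?Y\<^esub>, \<zero>\<^bsub>Cell2 C ?X ?Y\<^esub>, H)"
    by (rule hex_top_closed[of U V W])
  obtain p where p: "p \<in> carrier (Cell1 C ?X ?Z)" "\<one>\<^sub>1\<^bsub>D\<^esub> U \<otimes>\<^sub>1\<^sub>1\<^bsub>D\<^esub> (sigma K C \<gamma> t)\<langle>V, W\<rangle>
      = (swap23 U V W, recip 2 \<odot>\<^bsub>Cell1 C ?X ?Z\<^esub> (\<partial> (gammaT23 U V W)), p)"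
    by (rule sigma_whisker_left[of U V W])
  obtain q where q: "q \<in> carrier (Cell1 C ?Z ?Y)" "sigma_inv\<langle>W, U\<rangle> \<otimes>\<^sub>1\<^sub>1\<^bsub>D\<^esub> \<one>\<^sub>1\<^bsub>D\<^esub> V
      = (swap12 U W V, \<ominus>\<^bsub>Cell1 C ?Z ?Y\<^esub> (recip 2 \<odot>\<^bsub>Cell1 C ?Z ?Y\<^esub> (\<partial> (gammaT12 U W V))), q)"
    by (rule sigma_whisker_right[of U W V])
  have Sig: "Sig (U \<otimes>\<^sub>0 V) W = (\<zero>\<^bsub>Cell2 C ?X ?Y\<^esub>, swap12 U W V \<cdot>\<^sub>1\<^sub>2 gammaT23 U V W
      \<oplus>\<^bsub>Cell2 C ?X ?Y\<^esub> gammaT12 U W V \<cdot>\<^sub>2\<^sub>1 swap23 U V W, \<zero>\<^bsub>Cell2 C ?X ?Y\<^esub>)"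
    unfolding Sig_cell gamma_T_split by (simp add: tens_assoc0)
  show ?thesis
    unfolding aX(2) aY(2) aZ(2) H(2) p(2) q(2) Sig Sig_whiskered
    by (rule hexagon_expansion[OF aX(1) aY(1) aZ(1) whiskered_closed(2) p(1) whiskered_closed(1) q(1)
          gammaT_closed(1,2) H(1) recip_closed]) simp
qed

theorem symmetric_syllepsis_Sig:
  "symmetric_syllepsis D (alpha K C t) (sigma K C \<gamma> t) (hexL K C \<gamma> t) (hexR K C \<gamma> t) Sig"
proof (unfold_locales, goal_cases)
  case (1 U V W)
  show ?case
    using alpha_inverse[of U V W] by (simp add: tens_assoc0)
next
  case (2 U V)
  show ?case
    unfolding invertible1_def hcat_simps(8)
    using sigma_closed[of U V] hinverse_exists[OF sigma_closed gamma_closed sigma_inverse_pair, of U V]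
    by blast
next
  case (3 U V)
  show ?case
    using gamma_T_closed[of U V] unfolding Sig_cell by simp
next
  case (4 U V)
  show ?case
    using bdry_Sig[of U V] by (simp only: hcat_simps)
next
  case (5 f U U' g V V')
  then show ?case
    using Sig_htpy[of f U U' g V V'] by (simp only: hcat_simps)
next
  case (6 U V W)
  let ?X = "U \<otimes>\<^sub>0 (V \<otimes>\<^sub>0 W)" and ?Y = "V \<otimes>\<^sub>0 (W \<otimes>\<^sub>0 U)" and ?Z = "V \<otimes>\<^sub>0 (U \<otimes>\<^sub>0 W)"
  let ?x = "inv1 D (alpha K C t U V W) \<cdot>\<^sub>1\<^sub>1\<^bsub>D\<^esub> (sigma K C \<gamma> t)\<langle>V \<otimes>\<^sub>0 W, U\<rangle> \<cdot>\<^sub>1\<^sub>1\<^bsub>D\<^esub> inv1 D (alpha K C t V W U)"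
  let ?x' = "((sigma K C \<gamma> t)\<langle>V, U\<rangle> \<otimes>\<^sub>1\<^sub>1\<^bsub>D\<^esub> \<one>\<^sub>1\<^bsub>D\<^esub> W) \<cdot>\<^sub>1\<^sub>1\<^bsub>D\<^esub> inv1 D (alpha K C t V U W) \<cdot>\<^sub>1\<^sub>1\<^bsub>D\<^esub>
    (\<one>\<^sub>1\<^bsub>D\<^esub> V \<otimes>\<^sub>1\<^sub>1\<^bsub>D\<^esub> (sigma K C \<gamma> t)\<langle>W, U\<rangle>)"
  have s: "(sigma K C \<gamma> t)\<langle>V \<otimes>\<^sub>0 W, U\<rangle> \<in> carrier (Cell1 D ?Y ?X)"
    by (rule sigma_closed[of "V \<otimes>\<^sub>0 W" U, unfolded tens_assoc0])
  have s1: "(sigma K C \<gamma> t)\<langle>V, U\<rangle> \<otimes>\<^sub>1\<^sub>1\<^bsub>D\<^esub> \<one>\<^sub>1\<^bsub>D\<^esub> W \<in> carrier (Cell1 D ?Z ?X)"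
    by (rule htens11_closed[OF sigma_closed hident_closed, of V U W, unfolded tens_assoc0])
  have s2: "\<one>\<^sub>1\<^bsub>D\<^esub> V \<otimes>\<^sub>1\<^sub>1\<^bsub>D\<^esub> (sigma K C \<gamma> t)\<langle>W, U\<rangle> \<in> carrier (Cell1 D ?Y ?Z)"
    by (rule htens11_closed[OF hident_closed sigma_closed, of V W U])
  have x: "?x \<in> carrier (Cell1 D ?Y ?X)" and x': "?x' \<in> carrier (Cell1 D ?Y ?X)"
    by (rule hcomp11_closed alpha_closed s s1 s2)+
  have "fst ?x = \<gamma>\<langle>V \<otimes>\<^sub>0 W, U\<rangle>"
    using ident11[OF gamma3_closed(2)[of V W U]] by (simp add: fst_hcomp11 alpha_closed sigma_cell)
  moreover have "fst ?x' = \<gamma>\<langle>V \<otimes>\<^sub>0 W, U\<rangle>"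
    using ident11[OF whiskered_closed(1)[of V U W]]
    by (simp add: fst_hcomp11 fst_htens11 alpha_closed sigma_cell hident hexagon_left flip: swap12_def swap23_def)
  ultimately have "mod_inv D ?Y ?X ?x ?x' (hexR K C \<gamma> t V W U) = hexL K C \<gamma> t U V W"
    using x x' by (intro hexR_inverse)
  then show ?case
    using Sig_hexL[of U V W] by (simp only: hcat_simps tens_assoc0)
next
  case (7 U V W)
  show ?case
  proof -
    let ?X = "U \<otimes>\<^sub>0 (V \<otimes>\<^sub>0 W)" and ?Y = "W \<otimes>\<^sub>0 (U \<otimes>\<^sub>0 V)" and ?Z = "U \<otimes>\<^sub>0 (W \<otimes>\<^sub>0 V)"
    let ?x = "alpha K C t U V W \<cdot>\<^sub>1\<^sub>1\<^bsub>D\<^esub> (sigma K C \<gamma> t)\<langle>W, U \<otimes>\<^sub>0 V\<rangle> \<cdot>\<^sub>1\<^sub>1\<^bsub>D\<^esub> alpha K C t W U V"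
    let ?x' = "(\<one>\<^sub>1\<^bsub>D\<^esub> U \<otimes>\<^sub>1\<^sub>1\<^bsub>D\<^esub> (sigma K C \<gamma> t)\<langle>W, V\<rangle>) \<cdot>\<^sub>1\<^sub>1\<^bsub>D\<^esub> alpha K C t U W V \<cdot>\<^sub>1\<^sub>1\<^bsub>D\<^esub>
      ((sigma K C \<gamma> t)\<langle>W, U\<rangle> \<otimes>\<^sub>1\<^sub>1\<^bsub>D\<^esub> \<one>\<^sub>1\<^bsub>D\<^esub> V)"
    have s: "(sigma K C \<gamma> t)\<langle>W, U \<otimes>\<^sub>0 V\<rangle> \<in> carrier (Cell1 D ?Y ?X)"
      by (rule sigma_closed[of W "U \<otimes>\<^sub>0 V", unfolded tens_assoc0])
    have s1: "(sigma K C \<gamma> t)\<langle>W, U\<rangle> \<otimes>\<^sub>1\<^sub>1\<^bsub>D\<^esub> \<one>\<^sub>1\<^bsub>D\<^esub> V \<in> carrier (Cell1 D ?Y ?Z)"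
      by (rule htens11_closed[OF sigma_closed hident_closed, of W U V, unfolded tens_assoc0])
    have s2: "\<one>\<^sub>1\<^bsub>D\<^esub> U \<otimes>\<^sub>1\<^sub>1\<^bsub>D\<^esub> (sigma K C \<gamma> t)\<langle>W, V\<rangle> \<in> carrier (Cell1 D ?Z ?X)"
      by (rule htens11_closed[OF hident_closed sigma_closed, of U W V])
    have x: "?x \<in> carrier (Cell1 D ?Y ?X)" and x': "?x' \<in> carrier (Cell1 D ?Y ?X)"
      by (rule hcomp11_closed alpha_closed s s1 s2)+
    have "fst ?x = \<gamma>\<langle>W, U \<otimes>\<^sub>0 V\<rangle>"
      using ident11[OF gamma3_closed(1)[of W U V]] by (simp add: fst_hcomp11 alpha_closed sigma_cell)
    moreover have "fst ?x' = \<gamma>\<langle>W, U \<otimes>\<^sub>0 V\<rangle>"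
      using ident11[OF whiskered_closed(2)[of U W V]]
      by (simp add: fst_hcomp11 fst_htens11 alpha_closed sigma_cell hident hexagon_right
          flip: swap12_def swap23_def)
    ultimately have "mod_inv D ?Y ?X ?x ?x' (hexL K C \<gamma> t W U V) = hexR K C \<gamma> t U V W"
      using x x' by (intro hexL_inverse)
    then show ?thesis
      using Sig_hexR[of U V W] by (simp only: hcat_simps tens_assoc0)
  qed
next
  case (8 U V)
  show ?case
    using Sig_symmetric[of U V] by (simp only: hcat_simps)
qed

end


theorem mainTheorem4:
  fixes K :: "('k, 'y) ring_scheme"
    and C :: "('o, 'k, 'a, 'b) ch_mon_cat"
    and \<gamma> t :: "('o, 'a, 'b) ptrans"
    and T :: "'o \<Rightarrow> 'o \<Rightarrow> 'b"
  assumes "field K"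
    and "\<And>n :: nat. 0 < n \<Longrightarrow> [n] \<cdot>\<^bsub>K\<^esub> \<one>\<^bsub>K\<^esub> \<noteq> \<zero>\<^bsub>K\<^esub>"
    and "sym_strict_monoidal K C \<gamma>"
    and "infinitesimal_2_braiding K C \<gamma> t"
    and "strict_i2b K C \<gamma> t"
    and "totally_symmetric_i2b K C \<gamma> t"
    and "coherent_i2b K C \<gamma> t"
    and "coboundary_syllepsis K C \<gamma> t T"
  shows "symmetric_syllepsis (hcat C) (alpha K C t) (sigma K C \<gamma> t) (hexL K C \<gamma> t) (hexR K C \<gamma> t)
    (\<lambda>U V. h_over K 1 \<odot>\<^bsub>Cell2 (hcat C) (U \<otimes>\<^sub>0\<^bsub>C\<^esub> V) (V \<otimes>\<^sub>0\<^bsub>C\<^esub> U)\<^esub>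
       ((gamma_h C \<gamma>)\<langle>U, V\<rangle> \<cdot>\<^sub>1\<^sub>2\<^bsub>hcat C\<^esub> hconst2 C (T U V)))"
proof -
  interpret deformation K C \<gamma> t T
    by (intro deformation.intro extended_category.intro deformation_axioms.intro assms)
  show ?thesis
    by (rule symmetric_syllepsis_Sig)
qed

end
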